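(* Fix $d\geq 3$, $1<p<\infty$, and $0<s<\frac dp$, and let $\Omega\subset\mathbb{R}^d$ be the complement of a compact convex body $\Omega^c$ with smooth boundary. Then for any $f\in C_c^{\infty}(\Omega)$, $$\biggl\|\frac{f(x)}{\operatorname{dist}(x,\Omega^c)^s}\biggr\|_{L^p(\Omega)}\lesssim \bigl\||\nabla|^s f\bigr\|_{L^p(\mathbb{R}^d)}.$$
   Context: $|\nabla|^s=(-\Delta_{\mathbb{R}^d})^{s/2}$ is the Fourier multiplier $|\xi|^s$ on $\mathbb{R}^d$, applied to $f$ extended by zero to $\mathbb{R}^d$. $A\lesssim B$ means $A\le CB$ with $C$ depending only on $d,p,s,\Omega$, not on $f$. *)

theory Defs
  imports "HOL-Analysis.Analysis"
begin

text \<open>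
  Continuous differentiability of order \<open>n\<close>; meaningful for open \<open>U\<close>, where all directional
  derivatives of order at most \<open>n\<close> are required to exist (as Frechet derivatives) and to be
  continuous.
\<close>

primrec Ck_on :: "nat \<Rightarrow> ('a::euclidean_space \<Rightarrow> 'b::real_normed_vector) \<Rightarrow> 'a set \<Rightarrow> bool" where
  "Ck_on 0 f U \<longleftrightarrow> continuous_on U f"
| "Ck_on (Suc n) f U \<longleftrightarrow>
     (\<forall>x\<in>U. f differentiable at x) \<and> (\<forall>v. Ck_on n (\<lambda>x. frechet_derivative f (at x) v) U)"

definition smooth_on :: "('a::euclidean_space \<Rightarrow> 'b::real_normed_vector) \<Rightarrow> 'a set \<Rightarrow> bool" where
  "smooth_on f U \<longleftrightarrow> (\<forall>n. Ck_on n f U)"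

text \<open>
  An element of \<open>C\<^sub>c\<^sup>\<infinity>(\<Omega>)\<close> is represented by its extension by zero to the whole space.
\<close>

definition test_functions :: "'a::euclidean_space set \<Rightarrow> ('a \<Rightarrow> complex) set" where
  "test_functions \<Omega> =
     {f. smooth_on f UNIV \<and> compact (closure {x. f x \<noteq> 0}) \<and> closure {x. f x \<noteq> 0} \<subseteq> \<Omega>}"

definition smooth_hypersurface :: "'a::euclidean_space set \<Rightarrow> bool" where
  "smooth_hypersurface S \<longleftrightarrow>
     (\<forall>x\<in>S. \<exists>U (\<phi> :: 'a \<Rightarrow> real). open U \<and> x \<in> U \<and> smooth_on \<phi> U \<and>
        (\<forall>y\<in>U. frechet_derivative \<phi> (at y) \<noteq> (\<lambda>v. 0)) \<and> S \<inter> U = {y \<in> U. \<phi> y = 0})"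

definition smooth_convex_body :: "'a::euclidean_space set \<Rightarrow> bool" where
  "smooth_convex_body K \<longleftrightarrow>
     compact K \<and> convex K \<and> interior K \<noteq> {} \<and> smooth_hypersurface (frontier K)"

text \<open>
  The Fourier transform and its inverse in the unitary normalisation, as absolutely convergent
  integrals.
\<close>

definition fourier :: "('a::euclidean_space \<Rightarrow> complex) \<Rightarrow> 'a \<Rightarrow> complex" where
  "fourier f \<xi> =
     of_real ((2 * pi) powr (- real DIM('a) / 2)) * (LINT x|lborel. cis (- (x \<bullet> \<xi>)) * f x)"

definition inverse_fourier :: "('a::euclidean_space \<Rightarrow> complex) \<Rightarrow> 'a \<Rightarrow> complex" where
  "inverse_fourier g x =
     of_real ((2 * pi) powr (- real DIM('a) / 2)) * (LINT \<xi>|lborel. cis (x \<bullet> \<xi>) * g \<xi>)"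

text \<open>
  For a test function \<open>f\<close> and \<open>s > 0\<close> the function \<open>|\<xi>|\<^sup>s fourier f \<xi>\<close> is integrable, so the
  multiplier operator is given pointwise by the inversion integral.
\<close>

definition abs_nabla_powr :: "real \<Rightarrow> ('a::euclidean_space \<Rightarrow> complex) \<Rightarrow> 'a \<Rightarrow> complex" where
  "abs_nabla_powr s f = inverse_fourier (\<lambda>\<xi>. of_real (norm \<xi> powr s) * fourier f \<xi>)"

text \<open>
  The \<open>L\<^sup>p\<close> norm for \<open>0 < p < \<infinity>\<close>, with value \<open>\<infinity>\<close> when the integral diverges.
\<close>

definition Lp_norm :: "real \<Rightarrow> 'a measure \<Rightarrow> ('a \<Rightarrow> 'b::real_normed_vector) \<Rightarrow> ennreal" where
  "Lp_norm p M f =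
     (let I = (\<integral>\<^sup>+x. ennreal (norm (f x) powr p) \<partial>M)
      in if I = \<infinity> then \<infinity> else ennreal (enn2real I powr (1 / p)))"

end

theory Submission
  imports Defs "HOL-Probability.Probability" "HOL-Complex_Analysis.Complex_Analysis"
begin

text \<open>
  Write \<open>K = - \<Omega>\<close> for the obstacle, \<open>\<delta>\<close> for the distance to \<open>K\<close>, \<open>d\<close> for the dimension and
  \<open>g = |\<nabla>|\<^sup>s f\<close>. On the Fourier side \<open>|\<xi>|\<^sup>s \<integral>\<^sub>0\<^sup>\<infinity> \<rho>^(s-1) exp (- \<rho>\<^sup>2 |\<xi>|\<^sup>2 / 2) d\<rho>\<close> does not depend
  on \<open>\<xi> \<noteq> 0\<close>, so that a constant multiple of \<open>f\<close> is \<open>\<integral>\<^sub>0\<^sup>\<infinity> \<rho>^(s-1) G\<^sub>\<rho> g d\<rho>\<close>, where \<open>G\<^sub>\<rho>\<close> is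
  convolution with the Gaussian of width \<open>\<rho>\<close> (\<open>test_function_eq_heat_integral\<close>). Since \<open>|G\<^sub>\<rho> g|\<close> is
  bounded by the Hardy--Littlewood maximal function \<open>M g\<close>, the scales \<open>\<rho> < \<delta>\<close> contribute at most
  \<open>C \<delta>\<^sup>s M g\<close>. The scales \<open>\<rho> > \<delta>\<close> are where the vanishing of
  \<open>f\<close> on \<open>K\<close> and the condition \<open>s < d/p\<close> enter.

  Near \<open>K\<close> the vanishing is used. A convex \<open>K\<close> containing a ball is thick at every scale:
  for small \<open>\<delta> x\<close> there is a ball of steps \<open>h\<close>, whose radius and distance from \<open>0\<close>
  are comparable to \<open>\<delta> x\<close>, such that
  \<open>x + h, x + 2h, \<dots>, x + mh\<close> all lie in \<open>K\<close> (\<open>convex_obstacle_shift\<close>). Hence \<open>f x\<close> is an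
  \<open>m\<close>-th difference of \<open>f\<close>. Differencing the Gaussian of width \<open>\<rho>\<close> gains \<open>(\<delta>/\<rho>)\<^sup>m\<close>, and with
  \<open>m > s\<close> the large scales become summable. The small scales now involve \<open>M g (x + jh)\<close>; averaging over the
  ball of steps turns these into \<open>M (M g) x\<close> (\<open>near_pointwise_bound\<close>).

  Far from \<open>K\<close> the distance is comparable to \<open>|x - a|\<close> for a fixed \<open>a\<close> in \<open>K\<close>, and the condition on \<open>s\<close>
  is used: the large scales are bounded by the Hardy operator \<open>\<integral>\<^sub>1\<^sup>\<infinity> \<theta>^(s-1) M g (a + \<theta> (x - a)) d\<theta>\<close>,
  and dilation by \<open>\<theta>\<close> reduces the \<open>L\<^sup>p\<close> norm by the factor \<open>\<theta>^(-d/p)\<close>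
  (\<open>far_pointwise_bound\<close>, \<open>nn_integral_radial_tail_power\<close>). The theorem follows by taking \<open>L\<^sup>p\<close> norms, because
  \<open>M\<close> is bounded on \<open>L\<^sup>p\<close> for \<open>p > 1\<close> (\<open>hl_maxr_strong_type\<close>).
\<close>

section \<open>The Hardy--Littlewood maximal function\<close>

lemma sets_borel_ball [measurable]: "ball x r \<in> sets borel"
  by simp

lemma emeasure_ball_scaled:
  fixes x :: "'a::euclidean_space"
  assumes "r \<ge> 0"
  shows "emeasure lborel (ball x r) = ennreal (r ^ DIM('a) * unit_ball_vol (real DIM('a)))"
  using emeasure_ball[OF assms, of x] by (simp add: mult.commute)

abbreviation ball_integral :: "('a::euclidean_space \<Rightarrow> ennreal) \<Rightarrow> 'a \<Rightarrow> real \<Rightarrow> ennreal" where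
  "ball_integral u x r \<equiv> \<integral>\<^sup>+y\<in>ball x r. u y \<partial>lborel"

definition hl_max :: "('a::euclidean_space \<Rightarrow> ennreal) \<Rightarrow> 'a \<Rightarrow> ennreal" where
  "hl_max u x = (SUP r\<in>{0<..}. ball_integral u x r / emeasure lborel (ball x r))"

lemma less_divide_iff_ennreal:
  fixes a b c :: ennreal
  assumes "0 < c" "c < top"
  shows "a < b / c \<longleftrightarrow> a * c < b"
proof -
  have "b / c \<le> a \<longleftrightarrow> b \<le> a * c"
  proof
    assume "b / c \<le> a"
    then have "b / c * c \<le> a * c" by (rule mult_right_mono) simp
    moreover have "b / c * c = b"
      using assms by (metis ennreal_times_divide mult.commute ennreal_mult_divide_eq less_top order_less_irrefl)
    ultimately show "b \<le> a * c" by simp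
  next
    assume "b \<le> a * c" then show "b / c \<le> a"
      using assms by (intro divide_le_posI_ennreal) (auto simp: mult.commute)
  qed
  then show ?thesis by (simp add: not_le[symmetric])
qed

lemma ball_vol_pos_fin:
  fixes x :: "'a::euclidean_space"
  assumes "r > 0"
  shows "0 < emeasure lborel (ball x r)" "emeasure lborel (ball x r) < top"
  using assms unit_ball_vol_pos[of "real DIM('a)"] by (auto simp: emeasure_ball_scaled)

lemma less_hl_max_iff:
  "a < hl_max u x \<longleftrightarrow> (\<exists>r>0. a * emeasure lborel (ball x r) < ball_integral u x r)"
  unfolding hl_max_def less_SUP_iff
  by (simp add: Bex_def less_divide_iff_ennreal[OF ball_vol_pos_fin] cong: conj_cong)

lemma ball_integral_le_hl_max:
  assumes "r > 0"
  shows "ball_integral u x r \<le> hl_max u x * emeasure lborel (ball x r)"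
proof (rule ccontr)
  assume "\<not> ?thesis"
  with assms have "hl_max u x < hl_max u x"
    by (subst less_hl_max_iff) (auto simp: not_le)
  then show False by simp
qed

text \<open>
  Lower semicontinuity: a ball about \<open>x\<close> with large average sits inside a slightly larger ball about any
  nearby point, and the volume is continuous in the radius. Measurability of the uncountable supremum follows.
\<close>

lemma open_superlevel_hl_max: "open {x. a < hl_max u x}"
  for u :: "'a::euclidean_space \<Rightarrow> ennreal"
proof (subst open_contains_ball, safe)
  fix x :: 'a assume "a < hl_max u x"
  then obtain r where r: "r > 0" "a * emeasure lborel (ball x r) < ball_integral u x r"
    by (auto simp: less_hl_max_iff)
  have "a < top" using \<open>a < hl_max u x\<close> by (meson less_top_ennreal order_less_le_trans top_greatest)
  let ?V = "\<lambda>s. a * ennreal (s ^ DIM('a) * unit_ball_vol (real DIM('a)))"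
  have "(?V \<longlongrightarrow> ?V r) (at_right r)"
    using \<open>a < top\<close> by (intro ennreal_tendsto_cmult tendsto_ennrealI tendsto_intros) auto
  then have "\<forall>\<^sub>F s in at_right r. ?V s < ball_integral u x r"
    using r by (intro order_tendstoD) (auto simp: emeasure_ball_scaled)
  then obtain b where b: "b > r" "\<And>s. s > r \<Longrightarrow> s < b \<Longrightarrow> ?V s < ball_integral u x r"
    by (auto simp: eventually_at_right_field)
  define s where "s = (r + b) / 2"
  have s: "s > r" "s < b" using b by (auto simp: s_def)
  have "ball x (s - r) \<subseteq> {x. a < hl_max u x}"
  proof safe
    fix z assume z: "z \<in> ball x (s - r)"
    have "ball x r \<subseteq> ball z s"
    proof
      fix y assume "y \<in> ball x r"
      then show "y \<in> ball z s" using z dist_triangle[of z y x] by (auto simp: dist_commute)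
    qed
    then have le: "ball_integral u x r \<le> ball_integral u z s"
      by (intro nn_integral_mono) (auto simp: indicator_def)
    have "a * emeasure lborel (ball z s) < ball_integral u z s"
      using b(2)[OF s] le r s by (auto simp: emeasure_ball_scaled)
    then show "a < hl_max u z" using r s by (auto simp: less_hl_max_iff intro!: exI[of _ s])
  qed
  then show "\<exists>e>0. ball x e \<subseteq> {x. a < hl_max u x}"
    using s by (intro exI[of _ "s - r"]) auto
qed

lemma borel_measurable_hl_max [measurable]: "hl_max u \<in> borel_measurable borel"
proof (rule borel_measurableI_greater)
  fix a
  show "{x \<in> space borel. a < hl_max u x} \<in> sets borel"
    using borel_open[OF open_superlevel_hl_max[of a u]] by simp
qed

lemma hl_max_le_bound:
  assumes "\<And>x. u x \<le> c"
  shows "hl_max u x \<le> c"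
proof (rule ccontr)
  assume "\<not> ?thesis"
  then obtain r where r: "r > 0" "c * emeasure lborel (ball x r) < ball_integral u x r"
    by (auto simp: not_le less_hl_max_iff)
  have "ball_integral u x r \<le> (\<integral>\<^sup>+y. c * indicator (ball x r) y \<partial>lborel)"
    using assms by (intro nn_integral_mono mult_right_mono) auto
  also have "\<dots> = c * emeasure lborel (ball x r)"
    by (simp add: nn_integral_cmult_indicator)
  finally show False using r by simp
qed

text \<open>
  The superlevel set is covered by balls on which the average of \<open>u\<close> exceeds \<open>a\<close>. When the integral of \<open>u\<close> is
  finite their radii are bounded, so Vitali's lemma selects disjoint ones whose fivefold enlargements still
  cover; the disjoint balls have total volume at most the integral of \<open>u\<close> divided by \<open>a\<close>.
\<close>

lemma hl_max_weak_type:
  fixes u :: "'a::euclidean_space \<Rightarrow> ennreal"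
  assumes [measurable]: "u \<in> borel_measurable borel" and a: "a > 0" "a < top"
  shows "a * emeasure lborel {x. a < hl_max u x} \<le> 5 ^ DIM('a) * (\<integral>\<^sup>+x. u x \<partial>lborel)"
proof (cases "(\<integral>\<^sup>+x. u x \<partial>lborel) = top")
  case True then show ?thesis by (simp add: ennreal_mult_top)
next
  case False
  let ?I = "\<integral>\<^sup>+x. u x \<partial>lborel"
  define K where "K = {(x, r). 0 < r \<and> a * emeasure lborel (ball x r) < ball_integral u x r}"
  obtain i where i: "?I = ennreal i" "i \<ge> 0" using False by (cases ?I) auto
  obtain a' where a': "a = ennreal a'" "a' > 0" using a by (cases a) auto
  define B where "B = max 1 (i / (a' * unit_ball_vol (real DIM('a))))"
  have rB: "0 < snd z \<and> snd z \<le> B" if "z \<in> K" for z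
  proof -
    obtain x r where z: "z = (x, r)" by (cases z)
    have r: "r > 0" "a * emeasure lborel (ball x r) < ball_integral u x r"
      using that by (auto simp: K_def z)
    have "ball_integral u x r \<le> ?I"
      by (intro nn_integral_mono) (auto simp: indicator_def)
    then have "ennreal (a' * (r ^ DIM('a) * unit_ball_vol (real DIM('a)))) < ennreal i"
      using r a' unit_ball_vol_pos[of "real DIM('a)"]
      by (auto simp: emeasure_ball_scaled i ennreal_mult)
    then have *: "r ^ DIM('a) * (a' * unit_ball_vol (real DIM('a))) < i"
      using i a' r(1) by (subst (asm) ennreal_less_iff) (auto simp: mult_ac unit_ball_vol_nonneg)
    have "r \<le> B"
    proof (cases "r \<le> 1")
      case False
      then have "r ^ 1 \<le> r ^ DIM('a)" by (intro power_increasing) (auto simp: Suc_le_eq)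
      then have "r * (a' * unit_ball_vol (real DIM('a))) \<le> r ^ DIM('a) * (a' * unit_ball_vol (real DIM('a)))"
        using a' by (intro mult_right_mono) (auto simp: unit_ball_vol_nonneg)
      with * have "r * (a' * unit_ball_vol (real DIM('a))) < i" by simp
      then have "r < i / (a' * unit_ball_vol (real DIM('a)))"
        using a' unit_ball_vol_pos[of "real DIM('a)"] by (simp add: pos_less_divide_eq)
      then show ?thesis by (simp add: B_def)
    qed (simp add: B_def)
    with r z show ?thesis by simp
  qed
  have cov: "{x. a < hl_max u x} \<subseteq> (\<Union>z\<in>K. ball (fst z) (snd z))"
  proof safe
    fix x assume "a < hl_max u x"
    then obtain r where "r > 0" "a * emeasure lborel (ball x r) < ball_integral u x r"
      by (auto simp: less_hl_max_iff)
    then show "x \<in> (\<Union>z\<in>K. ball (fst z) (snd z))" by (intro UN_I[of "(x, r)"]) (auto simp: K_def)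
  qed
  obtain C where C: "countable C" "C \<subseteq> K"
     "pairwise (\<lambda>i j. disjnt (ball (fst i) (snd i)) (ball (fst j) (snd j))) C"
     "{x. a < hl_max u x} \<subseteq> (\<Union>i\<in>C. ball (fst i) (5 * snd i))"
    using Vitali_covering_lemma_balls[OF cov rB] by blast
  let ?b = "\<lambda>z::'a\<times>real. ball (fst z) (snd z)"
  have disj: "disjoint_family_on ?b C"
    using C(3) by (auto simp: disjoint_family_on_def pairwise_def disjnt_def)
  \<comment> \<open>Countable subadditivity, phrased with counting measure so that it matches
    the countable additivity used for the disjoint balls below.\<close>
  have ind: "indicator (\<Union>i\<in>C. ball (fst i) (5 * snd i)) x
      \<le> (\<integral>\<^sup>+i. indicator (ball (fst i) (5 * snd i)) x \<partial>count_space C)" for x :: 'a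
  proof (cases "x \<in> (\<Union>i\<in>C. ball (fst i) (5 * snd i))")
    case True
    then obtain j where j: "j \<in> C" "x \<in> ball (fst j) (5 * snd j)" by blast
    have "1 = (\<integral>\<^sup>+i. indicator {j} i \<partial>count_space C)"
      using j by (simp add: one_ennreal_def)
    also have "\<dots> \<le> (\<integral>\<^sup>+i. indicator (ball (fst i) (5 * snd i)) x \<partial>count_space C)"
      using j by (intro nn_integral_mono) (auto simp: indicator_def)
    finally show ?thesis using True by simp
  qed auto
  have "emeasure lborel {x. a < hl_max u x} \<le> emeasure lborel (\<Union>i\<in>C. ball (fst i) (5 * snd i))"
    using C by (intro emeasure_mono) auto
  also have "\<dots> = (\<integral>\<^sup>+x. indicator (\<Union>i\<in>C. ball (fst i) (5 * snd i)) x \<partial>lborel)"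
    using C(1) by (intro nn_integral_indicator[symmetric] sets.countable_UN') auto
  also have "\<dots> \<le> (\<integral>\<^sup>+x. \<integral>\<^sup>+i. indicator (ball (fst i) (5 * snd i)) x \<partial>count_space C \<partial>lborel)"
    by (intro nn_integral_mono ind)
  also have "\<dots> = (\<integral>\<^sup>+i. \<integral>\<^sup>+x. indicator (ball (fst i) (5 * snd i)) x \<partial>lborel \<partial>count_space C)"
    by (intro nn_integral_count_space_nn_integral C) measurable
  also have "\<dots> = (\<integral>\<^sup>+i. 5 ^ DIM('a) * emeasure lborel (?b i) \<partial>count_space C)"
  proof (intro nn_integral_cong)
    fix i assume "i \<in> space (count_space C)"
    then have "i \<in> K" using C(2) by auto
    then have "0 < snd i" using rB by blast
    then show "(\<integral>\<^sup>+x. indicator (ball (fst i) (5 * snd i)) x \<partial>lborel) = 5 ^ DIM('a) * emeasure lborel (?b i)"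
      by (simp add: emeasure_ball_scaled power_mult_distrib ennreal_mult unit_ball_vol_nonneg mult.assoc
          flip: ennreal_power)
  qed
  finally have 1: "a * emeasure lborel {x. a < hl_max u x} \<le> a * (\<integral>\<^sup>+i. 5 ^ DIM('a) * emeasure lborel (?b i) \<partial>count_space C)"
    by (intro mult_left_mono) auto
  also have "\<dots> = 5 ^ DIM('a) * (\<integral>\<^sup>+i. a * emeasure lborel (?b i) \<partial>count_space C)"
    by (simp add: nn_integral_cmult mult_ac)
  also have "\<dots> \<le> 5 ^ DIM('a) * (\<integral>\<^sup>+i. emeasure (density lborel u) (?b i) \<partial>count_space C)"
  proof (intro mult_left_mono nn_integral_mono)
    fix i assume "i \<in> space (count_space C)"
    then have "i \<in> K" using C by auto
    then show "a * emeasure lborel (?b i) \<le> emeasure (density lborel u) (?b i)"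
      by (auto simp: K_def emeasure_density)
  qed auto
  also have "(\<integral>\<^sup>+i. emeasure (density lborel u) (?b i) \<partial>count_space C) = emeasure (density lborel u) (\<Union>(?b ` C))"
    using C(1) disj by (intro emeasure_UN_countable[symmetric]) auto
  also have "\<dots> \<le> emeasure (density lborel u) (space (density lborel u))"
    by (rule emeasure_space)
  also have "\<dots> = ?I" by (simp add: emeasure_density)
  finally show ?thesis by (simp add: mult_left_mono)
qed

lemma nn_integral_powr_Ioo:
  assumes "p > 0" "a \<ge> 0"
  shows "(\<integral>\<^sup>+t. ennreal (p * t powr (p - 1)) * indicator {0<..<a} t \<partial>lborel) = ennreal (a powr p)"
proof -
  have "((\<lambda>t. p * t powr (p - 1)) has_integral (p * (a powr (p - 1 + 1) / (p - 1 + 1)))) {0..a}"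
    using assms by (intro has_integral_mult_right has_integral_powr_from_0) auto
  then have "((\<lambda>t. if t \<in> {0..a} then p * t powr (p - 1) else 0) has_integral (a powr p)) UNIV"
    using assms by (subst has_integral_restrict_UNIV) auto
  then have "(\<integral>\<^sup>+t. ennreal (if t \<in> {0..a} then p * t powr (p - 1) else 0) \<partial>lborel) = ennreal (a powr p)"
    using assms by (intro nn_integral_has_integral_lborel) auto
  moreover have "(\<integral>\<^sup>+t. ennreal (if t \<in> {0..a} then p * t powr (p - 1) else 0) \<partial>lborel)
     = (\<integral>\<^sup>+t. ennreal (p * t powr (p - 1)) * indicator {0<..<a} t \<partial>lborel)"
    using AE_lborel_singleton[of 0] AE_lborel_singleton[of a]
    by (intro nn_integral_cong_AE) (auto simp: indicator_def)
  ultimately show ?thesis by simp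
qed

lemma nn_integral_powr_Ici:
  assumes "e < -1" "a > 0"
  shows "(\<integral>\<^sup>+t. ennreal (t powr e) * indicator {a..} t \<partial>lborel) = ennreal (a powr (e + 1) / (- e - 1))"
proof -
  have "((\<lambda>t. if t \<in> {a..} then t powr e else 0) has_integral (- (a powr (e + 1)) / (e + 1))) UNIV"
    using assms by (subst has_integral_restrict_UNIV) (intro has_integral_powr_to_inf)
  then have "(\<integral>\<^sup>+t. ennreal (if t \<in> {a..} then t powr e else 0) \<partial>lborel) = ennreal (- (a powr (e + 1)) / (e + 1))"
    by (intro nn_integral_has_integral_lborel) auto
  moreover have "- (a powr (e + 1)) / (e + 1) = a powr (e + 1) / (- e - 1)"
    using assms by (simp add: field_simps)
  moreover have "(\<integral>\<^sup>+t. ennreal (if t \<in> {a..} then t powr e else 0) \<partial>lborel)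
     = (\<integral>\<^sup>+t. ennreal (t powr e) * indicator {a..} t \<partial>lborel)"
    by (intro nn_integral_cong) (auto simp: indicator_def)
  ultimately show ?thesis by simp
qed

lemma nn_integral_powr_layer_cake:
  fixes F :: "'a::euclidean_space \<Rightarrow> real"
  assumes [measurable]: "F \<in> borel_measurable borel" and "\<And>x. F x \<ge> 0" "p > 0"
  shows "(\<integral>\<^sup>+x. ennreal (F x powr p) \<partial>lborel) =
     (\<integral>\<^sup>+t. ennreal (p * t powr (p - 1)) * indicator {0<..} t * emeasure lborel {x. t < F x} \<partial>lborel)"
proof -
  let ?k = "\<lambda>t. ennreal (p * t powr (p - 1))"
  have "(\<integral>\<^sup>+x. ennreal (F x powr p) \<partial>lborel) =
      (\<integral>\<^sup>+x. (\<integral>\<^sup>+t. ?k t * indicator {0<..<F x} t \<partial>lborel) \<partial>lborel)"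
    using assms by (simp add: nn_integral_powr_Ioo)
  also have "\<dots> = (\<integral>\<^sup>+x. (\<integral>\<^sup>+t. ?k t * indicator {0<..} t * indicator {x. t < F x} x \<partial>lborel) \<partial>lborel)"
    by (intro nn_integral_cong) (auto simp: indicator_def)
  also have "\<dots> = (\<integral>\<^sup>+t. (\<integral>\<^sup>+x. ?k t * indicator {0<..} t * indicator {x. t < F x} x \<partial>lborel) \<partial>lborel)"
    by (rule lborel_pair.Fubini') measurable
  also have "\<dots> = (\<integral>\<^sup>+t. ?k t * indicator {0<..} t * emeasure lborel {x. t < F x} \<partial>lborel)"
    by (intro nn_integral_cong) (simp add: nn_integral_cmult_indicator)
  finally show ?thesis .
qed

text \<open>
  Real values make powers with a real exponent available. This version is meant for bounded functions,
  where \<open>enn2real\<close> loses nothing.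
\<close>

definition hl_maxr :: "('a::euclidean_space \<Rightarrow> real) \<Rightarrow> 'a \<Rightarrow> real" where
  "hl_maxr u x = enn2real (hl_max (\<lambda>y. ennreal (u y)) x)"

lemma hl_maxr_nonneg [simp]: "hl_maxr u x \<ge> 0"
  by (simp add: hl_maxr_def)

lemma borel_measurable_hl_maxr [measurable]: "hl_maxr u \<in> borel_measurable borel"
  unfolding hl_maxr_def[abs_def] by measurable

lemma ennreal_hl_maxr:
  assumes "\<And>x. u x \<le> B"
  shows "ennreal (hl_maxr u x) = hl_max (\<lambda>y. ennreal (u y)) x"
proof -
  have "hl_max (\<lambda>y. ennreal (u y)) x \<le> ennreal B"
    using assms by (intro hl_max_le_bound ennreal_leI)
  then show ?thesis by (simp add: hl_maxr_def le_less_trans[OF _ ennreal_less_top])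
qed

lemma hl_maxr_le:
  assumes "\<And>x. u x \<le> B" "B \<ge> 0"
  shows "hl_maxr u x \<le> B"
proof -
  have "hl_max (\<lambda>y. ennreal (u y)) x \<le> ennreal B"
    using assms by (intro hl_max_le_bound ennreal_leI)
  then show ?thesis using assms by (simp add: hl_maxr_def enn2real_leI)
qed

text \<open>
  The part of \<open>u\<close> below \<open>t/2\<close> can account for at most \<open>t/2\<close> of any average.
\<close>

lemma hl_max_superlevel_truncate:
  fixes u :: "'a::euclidean_space \<Rightarrow> real"
  assumes [measurable]: "u \<in> borel_measurable borel" and t: "t > 0"
  shows "{x. ennreal t < hl_max (\<lambda>y. ennreal (u y)) x} \<subseteq>
    {x. ennreal (t/2) < hl_max (\<lambda>y. ennreal (u y) * indicator {y. t/2 < u y} y) x}"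
proof safe
  fix x assume "ennreal t < hl_max (\<lambda>y. ennreal (u y)) x"
  then obtain r where r: "r > 0" "ennreal t * emeasure lborel (ball x r) < (\<integral>\<^sup>+y\<in>ball x r. ennreal (u y) \<partial>lborel)"
    by (auto simp: less_hl_max_iff)
  let ?V = "emeasure lborel (ball x r)"
  let ?u = "\<lambda>y. ennreal (u y) * indicator {y. t/2 < u y} y"
  have m: "(\<lambda>y. ?u y * indicator (ball x r) y) \<in> borel_measurable lborel"
    by measurable
  have m2: "(\<lambda>y. ennreal (t / 2) * indicator (ball x r) y) \<in> borel_measurable lborel"
    by measurable
  have "(\<integral>\<^sup>+y\<in>ball x r. ennreal (u y) \<partial>lborel)
      \<le> (\<integral>\<^sup>+y. ?u y * indicator (ball x r) y + ennreal (t/2) * indicator (ball x r) y \<partial>lborel)"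
    using t by (intro nn_integral_mono) (auto simp: indicator_def intro!: ennreal_leI)
  also have "\<dots> = ball_integral ?u x r + ennreal (t/2) * ?V"
    using m m2 by (simp add: nn_integral_add nn_integral_cmult_indicator)
  finally have le: "(\<integral>\<^sup>+y\<in>ball x r. ennreal (u y) \<partial>lborel) \<le> ball_integral ?u x r + ennreal (t/2) * ?V" .
  have "ennreal t = ennreal (t/2) + ennreal (t/2)"
    using t by (subst ennreal_plus[symmetric]) auto
  then have "ennreal (t/2) * ?V + ennreal (t/2) * ?V < ball_integral ?u x r + ennreal (t/2) * ?V"
    using less_le_trans[OF r(2) le] by (simp only: distrib_right)
  then have "ennreal (t/2) * ?V < ball_integral ?u x r"
    by (meson add_right_mono not_le)
  then show "ennreal (t/2) < hl_max ?u x" using r by (auto simp: less_hl_max_iff)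
qed

text \<open>
  Marcinkiewicz interpolation by hand. At height \<open>t\<close> the weak type inequality is applied only to the part of \<open>u\<close>
  above \<open>t/2\<close>; integrating over \<open>t\<close> and exchanging the integrals leaves
  \<open>\<integral> u(x) \<integral>\<^sub>0^(2u(x)) p t^(p-2) dt dx\<close>, where \<open>p > 1\<close> makes the inner integral converge.
\<close>

theorem hl_maxr_strong_type:
  fixes u :: "'a::euclidean_space \<Rightarrow> real"
  assumes [measurable]: "u \<in> borel_measurable borel" and u: "\<And>x. 0 \<le> u x" "\<And>x. u x \<le> B" and p: "p > 1"
  shows "(\<integral>\<^sup>+x. ennreal (hl_maxr u x powr p) \<partial>lborel)
    \<le> ennreal (5 ^ DIM('a) * 2 powr p * p / (p - 1)) * (\<integral>\<^sup>+x. ennreal (u x powr p) \<partial>lborel)"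
proof -
  let ?k = "\<lambda>t x. ennreal (p * t powr (p - 2)) * indicator {0<..} t * (ennreal (u x) * indicator {x. t/2 < u x} x)"
  let ?m = "\<lambda>t. \<integral>\<^sup>+x. ennreal (u x) * indicator {x. t/2 < u x} x \<partial>lborel"
  have weak: "ennreal (p * t powr (p - 1)) * indicator {0<..} t * emeasure lborel {x. t < hl_maxr u x} \<le>
     ennreal (5 ^ DIM('a) * 2) * (\<integral>\<^sup>+x. ?k t x \<partial>lborel)" for t
  proof (cases "t > 0")
    case True
    have eq: "{x. t < hl_maxr u x} = {x. ennreal t < hl_max (\<lambda>y. ennreal (u y)) x}"
      using True u by (auto simp: ennreal_hl_maxr[of u B, symmetric] ennreal_less_iff)
    have "ennreal (t/2) * emeasure lborel {x. t < hl_maxr u x}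
       \<le> ennreal (t/2) * emeasure lborel {x. ennreal (t/2) < hl_max (\<lambda>y. ennreal (u y) * indicator {y. t/2 < u y} y) x}"
      unfolding eq using hl_max_superlevel_truncate[OF assms(1) True]
      by (intro mult_left_mono emeasure_mono) auto
    also have "\<dots> \<le> 5 ^ DIM('a) * ?m t"
      using True by (intro hl_max_weak_type) auto
    finally have *: "ennreal (t/2) * emeasure lborel {x. t < hl_maxr u x} \<le> 5 ^ DIM('a) * ?m t" .
    have "ennreal (p * t powr (p - 1)) = ennreal (2 * (p * t powr (p - 2))) * ennreal (t/2)"
      using True p by (subst ennreal_mult[symmetric]) (auto simp: powr_diff field_simps power2_eq_square)
    then have "ennreal (p * t powr (p - 1)) * emeasure lborel {x. t < hl_maxr u x} =
       ennreal (2 * (p * t powr (p - 2))) * (ennreal (t/2) * emeasure lborel {x. t < hl_maxr u x})"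
      by (simp add: mult.assoc)
    also have "\<dots> \<le> ennreal (2 * (p * t powr (p - 2))) * (5 ^ DIM('a) * ?m t)"
      by (intro mult_left_mono *) auto
    also have "\<dots> = ennreal (5 ^ DIM('a) * 2) * (ennreal (p * t powr (p - 2)) * ?m t)"
      using p True by (simp add: ennreal_mult ennreal_power[symmetric] mult_ac)
    finally show ?thesis using True by (simp add: nn_integral_cmult)
  qed simp
  have "(\<integral>\<^sup>+x. ennreal (hl_maxr u x powr p) \<partial>lborel) =
     (\<integral>\<^sup>+t. ennreal (p * t powr (p - 1)) * indicator {0<..} t * emeasure lborel {x. t < hl_maxr u x} \<partial>lborel)"
    using p by (intro nn_integral_powr_layer_cake) auto
  also have "\<dots> \<le> (\<integral>\<^sup>+t. ennreal (5 ^ DIM('a) * 2) * (\<integral>\<^sup>+x. ?k t x \<partial>lborel) \<partial>lborel)"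
    by (intro nn_integral_mono weak)
  also have "\<dots> = ennreal (5 ^ DIM('a) * 2) * (\<integral>\<^sup>+t. (\<integral>\<^sup>+x. ?k t x \<partial>lborel) \<partial>lborel)"
    by (intro nn_integral_cmult) measurable
  also have "(\<integral>\<^sup>+t. (\<integral>\<^sup>+x. ?k t x \<partial>lborel) \<partial>lborel)
     = (\<integral>\<^sup>+x. (\<integral>\<^sup>+t. ?k t x \<partial>lborel) \<partial>lborel)"
    by (rule lborel_pair.Fubini') measurable
  also have "\<dots> = (\<integral>\<^sup>+x. ennreal (2 powr (p - 1) * p / (p - 1)) * ennreal (u x powr p) \<partial>lborel)"
  proof (intro nn_integral_cong)
    fix x :: 'a
    have "(\<integral>\<^sup>+t. ?k t x \<partial>lborel)
       = (\<integral>\<^sup>+t. ennreal (p / (p - 1) * u x) * (ennreal ((p - 1) * t powr (p - 1 - 1)) * indicator {0<..<2 * u x} t) \<partial>lborel)"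
      using p u(1)[of x] by (intro nn_integral_cong) (auto simp: indicator_def ennreal_mult[symmetric] mult_ac)
    also have "\<dots> = ennreal (p / (p - 1) * u x) * ennreal ((2 * u x) powr (p - 1))"
      using p u(1)[of x] by (subst nn_integral_cmult) (simp_all only: nn_integral_powr_Ioo, auto)
    also have "\<dots> = ennreal (2 powr (p - 1) * p / (p - 1)) * ennreal (u x powr p)"
    proof (cases "u x = 0")
      case False
      then have "u x * u x powr (p - 1) = u x powr p"
        using u(1)[of x] p by (simp add: powr_diff)
      then show ?thesis
        using p u(1)[of x] by (simp add: ennreal_mult[symmetric] powr_mult mult_ac)
    qed simp
    finally show "(\<integral>\<^sup>+t. ?k t x \<partial>lborel)
        = ennreal (2 powr (p - 1) * p / (p - 1)) * ennreal (u x powr p)" .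
  qed
  also have "\<dots> = ennreal (2 powr (p - 1) * p / (p - 1)) * (\<integral>\<^sup>+x. ennreal (u x powr p) \<partial>lborel)"
    by (intro nn_integral_cmult) measurable
  finally have "(\<integral>\<^sup>+x. ennreal (hl_maxr u x powr p) \<partial>lborel) \<le> ennreal (5 ^ DIM('a) * 2) *
      (ennreal (2 powr (p - 1) * p / (p - 1)) * (\<integral>\<^sup>+x. ennreal (u x powr p) \<partial>lborel))" .
  moreover have "ennreal (5 ^ DIM('a) * 2 powr p * p / (p - 1)) = ennreal (5 ^ DIM('a) * 2) * ennreal (2 powr (p - 1) * p / (p - 1))"
    using p by (subst ennreal_mult[symmetric]) (auto simp: powr_diff field_simps)
  ultimately show ?thesis by (simp only: mult.assoc)
qed

section \<open>Gaussian averages and the maximal function\<close>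

lemma nn_integral_lborel_affine:
  fixes F :: "'a::euclidean_space \<Rightarrow> ennreal"
  assumes [measurable]: "F \<in> borel_measurable borel" and "c > 0"
  shows "(\<integral>\<^sup>+x. F x \<partial>lborel) = ennreal (c ^ DIM('a)) * (\<integral>\<^sup>+x. F (t + c *\<^sub>R x) \<partial>lborel)"
proof -
  have "(\<integral>\<^sup>+x. F x \<partial>lborel) = (\<integral>\<^sup>+x. F x \<partial>density (distr lborel borel (\<lambda>x. t + c *\<^sub>R x)) (\<lambda>_. \<bar>c\<bar>^DIM('a)))"
    using assms(2) by (intro arg_cong[of _ _ "\<lambda>M. nn_integral M F"] lborel_affine) simp
  also have "\<dots> = (\<integral>\<^sup>+x. ennreal (c ^ DIM('a)) * F x \<partial>distr lborel borel (\<lambda>x. t + c *\<^sub>R x))"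
    using assms(2) by (subst nn_integral_density) simp_all
  also have "\<dots> = (\<integral>\<^sup>+x. ennreal (c ^ DIM('a)) * F (t + c *\<^sub>R x) \<partial>lborel)"
    by (subst nn_integral_distr) simp_all
  also have "\<dots> = ennreal (c ^ DIM('a)) * (\<integral>\<^sup>+x. F (t + c *\<^sub>R x) \<partial>lborel)"
    by (subst nn_integral_cmult) simp_all
  finally show ?thesis .
qed

lemma nn_integral_gaussian:
  assumes "r > 0"
  shows "(\<integral>\<^sup>+y. ennreal (exp (- (norm (y::'a::euclidean_space))\<^sup>2 / (2 * r\<^sup>2))) \<partial>lborel)
     = ennreal ((sqrt (2 * pi) * r) ^ DIM('a))"
proof -
  have 1: "(\<integral>\<^sup>+x. ennreal (exp (- x\<^sup>2 / (2 * r\<^sup>2))) \<partial>lborel) = ennreal (sqrt (2 * pi) * r)"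
  proof -
    interpret prob_space "density lborel (normal_density 0 r)"
      by (rule prob_space_normal_density) fact
    have "1 = emeasure (density lborel (normal_density 0 r)) (space (density lborel (normal_density 0 r)))"
      by (rule emeasure_space_1[symmetric])
    also have "\<dots> = (\<integral>\<^sup>+x. ennreal (normal_density 0 r x) \<partial>lborel)"
      by (simp add: emeasure_density)
    finally have *: "(\<integral>\<^sup>+x. ennreal (normal_density 0 r x) \<partial>lborel) = 1" ..
    have "(\<integral>\<^sup>+x. ennreal (exp (- x\<^sup>2 / (2 * r\<^sup>2))) \<partial>lborel)
        = (\<integral>\<^sup>+x. ennreal (sqrt (2 * pi) * r) * ennreal (normal_density 0 r x) \<partial>lborel)"
      using assms by (intro nn_integral_cong)
        (auto simp: normal_density_def real_sqrt_mult ennreal_mult[symmetric])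
    also have "\<dots> = ennreal (sqrt (2 * pi) * r) * 1"
      by (subst nn_integral_cmult) (auto simp: *)
    finally show ?thesis by simp
  qed
  have "(\<integral>\<^sup>+y. ennreal (exp (- (norm (y::'a))\<^sup>2 / (2 * r\<^sup>2))) \<partial>lborel)
     = (\<integral>\<^sup>+y. (\<Prod>b\<in>Basis. ennreal (exp (- (y \<bullet> b)\<^sup>2 / (2 * r\<^sup>2)))) \<partial>(lborel :: 'a measure))"
  proof (intro nn_integral_cong)
    fix y :: 'a
    have "(norm y)\<^sup>2 = (\<Sum>b\<in>Basis. (y \<bullet> b)\<^sup>2)"
      unfolding power2_norm_eq_inner by (subst euclidean_inner) (simp add: power2_eq_square)
    then show "ennreal (exp (- (norm y)\<^sup>2 / (2 * r\<^sup>2))) = (\<Prod>b\<in>Basis. ennreal (exp (- (y \<bullet> b)\<^sup>2 / (2 * r\<^sup>2))))"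
      by (simp add: prod_ennreal exp_sum[symmetric] sum_negf sum_divide_distrib)
  qed
  also have "\<dots> = (\<Prod>b\<in>(Basis::'a set). (\<integral>\<^sup>+x. ennreal (exp (- x\<^sup>2 / (2 * r\<^sup>2))) \<partial>lborel))"
    by (rule nn_integral_lborel_prod) auto
  also have "\<dots> = ennreal ((sqrt (2 * pi) * r) ^ DIM('a))"
    using assms by (simp only: 1) (simp add: ennreal_power)
  finally show ?thesis .
qed

lemma nn_integral_gaussian_tail:
  assumes "r > 0" "q \<ge> 0"
  shows "(\<integral>\<^sup>+s. ennreal (s / r\<^sup>2 * exp (- s\<^sup>2 / (2 * r\<^sup>2))) * indicator {q..} s \<partial>lborel)
     = ennreal (exp (- q\<^sup>2 / (2 * r\<^sup>2)))"
proof -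
  let ?F = "\<lambda>s. - exp (- s\<^sup>2 / (2 * r\<^sup>2))"
  have "(\<integral>\<^sup>+s. ennreal (s / r\<^sup>2 * exp (- s\<^sup>2 / (2 * r\<^sup>2))) * indicator {q..} s \<partial>lborel) = ennreal (0 - ?F q)"
  proof (rule nn_integral_FTC_atLeast)
    show "(?F \<longlongrightarrow> 0) at_top" using assms by real_asymp
    show "DERIV ?F x :> x / r\<^sup>2 * exp (- x\<^sup>2 / (2 * r\<^sup>2))" for x
      using assms by (auto intro!: derivative_eq_intros simp: field_simps power2_eq_square)
  qed (use assms in auto)
  then show ?thesis by simp
qed

text \<open>
  A radially decreasing kernel is a superposition of indicators of balls, so integrating against it costs no more
  than its total mass times the maximal function. The same decomposition applied to the constant function \<open>1\<close>
  identifies the constant with the integral of the Gaussian.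
\<close>

lemma gaussian_average_le_hl_max:
  fixes u :: "'a::euclidean_space \<Rightarrow> ennreal"
  assumes [measurable]: "u \<in> borel_measurable borel" and r: "r > 0"
  shows "(\<integral>\<^sup>+y. ennreal (exp (- (norm (x - y))\<^sup>2 / (2 * r\<^sup>2))) * u y \<partial>lborel)
     \<le> ennreal ((sqrt (2 * pi) * r) ^ DIM('a)) * hl_max u x"
proof -
  let ?e = "\<lambda>y. exp (- (norm (x - y))\<^sup>2 / (2 * r\<^sup>2))"
  let ?w = "\<lambda>s. ennreal (s / r\<^sup>2 * exp (- s\<^sup>2 / (2 * r\<^sup>2)))"
  have layer: "(\<integral>\<^sup>+y. ennreal (?e y) * v y \<partial>lborel)
      = (\<integral>\<^sup>+s. ?w s * indicator {0<..} s * (\<integral>\<^sup>+y\<in>ball x s. v y \<partial>lborel) \<partial>lborel)"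
    if [measurable]: "v \<in> borel_measurable borel" for v :: "'a \<Rightarrow> ennreal"
  proof -
    have "(\<integral>\<^sup>+y. ennreal (?e y) * v y \<partial>lborel)
       = (\<integral>\<^sup>+y. (\<integral>\<^sup>+s. ?w s * indicator {norm (x - y)..} s \<partial>lborel) * v y \<partial>lborel)"
      using r by (intro nn_integral_cong) (simp only: nn_integral_gaussian_tail norm_ge_zero)
    also have "\<dots> = (\<integral>\<^sup>+y. (\<integral>\<^sup>+s. ?w s * indicator {norm (x - y)..} s * v y \<partial>lborel) \<partial>lborel)"
      by (intro nn_integral_cong nn_integral_multc[symmetric]) measurable
    also have "\<dots> = (\<integral>\<^sup>+y. (\<integral>\<^sup>+s. ?w s * indicator {0<..} s * (v y * indicator {y. norm (x - y) < s} y) \<partial>lborel) \<partial>lborel)"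
    proof (rule nn_integral_cong, rule nn_integral_cong_AE)
      fix y
      show "AE s in lborel. ?w s * indicator {norm (x - y)..} s * v y
         = ?w s * indicator {0<..} s * (v y * indicator {y. norm (x - y) < s} y)"
        using AE_lborel_singleton[of "norm (x - y)"]
        by eventually_elim (auto simp: indicator_def dist_norm mult_ac dest: le_less_trans[OF norm_ge_zero])
    qed
    also have "\<dots> = (\<integral>\<^sup>+s. (\<integral>\<^sup>+y. ?w s * indicator {0<..} s * (v y * indicator {y. norm (x - y) < s} y) \<partial>lborel) \<partial>lborel)"
      by (rule lborel_pair.Fubini') measurable
    also have "\<dots> = (\<integral>\<^sup>+s. ?w s * indicator {0<..} s * (\<integral>\<^sup>+y\<in>ball x s. v y \<partial>lborel) \<partial>lborel)"
      by (subst nn_integral_cmult) (measurable, simp add: ball_def dist_norm)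
    finally show ?thesis .
  qed
  have meas: "(\<lambda>s. ?w s * indicator {0<..} s * (\<integral>\<^sup>+y. indicator (ball x s) y \<partial>lborel)) \<in> borel_measurable lborel"
  proof -
    have "(\<lambda>s. ?w s * indicator {0<..} s * (\<integral>\<^sup>+y. indicator (ball x s) y \<partial>lborel)) =
        (\<lambda>s. ?w s * indicator {0<..} s * ennreal (s ^ DIM('a) * unit_ball_vol (real DIM('a))))"
      by (rule ext) (simp add: emeasure_ball_scaled split: split_indicator)
    then show ?thesis by simp
  qed
  have "(\<integral>\<^sup>+y. ennreal (?e y) * u y \<partial>lborel)
      \<le> (\<integral>\<^sup>+s. hl_max u x * (?w s * indicator {0<..} s * (\<integral>\<^sup>+y. indicator (ball x s) y \<partial>lborel)) \<partial>lborel)"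
    unfolding layer[OF assms(1)]
  proof (intro nn_integral_mono)
    fix s
    show "?w s * indicator {0<..} s * ball_integral u x s
       \<le> hl_max u x * (?w s * indicator {0<..} s * (\<integral>\<^sup>+y. indicator (ball x s) y \<partial>lborel))"
      using mult_left_mono[OF ball_integral_le_hl_max[of s u x], of "?w s"]
      by (cases "s > 0") (simp_all add: mult_ac)
  qed
  also have "\<dots> = hl_max u x * (\<integral>\<^sup>+s. ?w s * indicator {0<..} s * (\<integral>\<^sup>+y\<in>ball x s. 1 \<partial>lborel) \<partial>lborel)"
    using meas by (simp add: nn_integral_cmult)
  also have "(\<integral>\<^sup>+s. ?w s * indicator {0<..} s * (\<integral>\<^sup>+y\<in>ball x s. 1 \<partial>lborel) \<partial>lborel)
     = (\<integral>\<^sup>+y. ennreal (?e y) \<partial>lborel)"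
    using layer[of "\<lambda>_. 1"] by simp
  also have "\<dots> = (\<integral>\<^sup>+y. ennreal (exp (- (norm (y::'a))\<^sup>2 / (2 * r\<^sup>2))) \<partial>lborel)"
    by (subst nn_integral_lborel_affine[where c = 1 and t = x]) simp_all
  also have "\<dots> = ennreal ((sqrt (2 * pi) * r) ^ DIM('a))"
    using r by (rule nn_integral_gaussian)
  finally show ?thesis by (simp add: mult.commute)
qed

text \<open>
  The base point may be moved by a multiple of the width at the price of a wider Gaussian. The case
  \<open>\<kappa> = 0\<close> gives the plain maximal bound, \<open>\<kappa> = 1\<close> is needed far from the obstacle.
\<close>

lemma gaussian_average_nontangential:
  fixes u :: "'a::euclidean_space \<Rightarrow> ennreal"
  assumes [measurable]: "u \<in> borel_measurable borel" and r: "r > 0" and near: "norm (x - x') \<le> \<kappa> * r"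
  shows "(\<integral>\<^sup>+y. ennreal (exp (- (norm (x - y))\<^sup>2 / (4 * r\<^sup>2))) * u y \<partial>lborel)
     \<le> ennreal (exp (\<kappa>\<^sup>2 / 4) * (2 * sqrt (2 * pi) * r) ^ DIM('a)) * hl_max u x'"
proof -
  let ?e' = "\<lambda>y. exp (- (norm (x' - y))\<^sup>2 / (2 * (2 * r)\<^sup>2))"
  let ?e = "\<lambda>y. exp (- (norm (x - y))\<^sup>2 / (4 * r\<^sup>2))"
  have pt: "?e y \<le> exp (\<kappa>\<^sup>2 / 4) * ?e' y" for y
  proof -
    have "norm (x' - y) \<le> norm (x - y) + norm (x - x')"
      by (metis add.commute diff_add_cancel norm_diff_ineq norm_minus_commute norm_triangle_sub dist_norm dist_triangle2 dist_commute)
    then have "(norm (x' - y))\<^sup>2 \<le> (norm (x - y) + \<kappa> * r)\<^sup>2"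
      using near by (intro power_mono) auto
    also have "\<dots> \<le> 2 * (norm (x - y))\<^sup>2 + 2 * (\<kappa> * r)\<^sup>2"
      using zero_le_power2[of "norm (x - y) - \<kappa> * r"] by (simp add: power2_sum power2_diff)
    finally have "(norm (x' - y))\<^sup>2 / (8 * r\<^sup>2) \<le> (2 * (norm (x - y))\<^sup>2 + 2 * (\<kappa> * r)\<^sup>2) / (8 * r\<^sup>2)"
      using r by (intro divide_right_mono) auto
    also have "\<dots> = (norm (x - y))\<^sup>2 / (4 * r\<^sup>2) + \<kappa>\<^sup>2 / 4"
      using r by (simp add: field_simps power2_eq_square)
    finally show ?thesis using r by (simp add: mult_exp_exp power_mult_distrib)
  qed
  have "(\<integral>\<^sup>+y. ennreal (?e y) * u y \<partial>lborel)
     \<le> (\<integral>\<^sup>+y. ennreal (exp (\<kappa>\<^sup>2 / 4)) * (ennreal (?e' y) * u y) \<partial>lborel)"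
    using pt by (intro nn_integral_mono)
      (auto simp: mult.assoc[symmetric] ennreal_mult[symmetric] intro!: mult_right_mono ennreal_leI)
  also have "\<dots> = ennreal (exp (\<kappa>\<^sup>2 / 4)) * (\<integral>\<^sup>+y. ennreal (?e' y) * u y \<partial>lborel)"
    by (intro nn_integral_cmult) measurable
  also have "\<dots> \<le> ennreal (exp (\<kappa>\<^sup>2 / 4)) * (ennreal ((sqrt (2 * pi) * (2 * r)) ^ DIM('a)) * hl_max u x')"
    using r by (intro mult_left_mono gaussian_average_le_hl_max) auto
  finally show ?thesis using r by (simp add: ennreal_mult mult_ac)
qed

text \<open>
  This is what averaging over the steps \<open>w\<close> achieves: the points \<open>x + v + c w\<close> sweep out a ball that lies within a
  ball about \<open>x\<close> of comparable radius.
\<close>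

lemma ball_average_shifted_le_hl_max:
  fixes V :: "'a::euclidean_space \<Rightarrow> ennreal"
  assumes [measurable]: "V \<in> borel_measurable borel" and R: "R > 0" and c: "c > 0"
    and near: "norm v \<le> \<kappa> * R"
  shows "(\<integral>\<^sup>+w\<in>ball 0 R. V (x + v + c *\<^sub>R w) \<partial>lborel)
     \<le> ennreal (((\<kappa> + c) / c) ^ DIM('a)) * emeasure lborel (ball (0::'a) R) * hl_max V x"
proof -
  let ?I = "\<integral>\<^sup>+w\<in>ball 0 R. V (x + v + c *\<^sub>R w) \<partial>lborel"
  have \<kappa>: "\<kappa> \<ge> 0" using near R by (metis norm_ge_zero order_trans zero_le_mult_iff not_le)
  have "ennreal (c ^ DIM('a)) * ?I
     = ennreal (c ^ DIM('a)) * (\<integral>\<^sup>+w. (\<lambda>z. V z * indicator (ball (x + v) (c * R)) z) (x + v + c *\<^sub>R w) \<partial>lborel)"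
    using c by (auto intro!: arg_cong2[where f="(*)"] nn_integral_cong simp: indicator_def dist_norm)
  also have "\<dots> = (\<integral>\<^sup>+z. V z * indicator (ball (x + v) (c * R)) z \<partial>lborel)"
    by (rule nn_integral_lborel_affine[OF _ c, symmetric]) measurable
  also have "\<dots> \<le> (\<integral>\<^sup>+z\<in>ball x ((\<kappa> + c) * R). V z \<partial>lborel)"
  proof (intro nn_integral_mono)
    fix z
    have "dist x z < (\<kappa> + c) * R" if "dist (x + v) z < c * R"
    proof -
      have "dist x z \<le> dist (x + v) z + norm v"
        using dist_triangle[of x z "x + v"] by (simp add: dist_norm)
      then show ?thesis using that near by (simp add: distrib_right)
    qed
    then show "V z * indicator (ball (x + v) (c * R)) z \<le> V z * indicator (ball x ((\<kappa> + c) * R)) z"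
      by (auto simp: indicator_def)
  qed
  also have "\<dots> \<le> hl_max V x * emeasure lborel (ball x ((\<kappa> + c) * R))"
    using \<kappa> c R by (intro ball_integral_le_hl_max) auto
  finally have *: "ennreal (c ^ DIM('a)) * ?I
     \<le> hl_max V x * emeasure lborel (ball x ((\<kappa> + c) * R))" .
  have "?I
     = ennreal (1 / c ^ DIM('a)) * (ennreal (c ^ DIM('a)) * ?I)"
    using c by (simp add: mult.assoc[symmetric] ennreal_mult[symmetric])
  also have "\<dots> \<le> ennreal (1 / c ^ DIM('a)) * (hl_max V x * emeasure lborel (ball x ((\<kappa> + c) * R)))"
    by (intro mult_left_mono *) auto
  also have "\<dots> = ennreal (((\<kappa> + c) / c) ^ DIM('a)) * emeasure lborel (ball (0::'a) R) * hl_max V x"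
  proof -
    have "ennreal (1 / c ^ DIM('a)) * emeasure lborel (ball x ((\<kappa> + c) * R)) = ennreal (((\<kappa> + c) / c) ^ DIM('a)) * emeasure lborel (ball (0::'a) R)"
      using \<kappa> c R unit_ball_vol_pos[of "real DIM('a)"]
      by (simp add: emeasure_ball_scaled ennreal_mult[symmetric] power_mult_distrib power_divide mult_ac)
    then show ?thesis by (metis mult.assoc mult.commute)
  qed
  finally show ?thesis .
qed

section \<open>Finite differences of the Gaussian\<close>

abbreviation alt_binom :: "nat \<Rightarrow> nat \<Rightarrow> 'a::comm_ring_1" where
  "alt_binom m j \<equiv> (-1) ^ j * of_nat (m choose j)"

abbreviation finite_difference :: "nat \<Rightarrow> ('b::real_vector \<Rightarrow> 'a::comm_ring_1) \<Rightarrow> 'b \<Rightarrow> 'b \<Rightarrow> 'a" where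
  "finite_difference m F x h \<equiv> \<Sum>j\<le>m. alt_binom m j * F (x + real j *\<^sub>R h)"

text \<open>
  An \<open>m\<close>-th difference annihilates polynomials of degree below \<open>m\<close>. Pascal's rule turns the sum for \<open>m + 1\<close> into a
  sum for \<open>m\<close> of the first difference, which has smaller degree.
\<close>

lemma binomial_alternating_sum_power:
  "k < m \<Longrightarrow> (\<Sum>j\<le>m. alt_binom m j * of_nat j ^ k) = (0::'a::comm_ring_1)"
proof (induction m arbitrary: k)
  case 0 then show ?case by simp
next
  case (Suc m)
  have pascal: "(\<Sum>j\<le>Suc m. alt_binom (Suc m) j * P j)
      = (\<Sum>j\<le>m. alt_binom m j * P j) - (\<Sum>j\<le>m. alt_binom m j * P (Suc j))"
    for P :: "nat \<Rightarrow> 'a"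
  proof -
    have "(\<Sum>j\<le>Suc m. alt_binom (Suc m) j * P j)
        = P 0 - (\<Sum>j\<le>m. (-1) ^ j * of_nat (Suc m choose Suc j) * P (Suc j))"
      by (subst sum.atMost_Suc_shift) (simp add: sum_negf)
    also have "(\<Sum>j\<le>m. (-1) ^ j * of_nat (Suc m choose Suc j) * P (Suc j)) =
        (\<Sum>j\<le>m. alt_binom m j * P (Suc j)) + (\<Sum>j\<le>m. (-1) ^ j * of_nat (m choose Suc j) * P (Suc j))"
      by (simp add: sum.distrib[symmetric] algebra_simps)
    also have "P 0 - \<dots> = (\<Sum>j\<le>Suc m. alt_binom m j * P j) - (\<Sum>j\<le>m. alt_binom m j * P (Suc j))"
      by (subst sum.atMost_Suc_shift) (simp add: sum_negf)
    also have "(\<Sum>j\<le>Suc m. alt_binom m j * P j) = (\<Sum>j\<le>m. alt_binom m j * P j)"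
      by (simp add: binomial_eq_0)
    finally show ?thesis .
  qed
  have expand: "of_nat (Suc j) ^ k = of_nat j ^ k + (\<Sum>i<k. of_nat (k choose i) * (of_nat j ^ i :: 'a))" for j
    using binomial_ring[of "of_nat j :: 'a" 1 k] by (simp add: lessThan_Suc_atMost[symmetric] add.commute)
  have "(\<Sum>j\<le>Suc m. alt_binom (Suc m) j * of_nat j ^ k)
     = - (\<Sum>j\<le>m. \<Sum>i<k. alt_binom m j * (of_nat (k choose i) * (of_nat j ^ i :: 'a)))"
    unfolding pascal expand by (simp add: distrib_left sum.distrib sum_distrib_left)
  also have "\<dots> = - (\<Sum>i<k. of_nat (k choose i) * (\<Sum>j\<le>m. alt_binom m j * (of_nat j ^ i :: 'a)))"
    by (subst sum.swap) (simp add: sum_distrib_left mult_ac)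
  also have "\<dots> = 0"
    using Suc by (intro neg_equal_0_iff_equal[THEN iffD2] sum.neutral) auto
  finally show ?case .
qed

text \<open>
  Expand \<open>F\<close> in its power series at \<open>0\<close>: the difference kills the terms of order below \<open>m\<close>, and Cauchy's estimate
  bounds the remaining ones by a geometric series of ratio at most \<open>m/\<rho> \<le> 1/2\<close>.
\<close>

lemma entire_difference_bound:
  fixes F :: "complex \<Rightarrow> complex"
  assumes hol: "F holomorphic_on UNIV" and \<rho>: "\<rho> \<ge> 2 * real (Suc m)"
    and B: "\<And>\<tau>. norm \<tau> = \<rho> \<Longrightarrow> norm (F \<tau>) \<le> B"
  shows "norm (\<Sum>j\<le>m. alt_binom m j * F (of_nat j)) \<le> 2 * 2 ^ m * B * (2 * real m / \<rho>) ^ m"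
proof -
  have "2 * real (Suc m) > 0" by simp
  with \<rho> have \<rho>0: "\<rho> > 0" by (rule less_le_trans[rotated])
  define a where "a n = (deriv ^^ n) F 0 / fact n" for n
  have B0: "B \<ge> 0" using B[of "of_real \<rho>"] \<rho>0 by (auto intro: order_trans[OF norm_ge_zero])
  have a: "norm (a n) \<le> B / \<rho> ^ n" for n
  proof -
    have "norm ((deriv ^^ n) F 0) \<le> fact n * B / \<rho> ^ n"
      using \<rho>0 B by (intro Cauchy_inequality holomorphic_on_subset[OF hol] holomorphic_on_imp_continuous_on) auto
    then show ?thesis by (simp add: a_def norm_divide field_simps)
  qed
  let ?c = "\<lambda>j. alt_binom m j :: complex"
  have sums: "(\<lambda>n. a n * of_nat j ^ n) sums F (of_nat j)" if "j \<le> m" for j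
  proof -
    have "(\<lambda>n. (deriv ^^ n) F 0 / fact n * (of_nat j - 0) ^ n) sums F (of_nat j)"
      using that \<rho> by (intro holomorphic_power_series[of F 0 \<rho>] holomorphic_on_subset[OF hol]) auto
    then show ?thesis by (simp add: a_def)
  qed
  have "(\<lambda>n. \<Sum>j\<le>m. ?c j * (a n * of_nat j ^ n)) sums (\<Sum>j\<le>m. ?c j * F (of_nat j))"
    by (intro sums_sum sums_mult sums) auto
  then have S: "(\<lambda>n. a n * (\<Sum>j\<le>m. ?c j * of_nat j ^ n)) sums (\<Sum>j\<le>m. ?c j * F (of_nat j))"
    by (simp add: sum_distrib_left mult_ac)
  define D where "D = 2 ^ m * B * (2 * real m / \<rho>) ^ m"
  have bd: "norm (a n * (\<Sum>j\<le>m. ?c j * of_nat j ^ n)) \<le> D * (1/2) ^ n" for n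
  proof (cases "n < m")
    case True
    then show ?thesis using binomial_alternating_sum_power[OF True, where 'a=complex] B0 \<rho>0 by (simp add: D_def)
  next
    case False
    have "norm (\<Sum>j\<le>m. ?c j * of_nat j ^ n) \<le> (\<Sum>j\<le>m. real (m choose j) * real m ^ n)"
      by (intro sum_norm_le) (auto simp: norm_mult norm_power intro!: mult_left_mono power_mono)
    also have "\<dots> = 2 ^ m * real m ^ n"
      using choose_row_sum[of m] by (simp add: sum_distrib_right[symmetric] of_nat_sum[symmetric] del: of_nat_sum)
    finally have "norm (a n * (\<Sum>j\<le>m. ?c j * of_nat j ^ n)) \<le> B / \<rho> ^ n * (2 ^ m * real m ^ n)"
      unfolding norm_mult using B0 \<rho>0 by (intro mult_mono a) auto
    also have "\<dots> = 2 ^ m * B * (real m / \<rho>) ^ n" by (simp add: power_divide)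
    also have "(real m / \<rho>) ^ n \<le> (2 * real m / \<rho>) ^ m * (1/2) ^ n"
    proof -
      have "(real m / \<rho>) ^ n = (real m / \<rho>) ^ m * (real m / \<rho>) ^ (n - m)"
        using False by (simp flip: power_add)
      also have "\<dots> \<le> (real m / \<rho>) ^ m * (1/2) ^ (n - m)"
        using \<rho> \<rho>0 by (intro mult_left_mono power_mono) (auto simp: field_simps)
      also have "\<dots> = (2 * real m / \<rho>) ^ m * ((1/2) ^ m * (1/2) ^ (n - m))"
        by (simp add: power_divide power_mult_distrib)
      also have "(1/2) ^ m * (1/2) ^ (n - m) = (1/2 :: real) ^ n"
        using False by (simp flip: power_add)
      finally show ?thesis .
    qed
    finally show ?thesis using B0 by (simp add: D_def mult_left_mono mult.assoc)
  qed
  have geo: "(\<lambda>n. D * (1/2) ^ n) sums (D * 2)"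
    using sums_mult[OF geometric_sums[of "1/2 :: real"]] by simp
  have "norm (\<Sum>j\<le>m. ?c j * F (of_nat j)) \<le> D * 2"
    using S geo bd by (rule norm_sums_le)
  then show ?thesis by (simp add: D_def mult_ac)
qed

text \<open>
  Restricted to the line \<open>z + \<tau> h\<close>, the Gaussian is an entire function of \<open>\<tau>\<close>. It is still controlled by
  \<open>exp (- |z|\<^sup>2 / 4)\<close> for complex \<open>\<tau>\<close> up to a size of order \<open>1 / |h|\<close>, which is the radius put into the previous
  estimate; no derivative of the Gaussian has to be computed.
\<close>

lemma gaussian_difference_bound:
  fixes \<kappa> :: real
  assumes "\<kappa> \<ge> 0"
  shows "\<exists>C>0. \<forall>(z::'a::euclidean_space) h. norm h \<le> \<kappa> \<longrightarrow>
    \<bar>\<Sum>j\<le>m. alt_binom m j * exp (- (norm (z + real j *\<^sub>R h))\<^sup>2 / 2)\<bar>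
      \<le> C * norm h ^ m * exp (- (norm z)\<^sup>2 / 4)"
proof -
  \<comment> \<open>Large enough for the radius \<open>R / |h|\<close> to be at least \<open>2 (m + 1)\<close> whenever \<open>|h| \<le> \<kappa>\<close>.\<close>
  define R where "R = 2 * real (Suc m) * (\<kappa> + 1)"
  have R: "R > 0" using assms by (simp add: R_def)
  define C where "C = 2 * 2 ^ m * exp (3 * R\<^sup>2 / 2) * (2 * real m / R) ^ m + 1"
  have C0: "2 * 2 ^ m * exp (3 * R\<^sup>2 / 2) * (2 * real m / R) ^ m \<ge> 0" using R by simp
  have "\<bar>\<Sum>j\<le>m. alt_binom m j * exp (- (norm (z + real j *\<^sub>R h))\<^sup>2 / 2)\<bar>
      \<le> C * norm h ^ m * exp (- (norm z)\<^sup>2 / 4)" if h: "norm h \<le> \<kappa>" for z h :: 'a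
  proof (cases "h = 0 \<or> m = 0")
    case True
    show ?thesis
    proof (cases "m = 0")
      case True
      have "exp (- (norm z)\<^sup>2 / 2) \<le> exp (- (norm z)\<^sup>2 / 4)" by simp
      also have "\<dots> \<le> C * exp (- (norm z)\<^sup>2 / 4)"
        using C0 by (simp add: C_def)
      finally show ?thesis using True by simp
    next
      case False
      then have "(\<Sum>j\<le>m. alt_binom m j * exp (- (norm (z + real j *\<^sub>R h))\<^sup>2 / 2)) = 0"
        using \<open>h = 0 \<or> m = 0\<close> binomial_alternating_sum_power[of 0 m, where 'a=real]
        by (simp flip: sum_distrib_right)
      then show ?thesis using C0 by (auto simp: C_def)
    qed
  next
    case False
    then have h0: "norm h > 0" by simp
    define F :: "complex \<Rightarrow> complex" where
      "F \<tau> = exp (- (of_real ((norm z)\<^sup>2) + 2 * of_real (z \<bullet> h) * \<tau> + of_real ((norm h)\<^sup>2) * \<tau>\<^sup>2) / 2)" for \<tau>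
    define \<rho> where "\<rho> = R / norm h"
    have F_nat: "F (of_nat j) = of_real (exp (- (norm (z + real j *\<^sub>R h))\<^sup>2 / 2))" for j
    proof -
      have "(norm (z + real j *\<^sub>R h))\<^sup>2 = (norm z)\<^sup>2 + 2 * (z \<bullet> h) * real j + (norm h)\<^sup>2 * (real j)\<^sup>2"
        unfolding power2_norm_eq_inner inner_add_left inner_add_right inner_scaleR_left inner_scaleR_right
        by (simp add: inner_commute[of h z] algebra_simps power2_eq_square)
      then show ?thesis by (simp add: F_def exp_of_real[symmetric])
    qed
    have \<rho>: "\<rho> \<ge> 2 * real (Suc m)"
    proof -
      have "2 * real (Suc m) * norm h \<le> 2 * real (Suc m) * (\<kappa> + 1)"
        using h by (intro mult_left_mono) auto
      then show ?thesis using h0 by (simp add: \<rho>_def R_def field_simps)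
    qed
    have F_le: "norm (F \<tau>) \<le> exp (- (norm z)\<^sup>2 / 4) * exp (3 * R\<^sup>2 / 2)" if "norm \<tau> = \<rho>" for \<tau>
    proof -
      have h\<tau>: "norm h * norm \<tau> = R" using h0 that by (simp add: \<rho>_def)
      have 1: "- Re (of_real (z \<bullet> h) * \<tau>) \<le> norm z * R"
      proof -
        have "- Re (of_real (z \<bullet> h) * \<tau>) \<le> norm (of_real (z \<bullet> h) * \<tau>)"
          using abs_Re_le_cmod[of "of_real (z \<bullet> h) * \<tau>"] by linarith
        also have "\<dots> = \<bar>z \<bullet> h\<bar> * norm \<tau>" by (simp add: norm_mult)
        also have "\<dots> \<le> (norm z * norm h) * norm \<tau>"
          by (intro mult_right_mono Cauchy_Schwarz_ineq2) auto
        finally show ?thesis using h\<tau> by (simp add: mult.assoc)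
      qed
      have 2: "- Re (of_real ((norm h)\<^sup>2) * \<tau>\<^sup>2) \<le> R\<^sup>2"
      proof -
        have "- Re (of_real ((norm h)\<^sup>2) * \<tau>\<^sup>2) \<le> norm (of_real ((norm h)\<^sup>2) * \<tau>\<^sup>2)"
          using abs_Re_le_cmod[of "of_real ((norm h)\<^sup>2) * \<tau>\<^sup>2"] by linarith
        also have "\<dots> = (norm h * norm \<tau>)\<^sup>2" by (simp add: norm_mult norm_power power_mult_distrib)
        finally show ?thesis using h\<tau> by simp
      qed
      have 3: "norm z * R \<le> (norm z)\<^sup>2 / 4 + R\<^sup>2"
        using zero_le_power2[of "norm z / 2 - R"] by (simp add: power2_diff power_divide)
      have "Re (- (of_real ((norm z)\<^sup>2) + 2 * of_real (z \<bullet> h) * \<tau> + of_real ((norm h)\<^sup>2) * \<tau>\<^sup>2) / 2)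
         = (- (norm z)\<^sup>2) / 2 + (- Re (of_real (z \<bullet> h) * \<tau>)) + (- Re (of_real ((norm h)\<^sup>2) * \<tau>\<^sup>2)) / 2"
        by (simp add: field_simps)
      also have "\<dots> \<le> - (norm z)\<^sup>2 / 4 + 3 * R\<^sup>2 / 2"
        using 1 2 3 by (simp add: field_simps)
      finally show ?thesis unfolding F_def norm_exp_eq_Re by (simp add: mult_exp_exp)
    qed
    have "norm (\<Sum>j\<le>m. alt_binom m j * F (of_nat j))
       \<le> 2 * 2 ^ m * (exp (- (norm z)\<^sup>2 / 4) * exp (3 * R\<^sup>2 / 2)) * (2 * real m / \<rho>) ^ m"
      by (rule entire_difference_bound[OF _ \<rho> F_le]) (auto simp: F_def[abs_def] intro!: holomorphic_intros)
    also have "(\<Sum>j\<le>m. alt_binom m j * F (of_nat j)) =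
       of_real (\<Sum>j\<le>m. alt_binom m j * exp (- (norm (z + real j *\<^sub>R h))\<^sup>2 / 2))"
      by (simp add: F_nat)
    also have "2 * 2 ^ m * (exp (- (norm z)\<^sup>2 / 4) * exp (3 * R\<^sup>2 / 2)) * (2 * real m / \<rho>) ^ m
       = (C - 1) * norm h ^ m * exp (- (norm z)\<^sup>2 / 4)"
      by (simp add: C_def \<rho>_def power_divide power_mult_distrib)
    also have "\<dots> \<le> C * norm h ^ m * exp (- (norm z)\<^sup>2 / 4)"
      by (intro mult_right_mono) auto
    finally show ?thesis by (simp only: norm_of_real)
  qed
  moreover have "C > 0" unfolding C_def using C0 by linarith
  ultimately show ?thesis by blast
qed

section \<open>The Fourier transform of a test function\<close>

lemma test_functions_mono: "A \<subseteq> B \<Longrightarrow> test_functions A \<subseteq> test_functions B"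
  by (auto simp: test_functions_def)

lemma test_function_differentiable:
  assumes "f \<in> test_functions UNIV"
  shows "f differentiable at x"
proof -
  have "Ck_on (Suc 0) f UNIV" using assms unfolding test_functions_def smooth_on_def by blast
  then show ?thesis by simp
qed

lemma test_function_has_derivative:
  assumes "f \<in> test_functions UNIV"
  shows "(f has_derivative frechet_derivative f (at x)) (at x)"
  using test_function_differentiable[OF assms] frechet_derivative_works by blast

lemma test_function_continuous:
  assumes "f \<in> test_functions UNIV"
  shows "continuous_on A f"
  using test_function_differentiable[OF assms]
  by (simp add: continuous_at_imp_continuous_on differentiable_imp_continuous_within)

lemma test_function_directional_derivative:
  assumes f: "f \<in> test_functions UNIV"
  shows "(\<lambda>x. frechet_derivative f (at x) v) \<in> test_functions UNIV"
proof -
  let ?D = "\<lambda>x. frechet_derivative f (at x) v"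
  have "Ck_on n ?D UNIV" for n
  proof -
    have "Ck_on (Suc n) f UNIV" using f unfolding test_functions_def smooth_on_def by blast
    then show ?thesis by simp
  qed
  moreover have "{x. ?D x \<noteq> 0} \<subseteq> closure {x. f x \<noteq> 0}"
  proof
    fix x assume x: "x \<in> {x. ?D x \<noteq> 0}"
    show "x \<in> closure {x. f x \<noteq> 0}"
    proof (rule ccontr)
      assume nin: "x \<notin> closure {x. f x \<noteq> 0}"
      have "(f has_derivative (\<lambda>_. 0)) (at x)"
      proof (rule has_derivative_transform_within_open)
        show "((\<lambda>_. 0) has_derivative (\<lambda>_. 0)) (at x)" by simp
        show "open (- closure {x. f x \<noteq> 0})" by (intro open_Compl closed_closure)
        show "x \<in> - closure {x. f x \<noteq> 0}" using nin by simp
        show "0 = f y" if "y \<in> - closure {x. f x \<noteq> 0}" for y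
          using that closure_subset[of "{x. f x \<noteq> 0}"] by auto
      qed
      then have "frechet_derivative f (at x) = (\<lambda>_. 0)" by (rule frechet_derivative_at[symmetric])
      then show False using x by simp
    qed
  qed
  then have "closure {x. ?D x \<noteq> 0} \<subseteq> closure {x. f x \<noteq> 0}" by (simp add: closure_minimal)
  then have "compact (closure {x. ?D x \<noteq> 0})"
    using f by (metis (mono_tags, lifting) closed_closure compact_Int_closed inf.absorb_iff2 mem_Collect_eq test_functions_def)
  ultimately show ?thesis by (simp add: test_functions_def smooth_on_def)
qed

lemma test_function_support:
  assumes "f \<in> test_functions UNIV"
  obtains R where "R > 0" "\<And>x. f x \<noteq> 0 \<Longrightarrow> norm x \<le> R"
proof -
  have "bounded (closure {x. f x \<noteq> 0})"
    using assms by (simp add: test_functions_def compact_imp_bounded)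
  then obtain R where "R > 0" "\<And>x. x \<in> closure {x. f x \<noteq> 0} \<Longrightarrow> norm x \<le> R"
    by (auto simp: bounded_pos)
  then show ?thesis using that closure_subset[of "{x. f x \<noteq> 0}"] by blast
qed

lemma test_function_bounded:
  assumes "f \<in> test_functions UNIV"
  obtains B where "B > 0" "\<And>x. norm (f x) \<le> B"
proof -
  obtain R where R: "R > 0" "\<And>x. f x \<noteq> 0 \<Longrightarrow> norm x \<le> R" using test_function_support[OF assms] by blast
  have "bounded (f ` cball 0 R)"
    by (intro compact_imp_bounded compact_continuous_image test_function_continuous[OF assms] compact_cball)
  then obtain B where B: "B > 0" "\<And>x. x \<in> cball 0 R \<Longrightarrow> norm (f x) \<le> B" by (auto simp: bounded_pos)
  have "norm (f x) \<le> B" for x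
    using B R(2)[of x] by (cases "f x = 0") auto
  then show ?thesis using that B by blast
qed

lemma test_function_borel:
  assumes "f \<in> test_functions UNIV"
  shows "f \<in> borel_measurable borel"
  by (intro borel_measurable_continuous_onI test_function_continuous assms)

lemma test_function_integrable:
  assumes "f \<in> test_functions UNIV"
  shows "integrable lborel f"
proof -
  obtain R where R: "R > 0" "\<And>x. f x \<noteq> 0 \<Longrightarrow> norm x \<le> R" using test_function_support[OF assms] by blast
  have "integrable lborel (\<lambda>x. indicator (cball 0 R) x *\<^sub>R f x)"
    by (intro borel_integrable_compact test_function_continuous assms compact_cball)
  moreover have "(\<lambda>x. indicator (cball 0 R) x *\<^sub>R f x) = f"
    using R by (fastforce simp: indicator_def fun_eq_iff)
  ultimately show ?thesis by simp
qed

lemma integral_lborel_affine: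
  fixes F :: "'a::euclidean_space \<Rightarrow> complex"
  assumes [measurable]: "F \<in> borel_measurable borel" and "c > 0"
  shows "(LINT x|lborel. F x) = of_real (c ^ DIM('a)) * (LINT x|lborel. F (t + c *\<^sub>R x))"
proof -
  have "(LINT x|lborel. F x) = (LINT x|density (distr lborel borel (\<lambda>x. t + c *\<^sub>R x)) (\<lambda>_. \<bar>c\<bar>^DIM('a)). F x)"
    using assms(2) by (intro arg_cong[of _ _ "\<lambda>M. integral\<^sup>L M F"] lborel_affine) simp
  also have "\<dots> = (LINT x|distr lborel borel (\<lambda>x. t + c *\<^sub>R x). (c ^ DIM('a)) *\<^sub>R F x)"
    using assms(2) by (subst integral_density) simp_all
  also have "\<dots> = (LINT x|lborel. (c ^ DIM('a)) *\<^sub>R F (t + c *\<^sub>R x))"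
    by (subst integral_distr) simp_all
  finally show ?thesis by (simp add: scaleR_conv_of_real)
qed

lemma integrable_lborel_affine:
  fixes F :: "'a::euclidean_space \<Rightarrow> complex"
  assumes F: "integrable lborel F" and "c > 0"
  shows "integrable lborel (\<lambda>x. F (t + c *\<^sub>R x))"
proof -
  have [measurable]: "F \<in> borel_measurable borel" using F by auto
  have "(\<integral>\<^sup>+x. ennreal (norm (F x)) \<partial>lborel) = ennreal (c ^ DIM('a)) * (\<integral>\<^sup>+x. ennreal (norm (F (t + c *\<^sub>R x))) \<partial>lborel)"
    using assms(2) by (intro nn_integral_lborel_affine) auto
  moreover have "(\<integral>\<^sup>+x. ennreal (norm (F x)) \<partial>lborel) < \<infinity>" using F by (simp add: integrable_iff_bounded)
  ultimately have "(\<integral>\<^sup>+x. ennreal (norm (F (t + c *\<^sub>R x))) \<partial>lborel) < \<infinity>"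
    using assms(2) by (auto simp: ennreal_mult_less_top)
  then show ?thesis by (simp add: integrable_iff_bounded)
qed

lemma has_derivative_directional_limit:
  fixes f :: "'a::euclidean_space \<Rightarrow> complex"
  assumes "(f has_derivative D) (at x)"
  shows "(\<lambda>n. (f (x + (1 / real (Suc n)) *\<^sub>R v) - f x) / of_real (1 / real (Suc n))) \<longlonglongrightarrow> D v"
proof -
  let ?d = "\<lambda>h::real. (f (x + h *\<^sub>R v) - f x - h *\<^sub>R D v) /\<^sub>R \<bar>h\<bar>"
  have lin: "linear D" using assms has_derivative_linear by blast
  have "((\<lambda>t::real. x + t *\<^sub>R v) has_derivative (\<lambda>t. t *\<^sub>R v)) (at 0)"
    by (auto intro!: derivative_eq_intros)
  then have "((\<lambda>t. f (x + t *\<^sub>R v)) has_derivative (\<lambda>t. D (t *\<^sub>R v))) (at 0)"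
    by (rule has_derivative_compose) (simp add: assms)
  then have "((\<lambda>t. f (x + t *\<^sub>R v)) has_vector_derivative D v) (at 0)"
    by (simp add: has_vector_derivative_def linear_scale[OF lin])
  then have "((\<lambda>h. norm (f (x + h *\<^sub>R v) - f x - h *\<^sub>R D v) / \<bar>h\<bar>) \<longlongrightarrow> 0) (at 0)"
    by (simp add: has_vector_derivative_def has_derivative_iff_norm)
  then have "((\<lambda>h. norm (?d h)) \<longlongrightarrow> 0) (at 0)"
    by (simp add: divide_inverse mult.commute)
  then have "((\<lambda>h. ?d h) \<longlongrightarrow> 0) (at 0)"
    by (rule tendsto_norm_zero_cancel)
  moreover have "filterlim (\<lambda>n. 1 / real (Suc n)) (at 0) sequentially"
    using LIMSEQ_inverse_real_of_nat by (simp add: filterlim_at inverse_eq_divide del: of_nat_Suc)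
  ultimately have "(\<lambda>n. ?d (1 / real (Suc n))) \<longlonglongrightarrow> 0"
    by (rule filterlim_compose)
  then have "(\<lambda>n. ?d (1 / real (Suc n)) + D v) \<longlonglongrightarrow> 0 + D v"
    by (intro tendsto_add tendsto_const)
  moreover have "?d (1 / real (Suc n)) + D v
     = (f (x + (1 / real (Suc n)) *\<^sub>R v) - f x) / of_real (1 / real (Suc n))" for n
    by (simp add: scaleR_conv_of_real field_simps del: of_nat_Suc)
  ultimately show ?thesis by simp
qed

lemma test_function_lipschitz:
  assumes f: "f \<in> test_functions UNIV" and B: "\<And>x. norm (frechet_derivative f (at x) v) \<le> B"
  shows "norm (f (x + t *\<^sub>R v) - f x) \<le> B * \<bar>t\<bar>"
proof -
  have "norm ((\<lambda>t. f (x + t *\<^sub>R v)) t - (\<lambda>t. f (x + t *\<^sub>R v)) 0) \<le> B * norm (t - 0)"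
  proof (rule differentiable_bound[of UNIV])
    fix t :: real
    let ?D = "frechet_derivative f (at (x + t *\<^sub>R v))"
    have lin: "linear ?D" using test_function_has_derivative[OF f] has_derivative_linear by blast
    show "((\<lambda>t. f (x + t *\<^sub>R v)) has_derivative (\<lambda>t. t *\<^sub>R ?D v)) (at t within UNIV)"
    proof -
      have "((\<lambda>t::real. x + t *\<^sub>R v) has_derivative (\<lambda>t. t *\<^sub>R v)) (at t)"
        by (auto intro!: derivative_eq_intros)
      then have "((\<lambda>t. f (x + t *\<^sub>R v)) has_derivative (\<lambda>t. ?D (t *\<^sub>R v))) (at t)"
        by (rule has_derivative_compose) (rule test_function_has_derivative[OF f])
      then show ?thesis by (simp add: linear_scale[OF lin])
    qed
    show "onorm (\<lambda>t. t *\<^sub>R ?D v) \<le> B"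
      using B[of "x + t *\<^sub>R v"] by (intro onorm_le) (simp add: mult.commute[of B] mult_left_mono)
  qed auto
  then show ?thesis by simp
qed

lemma borel_measurable_cis [measurable]: "cis \<in> borel_measurable borel"
  by (intro borel_measurable_continuous_onI continuous_intros)

text \<open>
  Instead of integrating by parts, compare difference quotients: translating \<open>f\<close> multiplies the Fourier integral by
  a character, and dominated convergence passes to the limit on both sides. The quotients are dominated by a
  Lipschitz bound on a fixed ball containing the supports of all the translates.
\<close>

lemma fourier_directional_derivative:
  fixes f :: "'a::euclidean_space \<Rightarrow> complex"
  assumes f: "f \<in> test_functions UNIV"
  shows "fourier (\<lambda>x. frechet_derivative f (at x) v) \<xi> = \<i> * of_real (v \<bullet> \<xi>) * fourier f \<xi>"
proof -
  let ?r = "\<lambda>n::nat. 1 / real (Suc n)"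
  let ?e = "\<lambda>x. cis (- (x \<bullet> \<xi>))"
  let ?D = "\<lambda>x. frechet_derivative f (at x) v"
  have [measurable]: "f \<in> borel_measurable borel" by (rule test_function_borel[OF f])
  have [measurable]: "?D \<in> borel_measurable borel"
    by (rule test_function_borel[OF test_function_directional_derivative[OF f]])
  obtain B where B: "B > 0" "\<And>x. norm (?D x) \<le> B"
    using test_function_bounded[OF test_function_directional_derivative[OF f]] by blast
  obtain R where R: "R > 0" "\<And>x. f x \<noteq> 0 \<Longrightarrow> norm x \<le> R" using test_function_support[OF f] by blast
  define q where "q n x = (f (x + (?r n) *\<^sub>R v) - f x) / of_real (?r n)" for n x
  have q_bd: "norm (q n x) \<le> B * indicator (cball 0 (R + norm v)) x" for n x
  proof (cases "x \<in> cball 0 (R + norm v)")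
    case True
    have "norm (f (x + (?r n) *\<^sub>R v) - f x) \<le> B * \<bar>?r n\<bar>"
      by (rule test_function_lipschitz[OF f B(2)])
    then have "norm (f (x + (?r n) *\<^sub>R v) - f x) / \<bar>?r n\<bar> \<le> B"
      by (subst pos_divide_le_eq) (simp_all del: of_nat_Suc)
    then show ?thesis using True by (simp only: q_def norm_divide norm_of_real) simp
  next
    case False
    have "norm x > R + norm v" using False by simp
    moreover have "norm ((?r n) *\<^sub>R v) \<le> norm v"
      by (simp add: divide_le_eq mult_le_cancel_left1)
    moreover have "norm x \<le> norm (x + (?r n) *\<^sub>R v) + norm ((?r n) *\<^sub>R v)"
      using norm_triangle_ineq4[of "x + (?r n) *\<^sub>R v" "(?r n) *\<^sub>R v"] by simp
    ultimately have "norm (x + (?r n) *\<^sub>R v) > R" "norm x > R"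
      using norm_ge_zero[of v] by linarith+
    then have "f (x + (?r n) *\<^sub>R v) = 0" "f x = 0" using R(2) by (meson not_le)+
    then show ?thesis using B by (simp add: q_def)
  qed
  have lim1: "(\<lambda>n. LINT x|lborel. ?e x * q n x) \<longlonglongrightarrow> (LINT x|lborel. ?e x * ?D x)"
  proof (rule integral_dominated_convergence)
    show "integrable lborel (\<lambda>x::'a. B * indicator (cball 0 (R + norm v)) x :: real)"
      using emeasure_lborel_cball_finite[of "0::'a" "R + norm v"]
      by (intro integrable_mult_right integrable_real_indicator) auto
    show "AE x in lborel. (\<lambda>n. ?e x * q n x) \<longlonglongrightarrow> ?e x * ?D x"
      unfolding q_def
      by (intro AE_I2 tendsto_mult tendsto_const has_derivative_directional_limit test_function_has_derivative f)
    show "AE x in lborel. norm (?e x * q n x) \<le> B * indicator (cball 0 (R + norm v)) x" for n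
      using q_bd by (auto simp: norm_mult)
  qed (unfold q_def, measurable)
  let ?I = "LINT x|lborel. ?e x * f x"
  have int_f: "integrable lborel (\<lambda>x. ?e x * f x)"
    by (rule Bochner_Integration.integrable_bound[OF test_function_integrable[OF f]]) (auto simp: norm_mult)
  have shift: "(LINT x|lborel. ?e x * f (x + t *\<^sub>R v)) = cis (t * (v \<bullet> \<xi>)) * ?I"
    and int_shift: "integrable lborel (\<lambda>x. ?e x * f (x + t *\<^sub>R v))" for t
  proof -
    have eq: "?e x * f (x + t *\<^sub>R v) = cis (t * (v \<bullet> \<xi>)) * (cis (- ((t *\<^sub>R v + 1 *\<^sub>R x) \<bullet> \<xi>)) * f (t *\<^sub>R v + 1 *\<^sub>R x))" for x
      by (simp add: inner_add_left cis_mult mult.assoc[symmetric] add.commute)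
    show "integrable lborel (\<lambda>x. ?e x * f (x + t *\<^sub>R v))"
      unfolding eq by (intro integrable_mult_right integrable_lborel_affine[where F = "\<lambda>x. ?e x * f x"] int_f) simp
    have "?I = (LINT x|lborel. cis (- ((t *\<^sub>R v + 1 *\<^sub>R x) \<bullet> \<xi>)) * f (t *\<^sub>R v + 1 *\<^sub>R x))"
      by (subst integral_lborel_affine[where c = 1 and t = "t *\<^sub>R v"]) auto
    then show "(LINT x|lborel. ?e x * f (x + t *\<^sub>R v)) = cis (t * (v \<bullet> \<xi>)) * ?I"
      unfolding eq by simp
  qed
  have "(LINT x|lborel. ?e x * q n x) = (cis ((?r n) * (v \<bullet> \<xi>)) - 1) / of_real (?r n) * ?I" for n
  proof -
    let ?t = "1 / real (Suc n)"
    have "(LINT x|lborel. ?e x * q n x)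
       = (LINT x|lborel. (?e x * f (x + ?t *\<^sub>R v) - ?e x * f x) / of_real ?t)"
      by (simp only: q_def right_diff_distrib times_divide_eq_right)
    also have "\<dots> = (cis (?t * (v \<bullet> \<xi>)) * ?I - ?I) / of_real ?t"
      using int_shift[of ?t] int_f by (simp only: integral_divide_zero Bochner_Integration.integral_diff shift)
    finally show ?thesis by (simp only: left_diff_distrib mult_1_left times_divide_eq_left diff_divide_distrib)
  qed
  with lim1 have lim2: "(\<lambda>n. (cis ((?r n) * (v \<bullet> \<xi>)) - 1) / of_real (?r n) * ?I) \<longlonglongrightarrow> (LINT x|lborel. ?e x * ?D x)"
    by simp
  have "((\<lambda>t. cis (t * (v \<bullet> \<xi>))) has_derivative (\<lambda>t. t *\<^sub>R (\<i> * of_real (v \<bullet> \<xi>)))) (at 0)"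
    using exp_scaleR_has_vector_derivative_right[of "\<i> * of_real (v \<bullet> \<xi>)" 0 UNIV]
    by (simp add: has_vector_derivative_def cis_conv_exp scaleR_conv_of_real mult_ac)
  from has_derivative_directional_limit[OF this, of 1]
  have "(\<lambda>n. (cis ((?r n) * (v \<bullet> \<xi>)) - 1) / of_real (?r n) * ?I) \<longlonglongrightarrow> (\<i> * of_real (v \<bullet> \<xi>)) * ?I"
    by (intro tendsto_mult tendsto_const) (simp del: of_nat_Suc)
  with lim2 have "(LINT x|lborel. ?e x * ?D x) = (\<i> * of_real (v \<bullet> \<xi>)) * ?I"
    by (rule LIMSEQ_unique)
  then show ?thesis by (simp add: fourier_def)
qed

lemma fourier_directional_decay:
  fixes f :: "'a::euclidean_space \<Rightarrow> complex"
  assumes "f \<in> test_functions UNIV"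
  shows "\<exists>C. \<forall>\<xi>. \<bar>v \<bullet> \<xi>\<bar> ^ n * norm (fourier f \<xi>) \<le> C"
  using assms
proof (induction n arbitrary: f)
  case 0
  have "norm (fourier f \<xi>) \<le> (2 * pi) powr (- real DIM('a) / 2) * (LINT x|lborel. norm (f x))" for \<xi>
  proof -
    have "norm (LINT x|lborel. cis (- (x \<bullet> \<xi>)) * f x) \<le> (LINT x|lborel. norm (cis (- (x \<bullet> \<xi>)) * f x))"
      by (rule integral_norm_bound)
    then show ?thesis by (simp add: fourier_def norm_mult mult_left_mono)
  qed
  then show ?case by auto
next
  case (Suc n)
  obtain C where C: "\<And>\<xi>. \<bar>v \<bullet> \<xi>\<bar> ^ n * norm (fourier (\<lambda>x. frechet_derivative f (at x) v) \<xi>) \<le> C"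
    using Suc.IH[OF test_function_directional_derivative[OF Suc.prems]] by blast
  have "\<bar>v \<bullet> \<xi>\<bar> ^ Suc n * norm (fourier f \<xi>) \<le> C" for \<xi>
    using C[of \<xi>] by (simp add: fourier_directional_derivative[OF Suc.prems] norm_mult mult_ac)
  then show ?case by blast
qed

lemma exists_large_coordinate:
  fixes \<xi> :: "'a::euclidean_space"
  shows "\<exists>b\<in>Basis. norm \<xi> \<le> real DIM('a) * \<bar>b \<bullet> \<xi>\<bar>"
proof (rule ccontr)
  assume "\<not> ?thesis"
  then have *: "\<bar>\<xi> \<bullet> b\<bar> < norm \<xi> / real DIM('a)" if "b \<in> Basis" for b
    using that by (auto simp: not_le inner_commute field_simps)
  have "norm \<xi> \<le> (\<Sum>b\<in>Basis. \<bar>\<xi> \<bullet> b\<bar>)" by (rule norm_le_l1)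
  also have "\<dots> < (\<Sum>b\<in>(Basis::'a set). norm \<xi> / real DIM('a))"
    by (intro sum_strict_mono *) auto
  also have "\<dots> = norm \<xi>" by simp
  finally show False by simp
qed

lemma fourier_decay:
  fixes f :: "'a::euclidean_space \<Rightarrow> complex"
  assumes f: "f \<in> test_functions UNIV"
  shows "\<exists>C. \<forall>\<xi>. (1 + norm \<xi>) ^ n * norm (fourier f \<xi>) \<le> C"
proof -
  obtain C0 where C0: "\<And>\<xi>. norm (fourier f \<xi>) \<le> C0"
    using fourier_directional_decay[OF f, of 0 0] by auto
  have "\<forall>b. \<exists>C. \<forall>\<xi>. \<bar>b \<bullet> \<xi>\<bar> ^ n * norm (fourier f \<xi>) \<le> C"
    using fourier_directional_decay[OF f] by blast
  then obtain C where C: "\<And>b \<xi>. \<bar>b \<bullet> \<xi>\<bar> ^ n * norm (fourier f \<xi>) \<le> C b"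
    by metis
  have Cpos: "C b \<ge> 0" for b using C[of b 0] by (rule order_trans[rotated]) simp
  have C0pos: "C0 \<ge> 0" using C0[of 0] by (rule order_trans[rotated]) simp
  define M where "M = 2 ^ n * C0 + (2 * real DIM('a)) ^ n * (\<Sum>b\<in>(Basis::'a set). C b)"
  have "(1 + norm \<xi>) ^ n * norm (fourier f \<xi>) \<le> M" for \<xi>
  proof (cases "norm \<xi> \<le> 1")
    case True
    have "(1 + norm \<xi>) ^ n * norm (fourier f \<xi>) \<le> 2 ^ n * C0"
      using True C0 C0pos by (intro mult_mono power_mono) auto
    then show ?thesis using Cpos by (simp add: M_def sum_nonneg add_increasing2)
  next
    case False
    obtain b where b: "b \<in> Basis" "norm \<xi> \<le> real DIM('a) * \<bar>b \<bullet> \<xi>\<bar>" using exists_large_coordinate[of \<xi>] by blast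
    have "(1 + norm \<xi>) ^ n \<le> (2 * (real DIM('a) * \<bar>b \<bullet> \<xi>\<bar>)) ^ n"
      using False b by (intro power_mono) auto
    then have "(1 + norm \<xi>) ^ n * norm (fourier f \<xi>) \<le> (2 * real DIM('a)) ^ n * (\<bar>b \<bullet> \<xi>\<bar> ^ n * norm (fourier f \<xi>))"
      by (simp add: power_mult_distrib mult_right_mono flip: mult.assoc)
    also have "\<dots> \<le> (2 * real DIM('a)) ^ n * C b" by (intro mult_left_mono C) auto
    also have "\<dots> \<le> (2 * real DIM('a)) ^ n * (\<Sum>b\<in>(Basis::'a set). C b)"
      using b Cpos by (intro mult_left_mono member_le_sum) auto
    finally show ?thesis using C0pos by (simp add: M_def add_increasing)
  qed
  then show ?thesis by blast
qed

lemma nn_integral_inverse_1_plus_square_finite: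
  "(\<integral>\<^sup>+x. ennreal (1 / (1 + x\<^sup>2)) \<partial>lborel) < \<infinity>"
proof -
  have "integrable lborel (\<lambda>x::real. inverse (1 + x\<^sup>2))"
    using integrable_inverse_1_plus_square by (simp add: set_integrable_def)
  then show ?thesis by (simp add: integrable_iff_bounded inverse_eq_divide)
qed

text \<open>
  The weight \<open>(1 + |\<xi>|)^(2d)\<close> dominates the product of \<open>1 + \<xi>\<^sub>b\<^sup>2\<close> over the coordinates \<open>b\<close>, whose inverse is integrable as
  a product of one-dimensional integrals.
\<close>

lemma integrable_polynomial_decay:
  fixes \<psi> :: "'a::euclidean_space \<Rightarrow> complex"
  assumes [measurable]: "\<psi> \<in> borel_measurable borel"
    and C: "\<And>\<xi>. (1 + norm \<xi>) ^ (2 * DIM('a)) * norm (\<psi> \<xi>) \<le> C"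
  shows "integrable lborel \<psi>"
proof -
  have C0: "C \<ge> 0" using C[of 0] by (rule order_trans[rotated]) simp
  have pt: "norm (\<psi> \<xi>) \<le> C * (\<Prod>b\<in>(Basis::'a set). 1 / (1 + (\<xi> \<bullet> b)\<^sup>2))" for \<xi>
  proof -
    let ?P = "\<Prod>b\<in>(Basis::'a set). (1 + (\<xi> \<bullet> b)\<^sup>2)"
    have "?P \<le> (\<Prod>b\<in>(Basis::'a set). (1 + norm \<xi>)\<^sup>2)"
    proof (intro prod_mono conjI)
      fix b :: 'a assume "b \<in> Basis"
      then have "\<bar>\<xi> \<bullet> b\<bar>\<^sup>2 \<le> (norm \<xi>)\<^sup>2" by (intro power_mono Basis_le_norm) auto
      then show "1 + (\<xi> \<bullet> b)\<^sup>2 \<le> (1 + norm \<xi>)\<^sup>2" by (simp add: power2_sum add_increasing2)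
    qed auto
    also have "\<dots> = (1 + norm \<xi>) ^ (2 * DIM('a))" by (simp add: power_mult)
    finally have "?P * norm (\<psi> \<xi>) \<le> C"
      using C[of \<xi>] by (meson mult_right_mono norm_ge_zero order_trans)
    moreover have "?P > 0" by (intro prod_pos) (auto simp: add_pos_nonneg)
    ultimately have "norm (\<psi> \<xi>) \<le> C / ?P" by (simp add: pos_le_divide_eq mult.commute)
    then show ?thesis by (simp add: prod_dividef)
  qed
  have "(\<integral>\<^sup>+\<xi>. ennreal (norm (\<psi> \<xi>)) \<partial>lborel) \<le> (\<integral>\<^sup>+\<xi>. ennreal C * (\<Prod>b\<in>(Basis::'a set). ennreal (1 / (1 + (\<xi> \<bullet> b)\<^sup>2))) \<partial>lborel)"
    using pt C0 by (intro nn_integral_mono) (auto simp: prod_ennreal ennreal_mult[symmetric] prod_nonneg intro!: ennreal_leI)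
  also have "\<dots> = ennreal C * (\<integral>\<^sup>+\<xi>. (\<Prod>b\<in>(Basis::'a set). ennreal (1 / (1 + (\<xi> \<bullet> b)\<^sup>2))) \<partial>lborel)"
    by (intro nn_integral_cmult) measurable
  also have "(\<integral>\<^sup>+\<xi>. (\<Prod>b\<in>(Basis::'a set). ennreal (1 / (1 + (\<xi> \<bullet> b)\<^sup>2))) \<partial>lborel)
      = (\<Prod>b\<in>(Basis::'a set). \<integral>\<^sup>+x. ennreal (1 / (1 + x\<^sup>2)) \<partial>lborel)"
    by (rule nn_integral_lborel_prod) auto
  also have "ennreal C * \<dots> < \<infinity>"
  proof -
    obtain i where "i \<ge> 0" "(\<integral>\<^sup>+x. ennreal (1 / (1 + x\<^sup>2)) \<partial>lborel) = ennreal i"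
      using nn_integral_inverse_1_plus_square_finite
      by (cases "\<integral>\<^sup>+x. ennreal (1 / (1 + x\<^sup>2)) \<partial>lborel") auto
    then show ?thesis using C0 by (simp only: prod_constant ennreal_power ennreal_mult[symmetric] zero_le_power) simp
  qed
  finally show ?thesis by (simp add: integrable_iff_bounded)
qed

lemma fourier_borel:
  fixes f :: "'a::euclidean_space \<Rightarrow> complex"
  assumes [measurable]: "f \<in> borel_measurable borel"
  shows "fourier f \<in> borel_measurable borel"
  unfolding fourier_def[abs_def] by measurable

lemma fourier_weighted_integrable:
  fixes f :: "'a::euclidean_space \<Rightarrow> complex"
  assumes f: "f \<in> test_functions UNIV" and "s \<ge> 0"
  shows "integrable lborel (\<lambda>\<xi>. of_real (norm \<xi> powr s) * fourier f \<xi>)"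
proof -
  have [measurable]: "fourier f \<in> borel_measurable borel"
    by (intro fourier_borel test_function_borel f)
  define k where "k = nat \<lceil>s\<rceil>"
  obtain C where C: "\<And>\<xi>. (1 + norm \<xi>) ^ (2 * DIM('a) + k) * norm (fourier f \<xi>) \<le> C"
    using fourier_decay[OF f] by blast
  have pw: "norm \<xi> powr s \<le> (1 + norm \<xi>) ^ k" for \<xi> :: 'a
  proof -
    have "norm \<xi> powr s \<le> (1 + norm \<xi>) powr s" using assms by (intro powr_mono2) auto
    also have "\<dots> \<le> (1 + norm \<xi>) powr real k" using assms by (intro powr_mono) (auto simp: k_def)
    also have "\<dots> = (1 + norm \<xi>) ^ k" by (intro powr_realpow) (auto simp: add_pos_nonneg)
    finally show ?thesis .
  qed
  show ?thesis
  proof (rule integrable_polynomial_decay)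
    fix \<xi> :: 'a
    have "(1 + norm \<xi>) ^ (2 * DIM('a)) * norm (of_real (norm \<xi> powr s) * fourier f \<xi>)
       \<le> (1 + norm \<xi>) ^ (2 * DIM('a)) * ((1 + norm \<xi>) ^ k * norm (fourier f \<xi>))"
      using pw by (intro mult_left_mono) (auto simp: norm_mult intro!: mult_right_mono)
    also have "\<dots> \<le> C" using C[of \<xi>] by (simp add: power_add mult.assoc)
    finally show "(1 + norm \<xi>) ^ (2 * DIM('a)) * norm (of_real (norm \<xi> powr s) * fourier f \<xi>) \<le> C" .
  qed measurable
qed

lemma fourier_integrable:
  fixes f :: "'a::euclidean_space \<Rightarrow> complex"
  assumes f: "f \<in> test_functions UNIV"
  shows "integrable lborel (fourier f)"
proof (rule integrable_polynomial_decay)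
  show "fourier f \<in> borel_measurable borel" by (intro fourier_borel test_function_borel f)
  show "(1 + norm \<xi>) ^ (2 * DIM('a)) * norm (fourier f \<xi>) \<le> (SOME C. \<forall>\<xi>. (1 + norm \<xi>) ^ (2 * DIM('a)) * norm (fourier f \<xi>) \<le> C)" for \<xi> :: 'a
    using someI_ex[OF fourier_decay[OF f, of "2 * DIM('a)"]] by blast
qed

section \<open>The Fourier transform of the Gaussian\<close>

abbreviation std_gauss :: "'a::real_normed_vector \<Rightarrow> complex" where
  "std_gauss z \<equiv> of_real (exp (- (norm z)\<^sup>2 / 2))"

lemma gaussian_1d_fourier:
  "integrable lborel (\<lambda>x. cis (- (x * t)) * of_real (exp (- x\<^sup>2 / 2)))"
  "(LINT x|lborel. cis (- (x * t)) * of_real (exp (- x\<^sup>2 / 2))) = of_real (sqrt (2 * pi) * exp (- t\<^sup>2 / 2))"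
proof -
  let ?g = "\<lambda>x. cis (- (x * t)) * of_real (exp (- x\<^sup>2 / 2))"
  have dens: "of_real (exp (- x\<^sup>2 / 2)) = of_real (sqrt (2 * pi)) * (of_real (std_normal_density x) :: complex)" for x
    by (simp add: std_normal_density_def)
  have "integrable lborel std_normal_density"
    by simp
  then have "integrable lborel (\<lambda>x. of_real (sqrt (2 * pi)) * (of_real (std_normal_density x) :: complex))"
    by (intro integrable_mult_right integrable_of_real)
  then have "integrable lborel (\<lambda>x. of_real (exp (- x\<^sup>2 / 2)) :: complex)"
    by (simp only: dens)
  then show "integrable lborel ?g"
    by (rule Bochner_Integration.integrable_bound) (auto simp: norm_mult)
  have "of_real (exp (- t\<^sup>2 / 2)) = char std_normal_distribution (- t)"
    by (simp add: char_std_normal_distribution)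
  also have "\<dots> = (LINT x|lborel. std_normal_density x *\<^sub>R cis (- t * x))"
    unfolding char_def by (subst integral_density) (auto simp: cis_conv_exp)
  finally have *: "(LINT x|lborel. std_normal_density x *\<^sub>R cis (- t * x)) = of_real (exp (- t\<^sup>2 / 2))" ..
  have "(LINT x|lborel. ?g x)
     = (LINT x|lborel. of_real (sqrt (2 * pi)) * (std_normal_density x *\<^sub>R cis (- t * x)))"
    unfolding dens by (intro Bochner_Integration.integral_cong) (auto simp: scaleR_conv_of_real mult_ac)
  also have "\<dots> = of_real (sqrt (2 * pi)) * of_real (exp (- t\<^sup>2 / 2))"
    unfolding integral_mult_right_zero * ..
  finally show "(LINT x|lborel. ?g x) = of_real (sqrt (2 * pi) * exp (- t\<^sup>2 / 2))"
    by simp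
qed

lemma cis_sum: "finite A \<Longrightarrow> cis (\<Sum>b\<in>A. g b) = (\<Prod>b\<in>A. cis (g b))"
  by (induction rule: finite_induct) (auto simp: cis_mult[symmetric])

lemma gaussian_fourier_integral:
  fixes \<xi> :: "'a::euclidean_space"
  shows "(LINT x|lborel. cis (- (x \<bullet> \<xi>)) * std_gauss x)
     = of_real (sqrt (2 * pi) ^ DIM('a) * exp (- (norm \<xi>)\<^sup>2 / 2))"
proof -
  interpret product_sigma_finite "\<lambda>_::'a. lborel :: real measure" ..
  let ?h = "\<lambda>b x. cis (- (x * (\<xi> \<bullet> b))) * of_real (exp (- x\<^sup>2 / 2)) :: complex"
  have nsq: "(norm y)\<^sup>2 = (\<Sum>b\<in>Basis. (y \<bullet> b)\<^sup>2)" for y :: 'a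
    unfolding power2_norm_eq_inner by (subst euclidean_inner) (simp add: power2_eq_square)
  have split: "cis (- (x \<bullet> \<xi>)) * std_gauss x = (\<Prod>b\<in>Basis. ?h b (x \<bullet> b))" for x :: 'a
  proof -
    have "x \<bullet> \<xi> = (\<Sum>b\<in>Basis. (x \<bullet> b) * (\<xi> \<bullet> b))" by (rule euclidean_inner)
    then have "cis (- (x \<bullet> \<xi>)) = (\<Prod>b\<in>Basis. cis (- ((x \<bullet> b) * (\<xi> \<bullet> b))))"
      by (simp add: cis_sum[symmetric] sum_negf)
    moreover have "exp (- (norm x)\<^sup>2 / 2) = (\<Prod>b\<in>Basis. exp (- (x \<bullet> b)\<^sup>2 / 2))"
      by (simp add: nsq exp_sum[symmetric] sum_negf sum_divide_distrib)
    ultimately show ?thesis by (simp add: prod.distrib)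
  qed
  have "(LINT x|lborel. cis (- (x \<bullet> \<xi>)) * std_gauss x)
    = (LINT x|(lborel :: 'a measure). (\<Prod>b\<in>Basis. ?h b (x \<bullet> b)))"
    by (simp only: split)
  also have "\<dots> = (LINT x|distr (\<Pi>\<^sub>M b\<in>Basis. lborel) borel (\<lambda>f. \<Sum>b\<in>Basis. f b *\<^sub>R b). (\<Prod>b\<in>(Basis::'a set). ?h b (x \<bullet> b)))"
    by (simp only: lborel_eq[symmetric])
  also have "\<dots> = (LINT f|(\<Pi>\<^sub>M b\<in>Basis. lborel). (\<Prod>b\<in>(Basis::'a set). ?h b (f b)))"
    by (subst integral_distr) (auto intro!: Bochner_Integration.integral_cong prod.cong)
  also have "\<dots> = (\<Prod>b\<in>(Basis::'a set). LINT x|lborel. ?h b x)"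
    by (intro product_integral_prod gaussian_1d_fourier) auto
  also have "\<dots> = of_real (\<Prod>b\<in>(Basis::'a set). sqrt (2 * pi) * exp (- (\<xi> \<bullet> b)\<^sup>2 / 2))"
    by (simp only: gaussian_1d_fourier of_real_prod)
  also have "(\<Prod>b\<in>(Basis::'a set). sqrt (2 * pi) * exp (- (\<xi> \<bullet> b)\<^sup>2 / 2)) = sqrt (2 * pi) ^ DIM('a) * exp (- (norm \<xi>)\<^sup>2 / 2)"
    by (simp add: prod.distrib nsq exp_sum[symmetric] sum_negf sum_divide_distrib)
  finally show ?thesis .
qed

definition heat_kernel :: "real \<Rightarrow> 'a::euclidean_space \<Rightarrow> real" where
  "heat_kernel \<rho> z = exp (- (norm z)\<^sup>2 / (2 * \<rho>\<^sup>2)) / (sqrt (2 * pi) * \<rho>) ^ DIM('a)"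

abbreviation heat_multiplier :: "real \<Rightarrow> 'a::euclidean_space \<Rightarrow> complex" where
  "heat_multiplier \<rho> \<xi> \<equiv> of_real (exp (- (\<rho>\<^sup>2 * (norm \<xi>)\<^sup>2) / 2))"

text \<open>
  The character with frequency \<open>\<xi>\<close> after application of the heat semigroup at width \<open>\<rho>\<close>.
\<close>

abbreviation heat_mode :: "real \<Rightarrow> 'a::euclidean_space \<Rightarrow> 'a \<Rightarrow> complex" where
  "heat_mode \<rho> x \<xi> \<equiv> cis (x \<bullet> \<xi>) * heat_multiplier \<rho> \<xi>"

definition heat :: "real \<Rightarrow> ('a::euclidean_space \<Rightarrow> complex) \<Rightarrow> 'a \<Rightarrow> complex" where
  "heat \<rho> g x = (LINT y|lborel. of_real (heat_kernel \<rho> (x - y)) * g y)"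

lemma borel_measurable_heat_kernel [measurable]:
  "(\<lambda>(\<rho>, z::'a::euclidean_space). heat_kernel \<rho> z) \<in> borel_measurable (borel \<Otimes>\<^sub>M borel)"
  unfolding heat_kernel_def[abs_def] by measurable

lemma heat_kernel_nonneg: "\<rho> > 0 \<Longrightarrow> heat_kernel \<rho> z \<ge> 0"
  by (simp add: heat_kernel_def)

lemma heat_kernel_minus: "heat_kernel \<rho> (x - y) = heat_kernel \<rho> (y - x)"
  by (simp add: heat_kernel_def norm_minus_commute)

lemma heat_kernel_integrable:
  assumes "\<rho> > 0"
  shows "integrable lborel (\<lambda>y::'a::euclidean_space. of_real (heat_kernel \<rho> (x - y)) :: complex)"
proof -
  have "(\<integral>\<^sup>+y. ennreal (exp (- (norm (y::'a))\<^sup>2 / (2 * \<rho>\<^sup>2))) \<partial>lborel) < \<infinity>"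
    using nn_integral_gaussian[OF assms, where 'a='a] by simp
  then have "integrable lborel (\<lambda>y::'a. exp (- (norm y)\<^sup>2 / (2 * \<rho>\<^sup>2)))"
    by (simp add: integrable_iff_bounded)
  then have "integrable lborel (\<lambda>y::'a. of_real (exp (- (norm y)\<^sup>2 / (2 * \<rho>\<^sup>2)) / (sqrt (2 * pi) * \<rho>) ^ DIM('a)) :: complex)"
    by (intro integrable_of_real integrable_divide_zero) auto
  then have "integrable lborel (\<lambda>y::'a. of_real (heat_kernel \<rho> y) :: complex)"
    by (simp only: heat_kernel_def)
  from integrable_lborel_affine[OF this, of 1 "- x"]
  show ?thesis by (simp add: heat_kernel_minus[of \<rho> x])
qed

lemma sqrt_2pi_power: "(2 * pi) powr (- real n / 2) = 1 / sqrt (2 * pi) ^ n"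
proof -
  have "sqrt (2 * pi) ^ n = (2 * pi) powr (real n / 2)"
    by (simp add: powr_half_sqrt[symmetric] powr_realpow[symmetric] powr_powr)
  then show ?thesis by (simp add: powr_minus_divide)
qed

lemma two_pi_power: "(2 * pi) ^ n = sqrt (2 * pi) ^ n * sqrt (2 * pi) ^ n"
  by (subst power_mult_distrib[symmetric]) simp

lemma heat_kernel_fourier:
  fixes x \<xi> :: "'a::euclidean_space"
  assumes \<rho>: "\<rho> > 0"
  shows "(LINT y|lborel. cis (\<xi> \<bullet> y) * of_real (heat_kernel \<rho> (x - y)))
     = cis (x \<bullet> \<xi>) * heat_multiplier \<rho> \<xi>"
proof -
  let ?l = "\<lambda>z. cis (\<xi> \<bullet> (x + \<rho> *\<^sub>R z)) * of_real (heat_kernel \<rho> (x - (x + \<rho> *\<^sub>R z)))"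
  let ?e = "\<lambda>z. cis (- (z \<bullet> (- \<rho> *\<^sub>R \<xi>)))"
  let ?c = "(sqrt (2 * pi) * \<rho>) ^ DIM('a)"
  have "(LINT y|lborel. cis (\<xi> \<bullet> y) * of_real (heat_kernel \<rho> (x - y)))
    = of_real (\<rho> ^ DIM('a)) * (LINT z|lborel. ?l z)"
    using \<rho> by (intro integral_lborel_affine) measurable
  also have "(\<lambda>z. ?l z)
    = (\<lambda>z. (cis (x \<bullet> \<xi>) * of_real (1 / ?c)) * (?e z * std_gauss z :: complex))"
  proof
    fix z :: 'a
    have "heat_kernel \<rho> (x - (x + \<rho> *\<^sub>R z)) = 1 / ?c * exp (- (norm z)\<^sup>2 / 2)"
      using \<rho> by (simp add: heat_kernel_def power_mult_distrib)
    moreover have "cis (\<xi> \<bullet> (x + \<rho> *\<^sub>R z)) = cis (x \<bullet> \<xi>) * ?e z"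
      by (simp add: cis_mult inner_add_right inner_commute)
    ultimately show "?l z
      = (cis (x \<bullet> \<xi>) * of_real (1 / ?c)) * (?e z * std_gauss z)"
      by (simp only: of_real_mult mult_ac)
  qed
  also have "(LINT z|lborel. (cis (x \<bullet> \<xi>) * of_real (1 / ?c)) * (?e z * std_gauss z :: complex))
     = (cis (x \<bullet> \<xi>) * of_real (1 / ?c)) * of_real (sqrt (2 * pi) ^ DIM('a) * exp (- (norm (- \<rho> *\<^sub>R \<xi>))\<^sup>2 / 2))"
    by (simp only: integral_mult_right_zero gaussian_fourier_integral)
  finally show ?thesis
    using \<rho> by (simp add: power_mult_distrib)
qed

lemma gaussian_multiplier_inverse_fourier:
  fixes x y :: "'a::euclidean_space"
  assumes \<rho>: "\<rho> > 0"
  shows "(LINT \<xi>|lborel. cis (- (y \<bullet> \<xi>)) * heat_mode \<rho> x \<xi>)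
     = of_real ((2 * pi) ^ DIM('a) * heat_kernel \<rho> (x - y))"
proof -
  let ?n = "exp (- (norm ((1/\<rho>) *\<^sub>R (y - x)))\<^sup>2 / 2)"
  let ?e = "\<lambda>z. cis (- (z \<bullet> ((1/\<rho>) *\<^sub>R (y - x))))"
  let ?F = "\<lambda>\<xi>. cis (- (y \<bullet> \<xi>)) * heat_mode \<rho> x \<xi> :: complex"
  have "(LINT \<xi>|lborel. ?F \<xi>) = of_real ((1/\<rho>) ^ DIM('a)) * (LINT z|lborel. ?F (0 + (1/\<rho>) *\<^sub>R z))"
    using \<rho> by (intro integral_lborel_affine) auto
  also have "(\<lambda>z. ?F (0 + (1/\<rho>) *\<^sub>R z)) = (\<lambda>z. ?e z * std_gauss z)"
  proof
    fix z :: 'a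
    show "?F (0 + (1/\<rho>) *\<^sub>R z) = ?e z * std_gauss z"
      using \<rho> by (simp add: mult.assoc[symmetric] cis_mult power_divide inner_diff_right inner_commute diff_divide_distrib)
  qed
  also have "(LINT z|lborel. ?e z * std_gauss z)
     = of_real (sqrt (2 * pi) ^ DIM('a) * ?n)"
    by (rule gaussian_fourier_integral)
  finally have "(LINT \<xi>|lborel. ?F \<xi>) = of_real ((1/\<rho>) ^ DIM('a) * (sqrt (2 * pi) ^ DIM('a) * ?n))"
    by simp
  also have "(1/\<rho>) ^ DIM('a) * (sqrt (2 * pi) ^ DIM('a) * ?n) = (2 * pi) ^ DIM('a) * heat_kernel \<rho> (x - y)"
  proof -
    note two_pi_power[of "DIM('a)"]
    then show ?thesis using \<rho>
      by (simp add: heat_kernel_def power_mult_distrib power_divide norm_minus_commute)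
  qed
  finally show ?thesis .
qed

section \<open>Fourier inversion and the heat semigroup\<close>

text \<open>
  The sign \<open>\<sigma>\<close> lets the same exchange of integrals serve the Fourier transform (in the inversion theorem)
  and its inverse (for the heat semigroup applied to \<open>|\<nabla>|\<^sup>s f\<close>).
\<close>

lemma fourier_multiplication_formula:
  fixes a b :: "'a::euclidean_space \<Rightarrow> complex" and \<sigma> :: real
  assumes a: "integrable lborel a" and b: "integrable lborel b"
  shows "(LINT y|lborel. (LINT x|lborel. cis (\<sigma> * (x \<bullet> y)) * a x) * b y)
      = (LINT x|lborel. a x * (LINT y|lborel. cis (\<sigma> * (x \<bullet> y)) * b y))"
proof -
  have [measurable]: "a \<in> borel_measurable borel" "b \<in> borel_measurable borel" using a b by auto
  let ?f = "\<lambda>x y. cis (\<sigma> * (x \<bullet> y)) * a x * b y"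
  have int: "integrable (lborel \<Otimes>\<^sub>M lborel) (\<lambda>(x, y). ?f x y)"
  proof (rule lborel_pair.Fubini_integrable)
    show "(\<lambda>(x, y). ?f x y) \<in> borel_measurable (lborel \<Otimes>\<^sub>M lborel)" by measurable
    have "integrable lborel (\<lambda>x. norm (a x) * (LINT y|lborel. norm (b y)))"
      using a by (intro integrable_mult_left integrable_norm)
    then show "integrable lborel (\<lambda>x. LINT y|lborel. norm (case (x, y) of (x, y) \<Rightarrow> ?f x y))"
      by (simp add: norm_mult)
    show "AE x in lborel. integrable lborel (\<lambda>y. case (x, y) of (x, y) \<Rightarrow> ?f x y)"
    proof (rule AE_I2)
      fix x :: 'a
      show "integrable lborel (\<lambda>y. case (x, y) of (x, y) \<Rightarrow> ?f x y)"
        using integrable_mult_right[OF b, of "a x"]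
        by (rule Bochner_Integration.integrable_bound) (auto simp: norm_mult)
    qed
  qed
  have "(LINT y|lborel. (LINT x|lborel. cis (\<sigma> * (x \<bullet> y)) * a x) * b y) = (LINT y|lborel. (LINT x|lborel. ?f x y))"
    by simp
  also have "\<dots> = (LINT x|lborel. (LINT y|lborel. ?f x y))"
    by (rule lborel_pair.Fubini_integral[OF int])
  also have "\<dots> = (LINT x|lborel. a x * (LINT y|lborel. cis (\<sigma> * (x \<bullet> y)) * b y))"
    by (intro Bochner_Integration.integral_cong) (simp_all add: mult_ac flip: integral_mult_right_zero)
  finally show ?thesis .
qed

lemma gaussian_multiplier_integrable:
  fixes x :: "'a::euclidean_space"
  assumes "\<rho> > 0"
  shows "integrable lborel (\<lambda>\<xi>::'a. cis (x \<bullet> \<xi>) * heat_multiplier \<rho> \<xi>)"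
proof -
  have "(\<integral>\<^sup>+y. ennreal (exp (- (norm (y::'a))\<^sup>2 / (2 * (1/\<rho>)\<^sup>2))) \<partial>lborel) < \<infinity>"
    using nn_integral_gaussian[of "1/\<rho>", where 'a='a] assms by simp
  moreover have "(norm y)\<^sup>2 / (2 * (1/\<rho>)\<^sup>2) = \<rho>\<^sup>2 * (norm y)\<^sup>2 / 2" for y :: 'a
    using assms by (simp add: field_simps)
  ultimately show ?thesis
    by (intro integrableI_bounded) (simp_all add: norm_mult)
qed

text \<open>
  Insert the factor \<open>exp (- \<rho>\<^sup>2 |\<xi>|\<^sup>2 / 2)\<close> into the inversion integral. The multiplication formula converts the
  result into a Gaussian average of \<open>f\<close> of width \<open>\<rho>\<close>, and both sides converge as \<open>\<rho>\<close> tends to \<open>0\<close>: the left one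
  because \<open>fourier f\<close> is integrable, the right one because \<open>f\<close> is bounded and continuous.
\<close>

theorem fourier_inversion:
  fixes f :: "'a::euclidean_space \<Rightarrow> complex"
  assumes f: "f \<in> test_functions UNIV"
  shows "inverse_fourier (fourier f) x = f x"
proof -
  let ?d = "DIM('a)"
  let ?J = "\<lambda>\<rho>. LINT z|lborel. std_gauss z * f (x + \<rho> *\<^sub>R z)"
  have [measurable]: "f \<in> borel_measurable borel" by (rule test_function_borel[OF f])
  have [measurable]: "fourier f \<in> borel_measurable borel" by (intro fourier_borel test_function_borel f)
  let ?c = "(2 * pi) powr (- real ?d / 2)"
  define r where "r n = 1 / real (Suc n)" for n
  have r: "r n > 0" "r \<longlonglongrightarrow> 0" for n
    using LIMSEQ_inverse_real_of_nat by (auto simp: r_def[abs_def] inverse_eq_divide simp del: of_nat_Suc)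
  obtain B where B: "B > 0" "\<And>x. norm (f x) \<le> B" using test_function_bounded[OF f] by blast
  let ?I = "\<lambda>\<rho>. LINT \<xi>|lborel. fourier f \<xi> * heat_mode \<rho> x \<xi>"
  have lim1: "(\<lambda>n. ?I (r n)) \<longlonglongrightarrow> (LINT \<xi>|lborel. fourier f \<xi> * cis (x \<bullet> \<xi>))"
  proof (rule integral_dominated_convergence)
    show "integrable lborel (\<lambda>\<xi>. norm (fourier f \<xi>))" by (intro integrable_norm fourier_integrable f)
    show "AE \<xi> in lborel. (\<lambda>n. fourier f \<xi> * heat_mode (r n) x \<xi>) \<longlonglongrightarrow> fourier f \<xi> * cis (x \<bullet> \<xi>)"
    proof (rule AE_I2)
      fix \<xi> :: 'a
      have "(\<lambda>n. fourier f \<xi> * heat_mode (r n) x \<xi>) \<longlonglongrightarrow>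
         fourier f \<xi> * heat_mode 0 x \<xi>"
        by (intro tendsto_intros r) auto
      then show "(\<lambda>n. fourier f \<xi> * heat_mode (r n) x \<xi>) \<longlonglongrightarrow> fourier f \<xi> * cis (x \<bullet> \<xi>)"
        by simp
    qed
    show "AE \<xi> in lborel. norm (fourier f \<xi> * heat_mode (r n) x \<xi>) \<le> norm (fourier f \<xi>)" for n
      by (auto simp: norm_mult mult_left_le)
  qed measurable
  have I_eq: "?I \<rho> = of_real ?c * (of_real ((2 * pi) ^ ?d / sqrt (2 * pi) ^ ?d) * ?J \<rho>)"
    if \<rho>: "\<rho> > 0" for \<rho>
  proof -
    have "?I \<rho> = of_real ?c * (LINT \<xi>|lborel. (LINT y|lborel. cis (- 1 * (y \<bullet> \<xi>)) * f y) * heat_mode \<rho> x \<xi>)"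
      by (simp only: fourier_def mult.assoc integral_mult_right_zero mult_minus_left mult_1_left)
    also have "(LINT \<xi>|lborel. (LINT y|lborel. cis (- 1 * (y \<bullet> \<xi>)) * f y) * heat_mode \<rho> x \<xi>)
       = (LINT y|lborel. f y * (LINT \<xi>|lborel. cis (- 1 * (y \<bullet> \<xi>)) * heat_mode \<rho> x \<xi>))"
      by (intro fourier_multiplication_formula test_function_integrable f gaussian_multiplier_integrable \<rho>)
    also have "\<dots> = (LINT y|lborel. f y * of_real ((2 * pi) ^ ?d * heat_kernel \<rho> (x - y)))"
      by (simp only: mult_minus_left mult_1_left gaussian_multiplier_inverse_fourier[OF \<rho>])
    also have "\<dots> = of_real (\<rho> ^ ?d) * (LINT z|lborel. f (x + \<rho> *\<^sub>R z) * of_real ((2 * pi) ^ ?d * heat_kernel \<rho> (x - (x + \<rho> *\<^sub>R z))))"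
      using \<rho> by (intro integral_lborel_affine) measurable
    also have "(\<lambda>z. f (x + \<rho> *\<^sub>R z) * of_real ((2 * pi) ^ ?d * heat_kernel \<rho> (x - (x + \<rho> *\<^sub>R z))))
       = (\<lambda>z. of_real ((2 * pi) ^ ?d / (sqrt (2 * pi) * \<rho>) ^ ?d) * (std_gauss z * f (x + \<rho> *\<^sub>R z)))"
    proof
      fix z :: 'a
      have "(2 * pi) ^ ?d * heat_kernel \<rho> (x - (x + \<rho> *\<^sub>R z)) = ((2 * pi) ^ ?d / (sqrt (2 * pi) * \<rho>) ^ ?d) * exp (- (norm z)\<^sup>2 / 2)"
        using \<rho> by (simp add: heat_kernel_def power_mult_distrib)
      then show "f (x + \<rho> *\<^sub>R z) * of_real ((2 * pi) ^ ?d * heat_kernel \<rho> (x - (x + \<rho> *\<^sub>R z)))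
        = of_real ((2 * pi) ^ ?d / (sqrt (2 * pi) * \<rho>) ^ ?d) * (std_gauss z * f (x + \<rho> *\<^sub>R z))"
        by (simp only: of_real_mult mult_ac)
    qed
    also have "of_real (\<rho> ^ ?d) * (LINT z|lborel. of_real ((2 * pi) ^ ?d / (sqrt (2 * pi) * \<rho>) ^ ?d) * (std_gauss z * f (x + \<rho> *\<^sub>R z)))
      = of_real (\<rho> ^ ?d * ((2 * pi) ^ ?d / (sqrt (2 * pi) * \<rho>) ^ ?d)) * ?J \<rho>"
      by (simp only: integral_mult_right_zero of_real_mult mult.assoc)
    also have "\<rho> ^ ?d * ((2 * pi) ^ ?d / (sqrt (2 * pi) * \<rho>) ^ ?d) = (2 * pi) ^ ?d / sqrt (2 * pi) ^ ?d"
      using \<rho> by (simp add: power_mult_distrib)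
    finally show ?thesis .
  qed
  have gauss_int: "(LINT z::'a|lborel. std_gauss z) = (of_real (sqrt (2 * pi) ^ ?d) :: complex)"
    using gaussian_fourier_integral[of "0::'a"] by simp
  have lim2: "(\<lambda>n. ?J (r n)) \<longlonglongrightarrow> (LINT z::'a|lborel. std_gauss z * f x)"
  proof (rule integral_dominated_convergence)
    have "integrable lborel (\<lambda>z::'a. exp (- (norm z)\<^sup>2 / 2))"
      using nn_integral_gaussian[of 1, where 'a='a] by (intro integrableI_bounded) simp_all
    then show "integrable lborel (\<lambda>z::'a. exp (- (norm z)\<^sup>2 / 2) * B)" by (rule integrable_mult_left)
    show "AE z in lborel. (\<lambda>n. std_gauss z * f (x + r n *\<^sub>R z)) \<longlonglongrightarrow> std_gauss z * f x"
    proof (rule AE_I2)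
      fix z :: 'a
      have "isCont f x" using test_function_continuous[OF f, of UNIV] by (simp add: continuous_on_eq_continuous_at)
      moreover have "(\<lambda>n. x + r n *\<^sub>R z) \<longlonglongrightarrow> x + 0 *\<^sub>R z" by (intro tendsto_intros r)
      ultimately have "(\<lambda>n. f (x + r n *\<^sub>R z)) \<longlonglongrightarrow> f x" by (intro isCont_tendsto_compose[of x f]) auto
      then show "(\<lambda>n. std_gauss z * f (x + r n *\<^sub>R z)) \<longlonglongrightarrow> std_gauss z * f x"
        by (intro tendsto_intros)
    qed
    show "AE z in lborel. norm (std_gauss z * f (x + r n *\<^sub>R z)) \<le> exp (- (norm z)\<^sup>2 / 2) * B" for n
      using B by (auto simp: norm_mult)
  qed measurable
  have "(\<lambda>n. ?I (r n)) \<longlonglongrightarrow> of_real ?c * (of_real ((2 * pi) ^ ?d / sqrt (2 * pi) ^ ?d) * (LINT z::'a|lborel. std_gauss z * f x))"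
    unfolding I_eq[OF r(1)] by (intro tendsto_mult tendsto_const lim2)
  from LIMSEQ_unique[OF lim1 this]
  have "(LINT \<xi>|lborel. fourier f \<xi> * cis (x \<bullet> \<xi>)) = of_real (?c * ((2 * pi) ^ ?d / sqrt (2 * pi) ^ ?d) * sqrt (2 * pi) ^ ?d) * f x"
    by (simp only: integral_mult_left_zero gauss_int of_real_mult mult.assoc)
  then have "inverse_fourier (fourier f) x = of_real (?c * (?c * ((2 * pi) ^ ?d / sqrt (2 * pi) ^ ?d) * sqrt (2 * pi) ^ ?d)) * f x"
    by (simp add: inverse_fourier_def mult.commute[of "cis _"])
  also have "?c * (?c * ((2 * pi) ^ ?d / sqrt (2 * pi) ^ ?d) * sqrt (2 * pi) ^ ?d) = 1"
    unfolding sqrt_2pi_power two_pi_power by simp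
  finally show ?thesis by simp
qed

lemma abs_nabla_powr_borel:
  fixes f :: "'a::euclidean_space \<Rightarrow> complex"
  assumes "f \<in> test_functions UNIV"
  shows "abs_nabla_powr s f \<in> borel_measurable borel"
proof -
  have [measurable]: "fourier f \<in> borel_measurable borel" by (intro fourier_borel test_function_borel assms)
  show ?thesis unfolding abs_nabla_powr_def inverse_fourier_def[abs_def] by measurable
qed

lemma abs_nabla_powr_bounded:
  fixes f :: "'a::euclidean_space \<Rightarrow> complex"
  shows "\<exists>B\<ge>0. \<forall>x. norm (abs_nabla_powr s f x) \<le> B"
proof -
  let ?B = "(2 * pi) powr (- real DIM('a) / 2) * (LINT \<xi>|lborel. norm (of_real (norm \<xi> powr s) * fourier f \<xi>))"
  have "norm (abs_nabla_powr s f x) \<le> ?B" for x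
  proof -
    have "norm (LINT \<xi>|lborel. cis (x \<bullet> \<xi>) * (of_real (norm \<xi> powr s) * fourier f \<xi>)) \<le> (LINT \<xi>|lborel. norm (cis (x \<bullet> \<xi>) * (of_real (norm \<xi> powr s) * fourier f \<xi>)))"
      by (rule integral_norm_bound)
    then show ?thesis by (simp add: abs_nabla_powr_def inverse_fourier_def norm_mult mult_left_mono)
  qed
  moreover have "?B \<ge> 0" by simp
  ultimately show ?thesis by blast
qed

lemma heat_abs_nabla_powr:
  fixes f :: "'a::euclidean_space \<Rightarrow> complex"
  assumes f: "f \<in> test_functions UNIV" and s: "s \<ge> 0" and \<rho>: "\<rho> > 0"
  shows "heat \<rho> (abs_nabla_powr s f) x = of_real ((2 * pi) powr (- real DIM('a) / 2)) *
     (LINT \<xi>|lborel. (of_real (norm \<xi> powr s) * fourier f \<xi>) * heat_mode \<rho> x \<xi>)"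
proof -
  let ?c = "of_real ((2 * pi) powr (- real DIM('a) / 2)) :: complex"
  let ?\<phi> = "\<lambda>\<xi>. of_real (norm \<xi> powr s) * fourier f \<xi>"
  have "heat \<rho> (abs_nabla_powr s f) x = (LINT y|lborel. ?c * ((LINT \<xi>|lborel. cis (1 * (\<xi> \<bullet> y)) * ?\<phi> \<xi>) * of_real (heat_kernel \<rho> (x - y))))"
    unfolding heat_def abs_nabla_powr_def inverse_fourier_def
    by (intro Bochner_Integration.integral_cong) (simp_all add: mult_ac inner_commute)
  also have "\<dots> = ?c * (LINT y|lborel. (LINT \<xi>|lborel. cis (1 * (\<xi> \<bullet> y)) * ?\<phi> \<xi>) * of_real (heat_kernel \<rho> (x - y)))"
    by (rule integral_mult_right_zero)
  also have "(LINT y|lborel. (LINT \<xi>|lborel. cis (1 * (\<xi> \<bullet> y)) * ?\<phi> \<xi>) * of_real (heat_kernel \<rho> (x - y)))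
     = (LINT \<xi>|lborel. ?\<phi> \<xi> * (LINT y|lborel. cis (1 * (\<xi> \<bullet> y)) * of_real (heat_kernel \<rho> (x - y))))"
    by (intro fourier_multiplication_formula fourier_weighted_integrable f s heat_kernel_integrable \<rho>)
  also have "\<dots> = (LINT \<xi>|lborel. ?\<phi> \<xi> * heat_mode \<rho> x \<xi>)"
    by (simp only: mult_1_left heat_kernel_fourier[OF \<rho>])
  finally show ?thesis .
qed

abbreviation heat_density :: "real \<Rightarrow> ('a::euclidean_space \<Rightarrow> complex) \<Rightarrow> 'a \<Rightarrow> real \<Rightarrow> complex" where
  "heat_density s g x \<rho> \<equiv> indicator {0<..} \<rho> *\<^sub>R (of_real (\<rho> powr (s - 1)) * heat \<rho> g x)"

abbreviation riesz_density :: "real \<Rightarrow> real \<Rightarrow> real" where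
  "riesz_density s \<rho> \<equiv> indicator {0<..} \<rho> * (\<rho> powr (s - 1) * exp (- \<rho>\<^sup>2 / 2))"

text \<open>
  Up to elementary factors this is the value of the Gamma function at \<open>s/2\<close>. Only \<open>0 < riesz_const s < \<infinity>\<close> matters.
\<close>

definition riesz_const :: "real \<Rightarrow> real" where
  "riesz_const s = (LINT \<rho>|lborel. riesz_density s \<rho>)"

lemma riesz_const_integrable:
  assumes s: "s > 0"
  shows "integrable lborel (\<lambda>\<rho>. riesz_density s \<rho>)"
proof (rule integrableI_bounded)
  \<comment> \<open>The bound \<open>exp y \<ge> (y/n)\<^sup>n\<close> for \<open>y = \<rho>\<^sup>2/2\<close> gives the tail exponent
    \<open>s - 1 - 2n\<close>, which has to be below \<open>-1\<close>.\<close>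
  define n where "n = Suc (nat \<lceil>s\<rceil>)"
  have n: "s < 2 * real n" "n > 0" using s by (auto simp: n_def) linarith
  let ?D = "(2 * real n) ^ n"
  let ?f1 = "\<lambda>\<rho>. ennreal (s * \<rho> powr (s - 1)) * indicator {0<..<1} \<rho>"
  let ?f2 = "\<lambda>\<rho>. ennreal (\<rho> powr (s - 1 - 2 * real n)) * indicator {1..} \<rho>"
  have pt: "ennreal (norm (riesz_density s \<rho> :: real)) \<le>
     ennreal (1 / s) * ?f1 \<rho> + ennreal ?D * ?f2 \<rho>" for \<rho>
  proof -
    consider "\<rho> \<le> 0" | "0 < \<rho>" "\<rho> < 1" | "\<rho> \<ge> 1" by linarith
    then show ?thesis
    proof cases
      case 2
      have "\<rho> powr (s - 1) * exp (- \<rho>\<^sup>2 / 2) \<le> \<rho> powr (s - 1) * 1" by (intro mult_left_mono) auto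
      then show ?thesis
        using 2 s by (simp add: ennreal_mult[symmetric] ennreal_leI)
    next
      case 3
      have "(\<rho>\<^sup>2 / (2 * real n)) ^ n \<le> (1 + (\<rho>\<^sup>2 / 2) / real n) ^ n"
        using 3 n by (intro power_mono) auto
      also have "\<dots> \<le> exp (\<rho>\<^sup>2 / 2)"
        using n by (intro exp_ge_one_plus_x_over_n_power_n) (auto intro: order_trans[of _ 0])
      finally have *: "(\<rho>\<^sup>2 / (2 * real n)) ^ n \<le> exp (\<rho>\<^sup>2 / 2)" .
      have "(\<rho>\<^sup>2 / (2 * real n)) ^ n > 0" using 3 n by (intro zero_less_power) auto
      with * have "1 / exp (\<rho>\<^sup>2 / 2) \<le> 1 / (\<rho>\<^sup>2 / (2 * real n)) ^ n"
        by (intro divide_left_mono mult_pos_pos) auto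
      then have "exp (- \<rho>\<^sup>2 / 2) \<le> 1 / (\<rho>\<^sup>2 / (2 * real n)) ^ n"
        by (simp add: exp_minus inverse_eq_divide)
      also have "\<dots> = ?D * \<rho> powr (- 2 * real n)"
      proof -
        have "\<rho> powr (- 2 * real n) = 1 / \<rho> powr (real (2 * n))"
          using powr_minus_divide[of \<rho> "real (2 * n)"] by simp
        also have "\<rho> powr (real (2 * n)) = (\<rho>\<^sup>2) ^ n"
          using 3 by (subst powr_realpow) (auto simp: power_mult)
        finally show ?thesis by (simp add: power_divide)
      qed
      finally have "\<rho> powr (s - 1) * exp (- \<rho>\<^sup>2 / 2) \<le> \<rho> powr (s - 1) * (?D * \<rho> powr (- 2 * real n))"
        by (intro mult_left_mono) auto
      also have "\<dots> = ?D * \<rho> powr (s - 1 - 2 * real n)"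
        using powr_add[of \<rho> "s - 1" "- 2 * real n"] by simp
      finally show ?thesis using 3 by (simp add: ennreal_mult[symmetric] ennreal_leI)
    qed auto
  qed
  have "(\<integral>\<^sup>+\<rho>. ennreal (norm (riesz_density s \<rho> :: real)) \<partial>lborel)
      \<le> (\<integral>\<^sup>+\<rho>. ennreal (1 / s) * ?f1 \<rho> + ennreal ?D * ?f2 \<rho> \<partial>lborel)"
    by (intro nn_integral_mono pt)
  also have "\<dots> = ennreal (1 / s) * (\<integral>\<^sup>+\<rho>. ?f1 \<rho> \<partial>lborel) + ennreal ?D * (\<integral>\<^sup>+\<rho>. ?f2 \<rho> \<partial>lborel)"
    by (simp add: nn_integral_add nn_integral_cmult)
  also have "\<dots> < \<infinity>"
    using s n by (simp add: nn_integral_powr_Ioo nn_integral_powr_Ici ennreal_mult_less_top)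
  finally show "(\<integral>\<^sup>+\<rho>. ennreal (norm (riesz_density s \<rho> :: real)) \<partial>lborel) < \<infinity>" .
qed measurable

lemma riesz_const_pos:
  assumes s: "s > 0"
  shows "riesz_const s > 0"
proof -
  let ?m = "min 1 (2 powr (s - 1)) * exp (- 2)"
  have "0 < ?m * measure lborel {1..2::real}" by simp
  also have "\<dots> = (LINT \<rho>|lborel. ?m * indicator {1..2::real} \<rho>)" by simp
  also have "\<dots> \<le> riesz_const s"
    unfolding riesz_const_def
  proof (rule integral_mono)
    show "integrable lborel (\<lambda>\<rho>::real. ?m * indicator {1..2} \<rho>)"
      by (intro integrable_mult_right integrable_real_indicator) auto
    show "integrable lborel (\<lambda>\<rho>. riesz_density s \<rho>)"
      by (rule riesz_const_integrable[OF s])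
    show "?m * indicator {1..2} \<rho> \<le> riesz_density s \<rho>" for \<rho> :: real
    proof (cases "\<rho> \<in> {1..2}")
      case True
      have "\<rho>\<^sup>2 \<le> 2\<^sup>2" using True by (intro power_mono) auto
      then have 1: "exp (- 2) \<le> exp (- \<rho>\<^sup>2 / 2)" by simp
      have 2: "min 1 (2 powr (s - 1)) \<le> \<rho> powr (s - 1)"
      proof (cases "s \<ge> 1")
        case True
        then have "1 \<le> \<rho> powr (s - 1)" using \<open>\<rho> \<in> {1..2}\<close> by (intro ge_one_powr_ge_zero) auto
        then show ?thesis by simp
      next
        case False
        then have "2 powr (s - 1) \<le> \<rho> powr (s - 1)" using True by (intro powr_mono2') auto
        then show ?thesis by simp
      qed
      show ?thesis using True mult_mono[OF 2 1] by simp
    qed simp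
  qed
  finally show ?thesis .
qed

abbreviation scaled_density :: "real \<Rightarrow> real \<Rightarrow> real \<Rightarrow> real" where
  "scaled_density s q \<rho> \<equiv> indicator {0<..} \<rho> * (\<rho> powr (s - 1) * exp (- (\<rho>\<^sup>2 * q\<^sup>2) / 2))"

lemma riesz_const_scaled:
  assumes "q > 0"
  shows "q powr s * (LINT \<rho>|lborel. scaled_density s q \<rho>) = riesz_const s"
proof -
  have "riesz_const s = \<bar>q\<bar> *\<^sub>R (LINT \<rho>|lborel. indicator {0<..} (0 + q * \<rho>) * ((0 + q * \<rho>) powr (s - 1) * exp (- (0 + q * \<rho>)\<^sup>2 / 2)))"
    unfolding riesz_const_def using assms by (intro lborel_integral_real_affine) auto
  also have "(\<lambda>\<rho>. indicator {0<..} (0 + q * \<rho>) * ((0 + q * \<rho>) powr (s - 1) * exp (- (0 + q * \<rho>)\<^sup>2 / 2))) =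
     (\<lambda>\<rho>. q powr (s - 1) * (scaled_density s q \<rho>))"
    using assms by (auto simp: fun_eq_iff indicator_def zero_less_mult_iff powr_mult power_mult_distrib mult_ac)
  also have "\<bar>q\<bar> *\<^sub>R (LINT \<rho>|lborel. q powr (s - 1) * (scaled_density s q \<rho>))
     = (q * q powr (s - 1)) * (LINT \<rho>|lborel. scaled_density s q \<rho>)"
    using assms by (simp only: integral_mult_right_zero) simp
  also have "q * q powr (s - 1) = q powr s" using assms by (simp add: powr_diff)
  finally show ?thesis ..
qed

lemma riesz_const_scaled_integrable:
  assumes "q > 0" "s > 0"
  shows "integrable lborel (\<lambda>\<rho>. scaled_density s q \<rho>)"
proof (rule ccontr)
  assume "\<not> ?thesis"
  then have "(LINT \<rho>|lborel. scaled_density s q \<rho>) = 0"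
    by (rule not_integrable_integral_eq)
  then show False using riesz_const_scaled[OF assms(1), of s] riesz_const_pos[OF assms(2)] by simp
qed

text \<open>
  Subordination of the Riesz potential to the heat semigroup. For a frequency \<open>\<xi> \<noteq> 0\<close> the integral over the scales
  \<open>\<rho>\<close> of the damped mode is \<open>riesz_const s\<close> divided by \<open>|\<xi>|\<^sup>s\<close>, which cancels the multiplier; what
  remains is the inversion integral of \<open>f\<close>. Fubini applies because \<open>fourier f\<close> is integrable.
\<close>

theorem test_function_eq_heat_integral:
  fixes f :: "'a::euclidean_space \<Rightarrow> complex"
  assumes f: "f \<in> test_functions UNIV" and s: "s > 0"
  defines "g \<equiv> abs_nabla_powr s f"
  shows "integrable lborel (\<lambda>\<rho>. heat_density s g x \<rho>)"
    and "of_real (riesz_const s) * f x = (LINT \<rho>|lborel. heat_density s g x \<rho>)"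
proof -
  have [measurable]: "fourier f \<in> borel_measurable borel" by (intro fourier_borel test_function_borel f)
  let ?c = "of_real ((2 * pi) powr (- real DIM('a) / 2)) :: complex"
  let ?k = "\<lambda>\<xi>::'a. \<lambda>\<rho>. scaled_density s (norm \<xi>) \<rho>"
  let ?H = "\<lambda>\<xi> \<rho>. of_real (?k \<xi> \<rho>) * (of_real (norm \<xi> powr s) * fourier f \<xi> * cis (x \<bullet> \<xi>))"
  have k_nonneg: "?k \<xi> \<rho> \<ge> 0" for \<xi> \<rho> by simp
  have k_int: "integrable lborel (?k \<xi>)" if "\<xi> \<noteq> 0" for \<xi>
    using riesz_const_scaled_integrable[of "norm \<xi>" s] that s by simp
  have k_val: "norm \<xi> powr s * (LINT \<rho>|lborel. ?k \<xi> \<rho>) = riesz_const s" if "\<xi> \<noteq> 0" for \<xi>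
    using riesz_const_scaled[of "norm \<xi>" s] that by simp
  have int_H: "integrable (lborel \<Otimes>\<^sub>M lborel) (\<lambda>(\<xi>, \<rho>). ?H \<xi> \<rho>)"
  proof (rule lborel_pair.Fubini_integrable)
    show "(\<lambda>(\<xi>, \<rho>). ?H \<xi> \<rho>) \<in> borel_measurable (lborel \<Otimes>\<^sub>M lborel)" by measurable
    have "(LINT \<rho>|lborel. norm (?H \<xi> \<rho>)) = (norm \<xi> powr s * (LINT \<rho>|lborel. ?k \<xi> \<rho>)) * norm (fourier f \<xi>)" for \<xi>
    proof -
      have "(LINT \<rho>|lborel. norm (?H \<xi> \<rho>)) = (LINT \<rho>|lborel. (norm \<xi> powr s * norm (fourier f \<xi>)) * ?k \<xi> \<rho>)"
        using k_nonneg by (intro Bochner_Integration.integral_cong) (simp_all add: norm_mult abs_mult)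
      also have "\<dots> = (norm \<xi> powr s * norm (fourier f \<xi>)) * (LINT \<rho>|lborel. ?k \<xi> \<rho>)"
        by (rule integral_mult_right_zero)
      finally show ?thesis by (simp only: mult_ac)
    qed
    then have "(LINT \<rho>|lborel. norm (?H \<xi> \<rho>)) = indicator (- {0}) \<xi> * (riesz_const s * norm (fourier f \<xi>))" for \<xi>
      using k_val[of \<xi>] by (cases "\<xi> = 0") auto
    moreover have "integrable lborel (\<lambda>\<xi>::'a. indicator (- {0}) \<xi> * (riesz_const s * norm (fourier f \<xi>)))"
      by (rule Bochner_Integration.integrable_bound[OF integrable_mult_right[OF integrable_norm[OF fourier_integrable[OF f]], of "riesz_const s"]])
         (auto simp: abs_mult indicator_def)
    ultimately show "integrable lborel (\<lambda>\<xi>. LINT \<rho>|lborel. norm (case (\<xi>, \<rho>) of (\<xi>, \<rho>) \<Rightarrow> ?H \<xi> \<rho>))" by simp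
    show "AE \<xi> in lborel. integrable lborel (\<lambda>\<rho>. case (\<xi>, \<rho>) of (\<xi>, \<rho>) \<Rightarrow> ?H \<xi> \<rho>)"
      using AE_lborel_singleton[of "0::'a"]
    proof eventually_elim
      case (elim \<xi>)
      then show ?case by (simp only: prod.case) (intro integrable_mult_left integrable_of_real k_int)
    qed
  qed
  have inner: "(LINT \<xi>|lborel. ?H \<xi> \<rho>) * ?c = heat_density s g x \<rho>" for \<rho>
  proof (cases "\<rho> > 0")
    case True
    have "(LINT \<xi>|lborel. ?H \<xi> \<rho>) = (LINT \<xi>|lborel. of_real (\<rho> powr (s - 1)) * ((of_real (norm \<xi> powr s) * fourier f \<xi>) * heat_mode \<rho> x \<xi>))"
      using True by (intro Bochner_Integration.integral_cong) (simp_all add: mult_ac)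
    also have "\<dots> = of_real (\<rho> powr (s - 1)) * (LINT \<xi>|lborel. (of_real (norm \<xi> powr s) * fourier f \<xi>) * heat_mode \<rho> x \<xi>)"
      by (rule integral_mult_right_zero)
    finally show ?thesis using True s unfolding g_def
      by (simp add: heat_abs_nabla_powr[OF f])
  qed simp
  show "integrable lborel (\<lambda>\<rho>. heat_density s g x \<rho>)"
    using integrable_mult_left[OF lborel_pair.integrable_snd[OF int_H], of ?c] by (simp only: inner)
  have "(LINT \<rho>|lborel. heat_density s g x \<rho>) = (LINT \<rho>|lborel. (LINT \<xi>|lborel. ?H \<xi> \<rho>)) * ?c"
    unfolding inner[symmetric] by (rule integral_mult_left_zero)
  also have "(LINT \<rho>|lborel. (LINT \<xi>|lborel. ?H \<xi> \<rho>)) = (LINT \<xi>|lborel. (LINT \<rho>|lborel. ?H \<xi> \<rho>))"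
    by (rule lborel_pair.Fubini_integral[OF int_H])
  also have "\<dots> = (LINT \<xi>|lborel. of_real (riesz_const s) * (fourier f \<xi> * cis (x \<bullet> \<xi>)))"
  proof (intro integral_cong_AE)
    show "AE \<xi> in lborel. (LINT \<rho>|lborel. ?H \<xi> \<rho>) = of_real (riesz_const s) * (fourier f \<xi> * cis (x \<bullet> \<xi>))"
      using AE_lborel_singleton[of "0::'a"]
    proof eventually_elim
      case (elim \<xi>)
      have "(LINT \<rho>|lborel. ?H \<xi> \<rho>) = of_real (LINT \<rho>|lborel. ?k \<xi> \<rho>) * (of_real (norm \<xi> powr s) * fourier f \<xi> * cis (x \<bullet> \<xi>))"
        by (simp only: integral_mult_left_zero integral_complex_of_real)
      also have "\<dots> = of_real (norm \<xi> powr s * (LINT \<rho>|lborel. ?k \<xi> \<rho>)) * (fourier f \<xi> * cis (x \<bullet> \<xi>))"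
        by (simp only: of_real_mult mult_ac)
      finally show ?case by (simp only: k_val[OF elim])
    qed
  qed measurable
  also have "\<dots> * ?c = of_real (riesz_const s) * inverse_fourier (fourier f) x"
    unfolding integral_mult_right_zero inverse_fourier_def by (simp add: mult_ac)
  also have "\<dots> = of_real (riesz_const s) * f x" by (simp add: fourier_inversion[OF f])
  finally show "of_real (riesz_const s) * f x = (LINT \<rho>|lborel. heat_density s g x \<rho>)" ..
qed

section \<open>Maximal function bounds for the heat semigroup\<close>

lemma norm_integral_le_nn_integral:
  fixes F :: "'a \<Rightarrow> 'b::{banach, second_countable_topology}"
  shows "ennreal (norm (integral\<^sup>L M F)) \<le> (\<integral>\<^sup>+x. ennreal (norm (F x)) \<partial>M)"
  by (cases "integrable M F") (auto simp: integral_norm_bound_ennreal not_integrable_integral_eq)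

lemma heat_integrable:
  fixes g :: "'a::euclidean_space \<Rightarrow> complex"
  assumes [measurable]: "g \<in> borel_measurable borel" and B: "\<And>y. norm (g y) \<le> B" and \<rho>: "\<rho> > 0"
  shows "integrable lborel (\<lambda>y. of_real (heat_kernel \<rho> (x - y)) * g y)"
proof (rule Bochner_Integration.integrable_bound)
  show "integrable lborel (\<lambda>y::'a. of_real B * of_real (heat_kernel \<rho> (x - y)) :: complex)"
    by (intro integrable_mult_right heat_kernel_integrable \<rho>)
  have "B \<ge> 0" using B[of 0] by (rule order_trans[OF norm_ge_zero])
  then show "AE y in lborel. norm (of_real (heat_kernel \<rho> (x - y)) * g y) \<le> norm (of_real B * of_real (heat_kernel \<rho> (x - y)) :: complex)"
    using B by (auto simp: norm_mult mult.commute[of _ "norm (g _)"] intro!: mult_right_mono)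
qed measurable

text \<open>
  The two kernels to which this applies are the heat kernel of width \<open>\<rho>\<close>, with \<open>A = 1\<close>, and its \<open>m\<close>-th
  differences, where \<open>A\<close> is a multiple of the gain \<open>(|h|/\<rho>)\<^sup>m\<close>.
\<close>

lemma gaussian_dominated_integral_le:
  fixes g :: "'a::euclidean_space \<Rightarrow> complex" and k :: "'a \<Rightarrow> real"
  assumes [measurable]: "g \<in> borel_measurable borel" and B: "\<And>y. norm (g y) \<le> B" and \<rho>: "\<rho> > 0"
    and near: "norm (x - x') \<le> \<kappa> * \<rho>" and A: "A \<ge> 0"
    and k: "\<And>y. \<bar>k y\<bar> \<le> A / (sqrt (2 * pi) * \<rho>) ^ DIM('a) * exp (- (norm (x - y))\<^sup>2 / (4 * \<rho>\<^sup>2))"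
  shows "norm (LINT y|lborel. of_real (k y) * g y)
     \<le> A * (exp (\<kappa>\<^sup>2 / 4) * 2 ^ DIM('a)) * hl_maxr (\<lambda>y. norm (g y)) x'"
proof -
  let ?Z = "(sqrt (2 * pi) * \<rho>) ^ DIM('a)" and ?Y = "(2 * sqrt (2 * pi) * \<rho>) ^ DIM('a)"
  let ?W = "hl_maxr (\<lambda>y. norm (g y)) x'" and ?e = "\<lambda>y. exp (- (norm (x - y))\<^sup>2 / (4 * \<rho>\<^sup>2))"
  have Z: "?Z > 0" using \<rho> by simp
  have "ennreal (norm (LINT y|lborel. of_real (k y) * g y)) \<le> (\<integral>\<^sup>+y. ennreal (norm (of_real (k y) * g y)) \<partial>lborel)"
    by (rule norm_integral_le_nn_integral)
  also have "\<dots> \<le> (\<integral>\<^sup>+y. ennreal (A / ?Z) * (ennreal (?e y) * ennreal (norm (g y))) \<partial>lborel)"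
  proof (intro nn_integral_mono)
    fix y
    have "norm (of_real (k y) * g y) \<le> A / ?Z * ?e y * norm (g y)"
      unfolding norm_mult norm_of_real by (intro mult_right_mono k) auto
    then have "ennreal (norm (of_real (k y) * g y)) \<le> ennreal (A / ?Z * ?e y * norm (g y))"
      by (rule ennreal_leI)
    also have "\<dots> = ennreal (A / ?Z) * (ennreal (?e y) * ennreal (norm (g y)))"
      using A Z by (subst ennreal_mult[symmetric], simp, simp)+ (simp only: mult.assoc)
    finally show "ennreal (norm (of_real (k y) * g y)) \<le> ennreal (A / ?Z) * (ennreal (?e y) * ennreal (norm (g y)))" .
  qed
  also have "\<dots> = ennreal (A / ?Z) * (\<integral>\<^sup>+y. ennreal (?e y) * ennreal (norm (g y)) \<partial>lborel)"
    by (intro nn_integral_cmult) measurable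
  also have "\<dots> \<le> ennreal (A / ?Z) * (ennreal (exp (\<kappa>\<^sup>2 / 4) * ?Y) * hl_max (\<lambda>y. ennreal (norm (g y))) x')"
    by (intro mult_left_mono gaussian_average_nontangential \<rho> near) auto
  also have "hl_max (\<lambda>y. ennreal (norm (g y))) x' = ennreal ?W"
    by (rule ennreal_hl_maxr[OF B, symmetric])
  also have "ennreal (A / ?Z) * (ennreal (exp (\<kappa>\<^sup>2 / 4) * ?Y) * ennreal ?W) = ennreal (A / ?Z * (exp (\<kappa>\<^sup>2 / 4) * ?Y * ?W))"
    using \<rho> A Z by (subst ennreal_mult[symmetric], simp, simp)+ simp
  also have "A / ?Z * (exp (\<kappa>\<^sup>2 / 4) * ?Y * ?W) = A * (exp (\<kappa>\<^sup>2 / 4) * 2 ^ DIM('a)) * ?W"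
  proof -
    have "?Y = 2 ^ DIM('a) * ?Z" by (simp only: power_mult_distrib mult.assoc)
    then show ?thesis using Z \<rho> by simp
  qed
  finally show ?thesis using A by (subst (asm) ennreal_le_iff) auto
qed

lemma heat_le_hl_maxr:
  fixes g :: "'a::euclidean_space \<Rightarrow> complex"
  assumes g: "g \<in> borel_measurable borel" "\<And>y. norm (g y) \<le> B" and \<rho>: "\<rho> > 0"
    and near: "norm (x - x') \<le> \<kappa> * \<rho>"
  shows "norm (heat \<rho> g x) \<le> exp (\<kappa>\<^sup>2 / 4) * 2 ^ DIM('a) * hl_maxr (\<lambda>y. norm (g y)) x'"
proof -
  let ?Z = "(sqrt (2 * pi) * \<rho>) ^ DIM('a)"
  have "\<bar>heat_kernel \<rho> (x - y)\<bar> \<le> 1 / ?Z * exp (- (norm (x - y))\<^sup>2 / (4 * \<rho>\<^sup>2))" for y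
  proof -
    have "(norm (x - y))\<^sup>2 / (4 * \<rho>\<^sup>2) \<le> (norm (x - y))\<^sup>2 / (2 * \<rho>\<^sup>2)"
      using \<rho> by (intro divide_left_mono) auto
    then show ?thesis using \<rho> by (simp add: heat_kernel_def divide_right_mono)
  qed
  from gaussian_dominated_integral_le[OF g \<rho> near _ this] show ?thesis by (simp add: heat_def)
qed

text \<open>
  At scales \<open>\<rho>\<close> large compared with the step \<open>h\<close> the gain \<open>(|h|/\<rho>)\<^sup>m\<close> comes from the smoothness of the
  Gaussian and not from \<open>g\<close>.
\<close>

lemma heat_difference_le_hl_maxr:
  fixes \<kappa> :: real
  assumes \<kappa>: "\<kappa> \<ge> 0"
  shows "\<exists>C>0. \<forall>(g :: 'a::euclidean_space \<Rightarrow> complex) B \<rho> x h.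
     g \<in> borel_measurable borel \<longrightarrow> (\<forall>y. norm (g y) \<le> B) \<longrightarrow> \<rho> > 0 \<longrightarrow> norm h \<le> \<kappa> * \<rho> \<longrightarrow>
     norm (finite_difference m (heat \<rho> g) x h)
       \<le> C * (norm h / \<rho>) ^ m * hl_maxr (\<lambda>y. norm (g y)) x"
proof -
  obtain C where C: "C > 0" and diff: "\<And>(z::'a) h. norm h \<le> \<kappa> \<Longrightarrow>
    \<bar>\<Sum>j\<le>m. alt_binom m j * exp (- (norm (z + real j *\<^sub>R h))\<^sup>2 / 2)\<bar>
      \<le> C * norm h ^ m * exp (- (norm z)\<^sup>2 / 4)"
    using gaussian_difference_bound[OF \<kappa>, where 'a='a and m=m] by blast
  have bd: "norm (finite_difference m (heat \<rho> g) x h)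
       \<le> (C * 2 ^ DIM('a)) * (norm h / \<rho>) ^ m * hl_maxr (\<lambda>y. norm (g y)) x"
    if [measurable]: "g \<in> borel_measurable borel" and B: "\<And>y. norm (g y) \<le> B" and \<rho>: "\<rho> > 0" and h: "norm h \<le> \<kappa> * \<rho>"
    for g :: "'a \<Rightarrow> complex" and B \<rho> x h
  proof -
    let ?q = "\<lambda>y j. exp (- (norm ((1/\<rho>) *\<^sub>R (x - y) + real j *\<^sub>R ((1/\<rho>) *\<^sub>R h)))\<^sup>2 / 2)"
    let ?e = "\<lambda>y. exp (- (norm (x - y))\<^sup>2 / (4 * \<rho>\<^sup>2))"
    let ?Z = "(sqrt (2 * pi) * \<rho>) ^ DIM('a)"
    let ?E = "(norm h / \<rho>) ^ m"
    have Z: "?Z > 0" using \<rho> by simp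
    let ?k = "\<lambda>y. \<Sum>j\<le>m. alt_binom m j * heat_kernel \<rho> (x + real j *\<^sub>R h - y)"
    have E: "?E \<ge> 0" using \<rho> by simp
    have k_le: "\<bar>?k y\<bar> \<le> C * ?E / ?Z * ?e y" for y
    proof -
      have "heat_kernel \<rho> (x + real j *\<^sub>R h - y) = ?q y j / ?Z" for j
      proof -
        have "(1/\<rho>) *\<^sub>R (x - y) + real j *\<^sub>R ((1/\<rho>) *\<^sub>R h) = (1/\<rho>) *\<^sub>R (x + real j *\<^sub>R h - y)"
          by (simp add: algebra_simps)
        then show ?thesis using \<rho> by (simp add: heat_kernel_def power_divide mult.commute)
      qed
      then have "?k y = (\<Sum>j\<le>m. alt_binom m j * ?q y j) / ?Z"
        by (simp only: times_divide_eq_right sum_divide_distrib)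
      then have "\<bar>?k y\<bar> = \<bar>\<Sum>j\<le>m. alt_binom m j * ?q y j\<bar> / ?Z"
        using Z by (simp only: abs_divide abs_of_pos)
      also have "\<dots> \<le> (C * norm ((1/\<rho>) *\<^sub>R h) ^ m * exp (- (norm ((1/\<rho>) *\<^sub>R (x - y)))\<^sup>2 / 4)) / ?Z"
        using h \<rho> Z by (intro divide_right_mono diff) (auto simp: field_simps)
      also have "\<dots> = C * ?E / ?Z * ?e y"
        using \<rho> by (simp add: power_divide mult.commute)
      finally show ?thesis .
    qed
    have "(finite_difference m (heat \<rho> g) x h)
       = (\<Sum>j\<le>m. (LINT y|lborel. alt_binom m j * (of_real (heat_kernel \<rho> (x + real j *\<^sub>R h - y)) * g y)))"
      unfolding heat_def by (simp only: integral_mult_right_zero)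
    also have "\<dots> = (LINT y|lborel. (\<Sum>j\<le>m. alt_binom m j * (of_real (heat_kernel \<rho> (x + real j *\<^sub>R h - y)) * g y)))"
      by (intro Bochner_Integration.integral_sum[symmetric] integrable_mult_right heat_integrable[OF _ B \<rho>]) measurable
    also have "\<dots> = (LINT y|lborel. of_real (?k y) * g y)"
      by (simp add: sum_distrib_right mult.assoc)
    finally have eq: "(finite_difference m (heat \<rho> g) x h) = (LINT y|lborel. of_real (?k y) * g y)" .
    have "norm (LINT y|lborel. of_real (?k y) * g y) \<le> C * ?E * (exp (0\<^sup>2 / 4) * 2 ^ DIM('a)) * hl_maxr (\<lambda>y. norm (g y)) x"
      using C E \<rho> k_le by (intro gaussian_dominated_integral_le[OF _ B \<rho>]) auto
    then show ?thesis unfolding eq by (simp add: mult_ac)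
  qed
  show ?thesis
  proof (intro exI[of _ "C * 2 ^ DIM('a)"] conjI allI impI)
    fix g :: "'a \<Rightarrow> complex" and B \<rho> and x h :: 'a
    assume "g \<in> borel_measurable borel" "\<forall>y. norm (g y) \<le> B" "\<rho> > 0" "norm h \<le> \<kappa> * \<rho>"
    then show "norm (finite_difference m (heat \<rho> g) x h)
       \<le> C * 2 ^ DIM('a) * (norm h / \<rho>) ^ m * hl_maxr (\<lambda>y. norm (g y)) x"
      by (intro bd[of g B \<rho> h x]) auto
  qed (use C in auto)
qed

section \<open>The estimate near the obstacle\<close>

abbreviation nabla_max :: "real \<Rightarrow> ('a::euclidean_space \<Rightarrow> complex) \<Rightarrow> 'a \<Rightarrow> real" where
  "nabla_max s f \<equiv> hl_maxr (\<lambda>y. norm (abs_nabla_powr s f y))"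

text \<open>
  The scales are split at \<open>\<rho> = \<delta>\<close>. Below, every term of the difference is estimated separately and
  \<open>\<integral>\<^sub>0\<^sup>\<delta> \<rho>^(s-1) d\<rho>\<close> is used; above, the gain \<open>(\<delta>/\<rho>)\<^sup>m\<close> makes \<open>\<rho>^(s-1-m)\<close> integrable at
  infinity. Both halves are of size \<open>\<delta>\<^sup>s\<close>.
\<close>

lemma difference_pointwise_bound:
  fixes \<Lambda> s :: real and m :: nat
  assumes \<Lambda>: "\<Lambda> \<ge> 0" and s: "0 < s" "s < real m"
  shows "\<exists>C>0. \<forall>(f :: 'a::euclidean_space \<Rightarrow> complex) x h \<delta>.
     f \<in> test_functions UNIV \<longrightarrow> \<delta> > 0 \<longrightarrow> norm h \<le> \<Lambda> * \<delta> \<longrightarrow>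
     norm (finite_difference m f x h)
       \<le> C * \<delta> powr s * (\<Sum>j\<le>m. nabla_max s f (x + real j *\<^sub>R h))"
proof -
  obtain C where C: "C > 0" and diff: "\<And>(g :: 'a \<Rightarrow> complex) B \<rho> x h.
     g \<in> borel_measurable borel \<Longrightarrow> (\<forall>y. norm (g y) \<le> B) \<Longrightarrow> \<rho> > 0 \<Longrightarrow> norm h \<le> \<Lambda> * \<rho> \<Longrightarrow>
     norm (finite_difference m (heat \<rho> g) x h)
       \<le> C * (norm h / \<rho>) ^ m * hl_maxr (\<lambda>y. norm (g y)) x"
    using heat_difference_le_hl_maxr[OF \<Lambda>, where 'a='a and m=m] by blast
  define K where "K = (2 ^ m * 2 ^ DIM('a) / s + C * \<Lambda> ^ m / (real m - s)) / riesz_const s"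
  have rc: "riesz_const s > 0" by (rule riesz_const_pos[OF s(1)])
  have K: "K > 0" using rc s C \<Lambda> by (auto simp: K_def intro!: divide_pos_pos add_pos_nonneg)
  have "norm (finite_difference m f x h)
       \<le> K * \<delta> powr s * (\<Sum>j\<le>m. nabla_max s f (x + real j *\<^sub>R h))"
    if f: "f \<in> test_functions UNIV" and \<delta>: "\<delta> > 0" and h: "norm h \<le> \<Lambda> * \<delta>"
    for f :: "'a \<Rightarrow> complex" and x h \<delta>
  proof -
    define g where "g = abs_nabla_powr s f"
    define W where "W = hl_maxr (\<lambda>y. norm (g y))"
    have [measurable]: "g \<in> borel_measurable borel" unfolding g_def by (rule abs_nabla_powr_borel[OF f])
    obtain B where B: "\<And>y. norm (g y) \<le> B" using abs_nabla_powr_bounded[of s f] by (auto simp: g_def)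
    have W0: "W y \<ge> 0" for y by (simp add: W_def)
    let ?c = "\<lambda>j. alt_binom m j :: complex"
    let ?F = "\<Sum>j\<le>m. ?c j * f (x + real j *\<^sub>R h)"
    let ?S = "\<Sum>j\<le>m. W (x + real j *\<^sub>R h)"
    have S0: "?S \<ge> 0" using W0 by (intro sum_nonneg) auto
    have WS: "W x \<le> ?S"
    proof -
      have "W (x + real 0 *\<^sub>R h) \<le> ?S" using W0 by (intro member_le_sum) auto
      then show ?thesis by simp
    qed
    let ?D = "\<lambda>\<rho>. \<Sum>j\<le>m. ?c j * heat \<rho> g (x + real j *\<^sub>R h)"
    have "of_real (riesz_const s) * ?F
        = (\<Sum>j\<le>m. ?c j * (of_real (riesz_const s) * f (x + real j *\<^sub>R h)))"
      by (simp add: sum_distrib_left mult_ac)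
    also have "\<dots> = (\<Sum>j\<le>m. (LINT \<rho>|lborel. ?c j * (heat_density s g (x + real j *\<^sub>R h) \<rho>)))"
      unfolding g_def integral_mult_right_zero test_function_eq_heat_integral(2)[OF f s(1)] ..
    also have "\<dots> = (LINT \<rho>|lborel. (\<Sum>j\<le>m. ?c j * (heat_density s g (x + real j *\<^sub>R h) \<rho>)))"
      unfolding g_def
      by (intro Bochner_Integration.integral_sum[symmetric] integrable_mult_right test_function_eq_heat_integral(1) f s(1))
    also have "\<dots> = (LINT \<rho>|lborel. indicator {0<..} \<rho> *\<^sub>R (of_real (\<rho> powr (s - 1)) * ?D \<rho>))"
      by (simp add: sum_distrib_left scaleR_sum_right mult_ac)
    finally have rep: "of_real (riesz_const s) * ?F = (LINT \<rho>|lborel. indicator {0<..} \<rho> *\<^sub>R (of_real (\<rho> powr (s - 1)) * ?D \<rho>))" .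
    let ?f1 = "\<lambda>\<rho>. ennreal (s * \<rho> powr (s - 1)) * indicator {0<..<\<delta>} \<rho>"
    let ?f2 = "\<lambda>\<rho>. ennreal (\<rho> powr (s - 1 - real m)) * indicator {\<delta>..} \<rho>"
    let ?A1 = "2 ^ m * 2 ^ DIM('a) * ?S / s"
    let ?A2 = "C * (\<Lambda> * \<delta>) ^ m * ?S"
    have A: "?A1 \<ge> 0" "?A2 \<ge> 0" using S0 s C \<Lambda> \<delta> by auto
    have pt: "ennreal (norm (indicator {0<..} \<rho> *\<^sub>R (of_real (\<rho> powr (s - 1)) * ?D \<rho>))) \<le> ennreal ?A1 * ?f1 \<rho> + ennreal ?A2 * ?f2 \<rho>" for \<rho>
    proof -
      consider "\<rho> \<le> 0" | "0 < \<rho>" "\<rho> < \<delta>" | "\<rho> \<ge> \<delta>" by linarith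
      then show ?thesis
      proof cases
        case 2
        have "norm (?D \<rho>) \<le> (\<Sum>j\<le>m. 2 ^ m * (2 ^ DIM('a) * W (x + real j *\<^sub>R h)))"
        proof (intro sum_norm_le)
          fix j assume "j \<in> {..m}"
          have "norm (heat \<rho> g (x + real j *\<^sub>R h)) \<le> exp (0\<^sup>2 / 4) * 2 ^ DIM('a) * W (x + real j *\<^sub>R h)"
            unfolding W_def using 2 by (intro heat_le_hl_maxr[OF _ B]) auto
          moreover have "real (m choose j) \<le> 2 ^ m"
            using binomial_le_pow2[of m j] by (metis of_nat_le_iff of_nat_numeral of_nat_power)
          ultimately show "norm (?c j * heat \<rho> g (x + real j *\<^sub>R h)) \<le> 2 ^ m * (2 ^ DIM('a) * W (x + real j *\<^sub>R h))"
            by (simp add: norm_mult norm_power mult_mono)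
        qed
        also have "\<dots> = 2 ^ m * 2 ^ DIM('a) * ?S" by (simp add: sum_distrib_left mult.assoc)
        finally have "\<rho> powr (s - 1) * norm (?D \<rho>) \<le> \<rho> powr (s - 1) * (2 ^ m * 2 ^ DIM('a) * ?S)"
          by (intro mult_left_mono) auto
        also have "\<dots> = ?A1 * (s * \<rho> powr (s - 1))" using s by simp
        finally show ?thesis
          using 2 A s by (simp add: norm_mult ennreal_leI flip: ennreal_mult)
      next
        case 3
        then have \<rho>: "\<rho> > 0" using \<delta> by linarith
        have h\<rho>: "norm h \<le> \<Lambda> * \<rho>" using h 3 \<Lambda> by (meson mult_left_mono order_trans)
        have "norm (?D \<rho>) \<le> C * (norm h / \<rho>) ^ m * W x"
          unfolding W_def using B \<rho> h\<rho> by (intro diff) auto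
        also have "\<dots> \<le> C * (\<Lambda> * \<delta> / \<rho>) ^ m * ?S"
          using C \<rho> h \<Lambda> \<delta> WS W0 by (intro mult_mono mult_left_mono power_mono divide_right_mono) auto
        finally have "\<rho> powr (s - 1) * norm (?D \<rho>) \<le> \<rho> powr (s - 1) * (C * (\<Lambda> * \<delta> / \<rho>) ^ m * ?S)"
          by (intro mult_left_mono) auto
        also have "\<dots> = ?A2 * (\<rho> powr (s - 1 - real m))"
          using \<rho> by (simp add: power_divide powr_diff powr_realpow)
        finally show ?thesis
          using \<rho> 3 A by (simp add: norm_mult ennreal_leI flip: ennreal_mult)
      qed (auto)
    qed
    have "ennreal (norm (of_real (riesz_const s) * ?F))
       \<le> (\<integral>\<^sup>+\<rho>. ennreal (norm (indicator {0<..} \<rho> *\<^sub>R (of_real (\<rho> powr (s - 1)) * ?D \<rho>))) \<partial>lborel)"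
      unfolding rep by (rule norm_integral_le_nn_integral)
    also have "\<dots> \<le> (\<integral>\<^sup>+\<rho>. ennreal ?A1 * ?f1 \<rho> + ennreal ?A2 * ?f2 \<rho> \<partial>lborel)"
      by (intro nn_integral_mono pt)
    also have "\<dots> = ennreal ?A1 * (\<integral>\<^sup>+\<rho>. ?f1 \<rho> \<partial>lborel) + ennreal ?A2 * (\<integral>\<^sup>+\<rho>. ?f2 \<rho> \<partial>lborel)"
      by (subst nn_integral_add) (simp_all add: nn_integral_cmult)
    also have "(\<integral>\<^sup>+\<rho>. ?f1 \<rho> \<partial>lborel) = ennreal (\<delta> powr s)"
      using s \<delta> by (intro nn_integral_powr_Ioo) auto
    also have "(\<integral>\<^sup>+\<rho>. ?f2 \<rho> \<partial>lborel) = ennreal (\<delta> powr (s - 1 - real m + 1) / (- (s - 1 - real m) - 1))"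
      using s \<delta> by (intro nn_integral_powr_Ici) auto
    also have "\<delta> powr (s - 1 - real m + 1) / (- (s - 1 - real m) - 1) = \<delta> powr s / \<delta> ^ m / (real m - s)"
      using \<delta> by (simp add: powr_diff powr_realpow)
    also have "ennreal ?A1 * ennreal (\<delta> powr s) + ennreal ?A2 * ennreal (\<delta> powr s / \<delta> ^ m / (real m - s))
       = ennreal (?A1 * \<delta> powr s + ?A2 * (\<delta> powr s / \<delta> ^ m / (real m - s)))"
      using A s \<delta> by (simp only: ennreal_mult[symmetric] ennreal_plus[symmetric] powr_ge_zero mult_nonneg_nonneg divide_nonneg_nonneg zero_le_power less_imp_le diff_ge_0_iff_ge)
    also have "?A1 * \<delta> powr s + ?A2 * (\<delta> powr s / \<delta> ^ m / (real m - s)) = riesz_const s * (K * \<delta> powr s * ?S)"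
      using s \<delta> rc by (simp add: K_def power_mult_distrib field_simps)
    finally have "riesz_const s * norm ?F \<le> riesz_const s * (K * \<delta> powr s * ?S)"
      using rc K S0 by (subst (asm) ennreal_le_iff) (simp_all add: norm_mult)
    then show ?thesis using rc unfolding W_def g_def by simp
  qed
  with K show ?thesis by blast
qed

lemma sum_atMost_split_0: "(\<Sum>j\<le>m. P j) = P 0 + (\<Sum>j=1..m. P j)"
  for P :: "nat \<Rightarrow> 'b::comm_monoid_add"
  by (simp add: atMost_atLeast0 sum.atLeast_Suc_atMost)

text \<open>
  Since \<open>f\<close> vanishes at \<open>x + j (h0 + w)\<close> for \<open>1 \<le> j \<le> m\<close>, the difference with step \<open>h0 + w\<close> is just \<open>f x\<close>. The
  resulting bound contains the values of \<open>W\<close> at these points, where nothing is known for an individual \<open>w\<close>; averaging it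
  over the ball of admissible \<open>w\<close> replaces them by the maximal function of \<open>W\<close> at \<open>x\<close>.
\<close>

lemma near_pointwise_bound:
  fixes \<Lambda> \<theta> s :: real and m :: nat
  assumes \<Lambda>: "\<Lambda> \<ge> 0" and \<theta>: "\<theta> > 0" and s: "0 < s" "s < real m"
  shows "\<exists>C>0. \<forall>(f :: 'a::euclidean_space \<Rightarrow> complex) x h0 \<delta> W.
     f \<in> test_functions UNIV \<longrightarrow> \<delta> > 0 \<longrightarrow> norm h0 \<le> \<Lambda> * \<delta> \<longrightarrow>
     (\<forall>w\<in>ball 0 (\<theta> * \<delta>). \<forall>j\<in>{1..m}. f (x + real j *\<^sub>R (h0 + w)) = 0) \<longrightarrow>
     W = nabla_max s f \<longrightarrow>
     norm (f x) \<le> C * \<delta> powr s * (W x + hl_maxr W x)"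
proof -
  have "\<Lambda> + \<theta> \<ge> 0" using \<Lambda> \<theta> by simp
  then obtain C where C: "C > 0" and diff: "\<And>(f :: 'a \<Rightarrow> complex) x h \<delta>.
     f \<in> test_functions UNIV \<Longrightarrow> \<delta> > 0 \<Longrightarrow> norm h \<le> (\<Lambda> + \<theta>) * \<delta> \<Longrightarrow>
     norm (finite_difference m f x h)
       \<le> C * \<delta> powr s * (\<Sum>j\<le>m. nabla_max s f (x + real j *\<^sub>R h))"
    using difference_pointwise_bound[OF _ s, of "\<Lambda> + \<theta>", where 'a='a] by blast
  \<comment> \<open>The displacement \<open>j h0\<close> measured in units of the radius \<open>\<theta> \<delta>\<close> of the ball of steps.\<close>
  define \<kappa> where "\<kappa> = real m * \<Lambda> / \<theta>"
  have \<kappa>: "\<kappa> \<ge> 0" using \<Lambda> \<theta> by (simp add: \<kappa>_def)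
  define K where "K = C * (1 + real m * (\<kappa> + 1) ^ DIM('a))"
  have K: "K > 0" using C \<kappa> by (auto simp: K_def intro!: mult_pos_pos add_pos_nonneg)
  have "norm (f x) \<le> K * \<delta> powr s * (W x + hl_maxr W x)"
    if f: "f \<in> test_functions UNIV" and \<delta>: "\<delta> > 0" and h0: "norm h0 \<le> \<Lambda> * \<delta>"
      and van: "\<And>w j. w \<in> ball 0 (\<theta> * \<delta>) \<Longrightarrow> j \<in> {1..m} \<Longrightarrow> f (x + real j *\<^sub>R (h0 + w)) = 0"
      and W: "W = nabla_max s f"
    for f :: "'a \<Rightarrow> complex" and x h0 \<delta> W
  proof -
    have [measurable]: "W \<in> borel_measurable borel" unfolding W by measurable
    obtain B where B: "B \<ge> 0" "\<And>y. norm (abs_nabla_powr s f y) \<le> B" using abs_nabla_powr_bounded[of s f] by blast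
    have WB: "W y \<le> B" for y unfolding W using B by (intro hl_maxr_le) auto
    have W0: "W y \<ge> 0" for y by (simp add: W)
    let ?R = "\<theta> * \<delta>"
    let ?V = "emeasure lborel (ball (0::'a) ?R)"
    let ?w = "\<lambda>j w. ennreal (W (x + real j *\<^sub>R (h0 + w)))" and ?H = "ennreal ((\<kappa> + 1) ^ DIM('a)) * ?V * ennreal (hl_maxr W x)"
    have R: "?R > 0" using \<theta> \<delta> by simp
    have V: "0 < ?V" "?V < top" by (rule ball_vol_pos_fin[OF R])+
    have pt: "norm (f x) \<le> C * \<delta> powr s * (W x + (\<Sum>j=1..m. W (x + real j *\<^sub>R (h0 + w))))" if w: "w \<in> ball 0 ?R" for w
    proof -
      have "norm (h0 + w) \<le> \<Lambda> * \<delta> + \<theta> * \<delta>"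
        using h0 w by (intro norm_triangle_le add_mono) auto
      then have "norm (finite_difference m f x (h0 + w))
        \<le> C * \<delta> powr s * (\<Sum>j\<le>m. W (x + real j *\<^sub>R (h0 + w)))"
        unfolding W using \<delta> by (intro diff f) (auto simp: distrib_right)
      moreover have "(\<Sum>j=1..m. alt_binom m j * f (x + real j *\<^sub>R (h0 + w))) = 0"
        using van[OF w] by (intro sum.neutral) auto
      ultimately show ?thesis unfolding sum_atMost_split_0 by simp
    qed
    have "ennreal (norm (f x)) * ?V = (\<integral>\<^sup>+w. ennreal (norm (f x)) * indicator (ball 0 ?R) w \<partial>(lborel :: 'a measure))"
      by (simp add: nn_integral_cmult_indicator)
    also have "\<dots> \<le> (\<integral>\<^sup>+w. ennreal (C * \<delta> powr s) * (ennreal (W x) * indicator (ball 0 ?R) w + (\<Sum>j=1..m. ?w j w * indicator (ball 0 ?R) w)) \<partial>lborel)"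
    proof (intro nn_integral_mono)
      fix w :: 'a
      show "ennreal (norm (f x)) * indicator (ball 0 ?R) w \<le> ennreal (C * \<delta> powr s) * (ennreal (W x) * indicator (ball 0 ?R) w + (\<Sum>j=1..m. ?w j w * indicator (ball 0 ?R) w))"
      proof (cases "w \<in> ball 0 ?R")
        case True
        have "ennreal (norm (f x)) \<le> ennreal (C * \<delta> powr s * (W x + (\<Sum>j=1..m. W (x + real j *\<^sub>R (h0 + w)))))"
          by (rule ennreal_leI[OF pt[OF True]])
        also have "\<dots> = ennreal (C * \<delta> powr s) * (ennreal (W x) + (\<Sum>j=1..m. ?w j w))"
          using C W0 by (simp add: ennreal_mult ennreal_plus sum_nonneg sum_ennreal)
        finally show ?thesis using True by simp
      qed simp
    qed
    also have "\<dots> = ennreal (C * \<delta> powr s) * (ennreal (W x) * ?V + (\<Sum>j=1..m. (\<integral>\<^sup>+w\<in>ball 0 ?R. ?w j w \<partial>lborel)))"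
      by (subst nn_integral_cmult, measurable, subst nn_integral_add, measurable, subst nn_integral_sum, measurable, simp add: nn_integral_cmult_indicator)
    also have "\<dots> \<le> ennreal (C * \<delta> powr s) * (ennreal (W x) * ?V + (\<Sum>j=1..m. ?H))"
    proof (intro mult_left_mono add_mono sum_mono order_refl)
      fix j assume j: "j \<in> {1..m}"
      have "norm (real j *\<^sub>R h0) \<le> \<kappa> * ?R"
      proof -
        have "real j * norm h0 \<le> real m * (\<Lambda> * \<delta>)" using j h0 by (intro mult_mono) auto
        then show ?thesis using \<theta> by (simp add: \<kappa>_def)
      qed
      then have "(\<integral>\<^sup>+w\<in>ball 0 ?R. ennreal (W (x + real j *\<^sub>R h0 + real j *\<^sub>R w)) \<partial>lborel)
         \<le> ennreal (((\<kappa> + real j) / real j) ^ DIM('a)) * ?V * hl_max (\<lambda>y. ennreal (W y)) x"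
        using R j by (intro ball_average_shifted_le_hl_max) auto
      also have "\<dots> \<le> ennreal ((\<kappa> + 1) ^ DIM('a)) * ?V * hl_max (\<lambda>y. ennreal (W y)) x"
      proof (intro mult_right_mono ennreal_leI power_mono)
        have "\<kappa> \<le> \<kappa> * real j" using j \<kappa> by (simp add: mult_le_cancel_left1)
        then show "(\<kappa> + real j) / real j \<le> \<kappa> + 1" using j by (simp add: divide_le_eq distrib_right)
      qed (use \<kappa> in auto)
      finally show "(\<integral>\<^sup>+w\<in>ball 0 ?R. ?w j w \<partial>lborel) \<le> ?H"
        by (simp add: scaleR_add_right add.assoc ennreal_hl_maxr[OF WB])
    qed auto
    also have "\<dots> = ennreal (C * \<delta> powr s * (W x + real m * (\<kappa> + 1) ^ DIM('a) * hl_maxr W x)) * ?V"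
      using C W0 \<kappa> by (simp add: ennreal_mult ennreal_plus distrib_right distrib_left mult_ac flip: ennreal_of_nat_eq_real_of_nat)
    finally have "ennreal (norm (f x)) \<le> ennreal (C * \<delta> powr s * (W x + real m * (\<kappa> + 1) ^ DIM('a) * hl_maxr W x))"
      using V ennreal_mult_le_mult_iff[of ?V] by (simp only: mult.commute[of _ ?V])
    then have "norm (f x) \<le> C * \<delta> powr s * (W x + real m * (\<kappa> + 1) ^ DIM('a) * hl_maxr W x)"
      using C W0 \<kappa> by (subst (asm) ennreal_le_iff) auto
    also have "\<dots> \<le> C * \<delta> powr s * ((1 + real m * (\<kappa> + 1) ^ DIM('a)) * (W x + hl_maxr W x))"
      using C W0 \<kappa> by (intro mult_left_mono) (auto simp: algebra_simps)
    finally show ?thesis by (simp add: K_def mult_ac)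
  qed
  with K show ?thesis by (intro exI[of _ K]) auto
qed

section \<open>The estimate far from the obstacle\<close>

text \<open>
  Jensen's inequality for the measure \<open>w M\<close> of mass \<open>A\<close>, obtained by integrating the tangent line bound
  \<open>t \<le> c^(1-p) t\<^sup>p / p + c (1 - 1/p)\<close>. The real number \<open>z\<close> stands below a possibly infinite integral, so that its
  power makes sense in every case.
\<close>

lemma nn_integral_Hoelder_weight:
  fixes w v :: "'a \<Rightarrow> real" and z A p :: real
  assumes [measurable]: "w \<in> borel_measurable M" "v \<in> borel_measurable M"
    and nonneg: "\<And>x. w x \<ge> 0" "\<And>x. v x \<ge> 0" "z \<ge> 0"
    and A: "(\<integral>\<^sup>+x. ennreal (w x) \<partial>M) = ennreal A" "A > 0" and p: "p > 1"
    and z: "ennreal z \<le> (\<integral>\<^sup>+x. ennreal (w x * v x) \<partial>M)"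
  shows "ennreal (z powr p) \<le> ennreal (A powr (p - 1)) * (\<integral>\<^sup>+x. ennreal (w x * v x powr p) \<partial>M)"
proof (cases "z = 0 \<or> (\<integral>\<^sup>+x. ennreal (w x * v x powr p) \<partial>M) = top")
  case True
  then show ?thesis using A p by (auto simp: ennreal_mult_top)
next
  case False
  then have z0: "z > 0" using nonneg(3) by simp
  obtain i where i: "i \<ge> 0" "(\<integral>\<^sup>+x. ennreal (w x * v x powr p) \<partial>M) = ennreal i"
    using False by (cases "\<integral>\<^sup>+x. ennreal (w x * v x powr p) \<partial>M") auto
  \<comment> \<open>With this point of tangency the constant term integrates to \<open>z (1 - 1/p)\<close>
    and can be absorbed into the left-hand side.\<close>
  define c where "c = z / A"
  have c: "c > 0" using z0 A by (simp add: c_def)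
  define \<alpha> where "\<alpha> = c powr (1 - p) / p"
  define \<beta> where "\<beta> = c * (1 - 1 / p)"
  have young: "t \<le> \<alpha> * t powr p + \<beta>" if "t \<ge> 0" for t
  proof -
    have q: "p / (p - 1) > 1" "1 / p + 1 / (p / (p - 1)) = 1" using p by (auto simp: field_simps)
    have "(t / c) * 1 \<le> (t / c) powr p / p + 1 powr (p / (p - 1)) / (p / (p - 1))"
      using that c p q by (intro Youngs_inequality) auto
    then have "t / c \<le> (t / c) powr p / p + (1 - 1 / p)" using p by (simp add: diff_divide_distrib)
    then have "t \<le> c * ((t / c) powr p / p + (1 - 1 / p))"
      using c by (simp add: pos_divide_le_eq mult.commute)
    also have "\<dots> = \<alpha> * t powr p + \<beta>"
      using c that by (simp add: \<alpha>_def \<beta>_def powr_divide powr_diff field_simps)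
    finally show ?thesis .
  qed
  have ab: "\<alpha> \<ge> 0" "\<beta> \<ge> 0" using p c by (auto simp: \<alpha>_def \<beta>_def)
  have "ennreal z \<le> (\<integral>\<^sup>+x. ennreal (w x * v x) \<partial>M)" by (rule z)
  also have "\<dots> \<le> (\<integral>\<^sup>+x. ennreal \<alpha> * ennreal (w x * v x powr p) + ennreal \<beta> * ennreal (w x) \<partial>M)"
  proof (intro nn_integral_mono)
    fix x
    have "w x * v x \<le> w x * (\<alpha> * v x powr p + \<beta>)" by (intro mult_left_mono young nonneg)
    also have "\<dots> = \<alpha> * (w x * v x powr p) + \<beta> * w x" by (simp only: distrib_left mult_ac)
    finally have "ennreal (w x * v x) \<le> ennreal (\<alpha> * (w x * v x powr p) + \<beta> * w x)" by (rule ennreal_leI)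
    also have "\<dots> = ennreal \<alpha> * ennreal (w x * v x powr p) + ennreal \<beta> * ennreal (w x)"
      using ab nonneg by (simp add: ennreal_plus ennreal_mult)
    finally show "ennreal (w x * v x) \<le> ennreal \<alpha> * ennreal (w x * v x powr p) + ennreal \<beta> * ennreal (w x)" .
  qed
  also have "\<dots> = ennreal \<alpha> * (\<integral>\<^sup>+x. ennreal (w x * v x powr p) \<partial>M) + ennreal \<beta> * (\<integral>\<^sup>+x. ennreal (w x) \<partial>M)"
    by (subst nn_integral_add) (simp_all add: nn_integral_cmult)
  also have "\<dots> = ennreal (\<alpha> * i + \<beta> * A)"
    unfolding A(1) i(2) using ab i A
    by (subst ennreal_plus) (auto simp del: ennreal_plus simp add: ennreal_mult)
  finally have "z \<le> \<alpha> * i + \<beta> * A"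
    using ab i A by (subst (asm) ennreal_le_iff) auto
  also have "\<beta> * A = z * (1 - 1 / p)" using A by (simp add: c_def \<beta>_def)
  finally have "z / p \<le> \<alpha> * i" by (simp add: algebra_simps)
  then have "z \<le> c powr (1 - p) * i" using p by (simp add: \<alpha>_def divide_le_cancel)
  then have "z * c powr (p - 1) \<le> c powr (1 - p) * i * c powr (p - 1)"
    by (intro mult_right_mono) auto
  also have "\<dots> = i" using c by (simp add: powr_diff field_simps)
  finally have "z * c powr (p - 1) \<le> i" .
  then have "A powr (p - 1) * (z * c powr (p - 1)) \<le> A powr (p - 1) * i"
    by (intro mult_left_mono) auto
  also have "A powr (p - 1) * (z * c powr (p - 1)) = z powr p"
    using z0 A by (simp add: c_def powr_divide powr_diff)
  finally show ?thesis unfolding i(2) using i by (simp add: ennreal_mult[symmetric] ennreal_leI)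
qed

text \<open>
  The dual Hardy operator along the ray from \<open>a\<close> through \<open>x\<close>: it collects the contribution of the scales above \<open>|x - a|\<close>.
\<close>

definition radial_tail :: "real \<Rightarrow> 'a::euclidean_space \<Rightarrow> ('a \<Rightarrow> real) \<Rightarrow> 'a \<Rightarrow> ennreal" where
  "radial_tail s a W x = (\<integral>\<^sup>+\<theta>. ennreal (indicator {1..} \<theta> * (\<theta> powr (s - 1) * W (a + \<theta> *\<^sub>R (x - a)))) \<partial>lborel)"

text \<open>
  The scales are split at \<open>\<rho> = |x - a|\<close>. For a larger \<open>\<rho>\<close> the Gaussian average at \<open>x\<close> is compared not with \<open>W x\<close>, but with
  \<open>W\<close> at the point of the same ray at distance \<open>\<rho>\<close> from \<open>a\<close>, which is within \<open>\<rho>\<close> of \<open>x\<close>. Substituting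
  \<open>\<rho> = |x - a| \<theta>\<close> produces the radial tail.
\<close>

lemma far_pointwise_bound:
  fixes f :: "'a::euclidean_space \<Rightarrow> complex"
  assumes s: "s > 0" and f: "f \<in> test_functions UNIV" and r: "x \<noteq> a"
    and W: "W = nabla_max s f"
  shows "ennreal (norm (f x)) \<le> ennreal (exp 1 * 2 ^ DIM('a) * (1 + 1 / s) / riesz_const s * norm (x - a) powr s) * (ennreal (W x) + radial_tail s a W x)"
proof -
  let ?T = "ennreal (W x) + radial_tail s a W x"
  define g where "g = abs_nabla_powr s f"
  have [measurable]: "g \<in> borel_measurable borel" unfolding g_def by (rule abs_nabla_powr_borel[OF f])
  obtain B where B: "\<And>y. norm (g y) \<le> B" using abs_nabla_powr_bounded[of s f] by (auto simp: g_def)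
  have Wg: "W = hl_maxr (\<lambda>y. norm (g y))" by (simp add: W g_def)
  have [measurable]: "W \<in> borel_measurable borel" unfolding W by measurable
  have W0: "W y \<ge> 0" for y by (simp add: W)
  define r where "r = norm (x - a)"
  let ?w = "\<lambda>\<rho>. W (a + (\<rho> / r) *\<^sub>R (x - a))"
  have r: "r > 0" using \<open>x \<noteq> a\<close> by (simp add: r_def)
  have rc: "riesz_const s > 0" by (rule riesz_const_pos[OF s])
  let ?K = "exp 1 * 2 ^ DIM('a) :: real"
  let ?f1 = "\<lambda>\<rho>. ennreal (s * \<rho> powr (s - 1)) * indicator {0<..<r} \<rho>"
  let ?f2 = "\<lambda>\<rho>. ennreal (indicator {r..} \<rho> * (\<rho> powr (s - 1) * ?w \<rho>))"
  have pt: "ennreal (norm (heat_density s g x \<rho>)) \<le> ennreal (?K * W x / s) * ?f1 \<rho> + ennreal ?K * ?f2 \<rho>" for \<rho>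
  proof -
    consider "\<rho> \<le> 0" | "0 < \<rho>" "\<rho> < r" | "\<rho> \<ge> r" by linarith
    then show ?thesis
    proof cases
      case 2
      have "norm (heat \<rho> g x) \<le> exp (0\<^sup>2 / 4) * 2 ^ DIM('a) * W x"
        unfolding Wg using 2 by (intro heat_le_hl_maxr[OF _ B]) auto
      also have "\<dots> \<le> ?K * W x" using W0 by (intro mult_right_mono) auto
      finally have "\<rho> powr (s - 1) * norm (heat \<rho> g x) \<le> \<rho> powr (s - 1) * (?K * W x)"
        by (intro mult_left_mono) auto
      also have "\<dots> = ?K * W x / s * (s * \<rho> powr (s - 1))" using s by simp
      finally show ?thesis using 2 W0[of x] s by (simp add: norm_mult ennreal_leI flip: ennreal_mult)
    next
      case 3
      then have \<rho>: "\<rho> > 0" using r by linarith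
      have "x - (a + (\<rho> / r) *\<^sub>R (x - a)) = (1 - \<rho> / r) *\<^sub>R (x - a)"
        by (simp add: algebra_simps)
      then have "norm (x - (a + (\<rho> / r) *\<^sub>R (x - a))) = \<bar>1 - \<rho> / r\<bar> * r" by (simp add: r_def)
      also have "\<bar>1 - \<rho> / r\<bar> = \<rho> / r - 1" using 3 r by simp
      also have "(\<rho> / r - 1) * r \<le> 1 * \<rho>" using r by (simp add: left_diff_distrib)
      finally have "norm (heat \<rho> g x) \<le> exp (1\<^sup>2 / 4) * 2 ^ DIM('a) * ?w \<rho>"
        unfolding Wg using \<rho> by (intro heat_le_hl_maxr[OF _ B]) auto
      also have "\<dots> \<le> ?K * ?w \<rho>" using W0 by (intro mult_right_mono) auto
      finally have "\<rho> powr (s - 1) * norm (heat \<rho> g x) \<le> \<rho> powr (s - 1) * (?K * ?w \<rho>)"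
        by (intro mult_left_mono) auto
      also have "\<dots> = ?K * (\<rho> powr (s - 1) * ?w \<rho>)" by simp
      finally show ?thesis using 3 \<rho> W0 by (simp add: norm_mult ennreal_leI flip: ennreal_mult)
    qed auto
  qed
  have f2: "(\<integral>\<^sup>+\<rho>. ?f2 \<rho> \<partial>lborel) = ennreal (r powr s) * radial_tail s a W x"
  proof -
    have "(\<integral>\<^sup>+\<rho>. ?f2 \<rho> \<partial>lborel) = ennreal \<bar>r\<bar> * (\<integral>\<^sup>+\<theta>. ?f2 (0 + r * \<theta>) \<partial>lborel)"
      using r by (intro nn_integral_real_affine) auto
    also have "(\<lambda>\<theta>. ?f2 (0 + r * \<theta>)) = (\<lambda>\<theta>. ennreal (r powr (s - 1)) * ennreal (indicator {1..} \<theta> * (\<theta> powr (s - 1) * W (a + \<theta> *\<^sub>R (x - a)))))"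
      using r W0 by (auto simp: fun_eq_iff indicator_def powr_mult ennreal_mult[symmetric] mult_ac)
    also have "ennreal \<bar>r\<bar> * (\<integral>\<^sup>+\<theta>. ennreal (r powr (s - 1)) * ennreal (indicator {1..} \<theta> * (\<theta> powr (s - 1) * W (a + \<theta> *\<^sub>R (x - a)))) \<partial>lborel)
       = ennreal \<bar>r\<bar> * (ennreal (r powr (s - 1)) * radial_tail s a W x)"
      unfolding radial_tail_def by (subst nn_integral_cmult) auto
    also have "\<dots> = ennreal (r powr s) * radial_tail s a W x"
      using r by (simp add: mult.assoc[symmetric] ennreal_mult[symmetric] powr_diff)
    finally show ?thesis .
  qed
  have "ennreal (riesz_const s) * ennreal (norm (f x)) = ennreal (norm (of_real (riesz_const s) * f x))"
    using rc by (simp add: norm_mult ennreal_mult)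
  also have "\<dots> \<le> (\<integral>\<^sup>+\<rho>. ennreal (norm (heat_density s g x \<rho>)) \<partial>lborel)"
    unfolding g_def test_function_eq_heat_integral(2)[OF f s] by (rule norm_integral_le_nn_integral)
  also have "\<dots> \<le> (\<integral>\<^sup>+\<rho>. ennreal (?K * W x / s) * ?f1 \<rho> + ennreal ?K * ?f2 \<rho> \<partial>lborel)"
    by (intro nn_integral_mono pt)
  also have "\<dots> = ennreal (?K * W x / s) * (\<integral>\<^sup>+\<rho>. ?f1 \<rho> \<partial>lborel) + ennreal ?K * (\<integral>\<^sup>+\<rho>. ?f2 \<rho> \<partial>lborel)"
    by (subst nn_integral_add) (simp_all add: nn_integral_cmult)
  also have "(\<integral>\<^sup>+\<rho>. ?f1 \<rho> \<partial>lborel) = ennreal (r powr s)"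
    using s r by (intro nn_integral_powr_Ioo) auto
  also have "ennreal (?K * W x / s) * ennreal (r powr s) + ennreal ?K * (\<integral>\<^sup>+\<rho>. ?f2 \<rho> \<partial>lborel)
     = ennreal (?K / s * r powr s) * ennreal (W x) + ennreal (?K * r powr s) * radial_tail s a W x"
  proof -
    have "ennreal (?K * W x / s) * ennreal (r powr s) = ennreal (?K / s * r powr s) * ennreal (W x)"
      using s W0[of x] by (subst ennreal_mult[symmetric], simp, simp)+ (simp add: mult_ac)
    moreover have "ennreal ?K * (ennreal (r powr s) * radial_tail s a W x) = ennreal (?K * r powr s) * radial_tail s a W x"
      by (subst ennreal_mult) (simp_all add: mult.assoc)
    ultimately show ?thesis unfolding f2 by simp
  qed
  also have "\<dots> \<le> ennreal (?K * (1 + 1 / s) * r powr s) * ennreal (W x) + ennreal (?K * (1 + 1 / s) * r powr s) * radial_tail s a W x"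
    using s by (intro add_mono mult_right_mono ennreal_leI) (auto simp: field_simps)
  also have "\<dots> = ennreal (?K * (1 + 1 / s) * r powr s) * ?T"
    by (simp only: distrib_left)
  finally have le: "ennreal (riesz_const s) * ennreal (norm (f x)) \<le> ennreal (?K * (1 + 1 / s) * r powr s) * ?T" .
  have "ennreal (norm (f x)) = ennreal (1 / riesz_const s) * (ennreal (riesz_const s) * ennreal (norm (f x)))"
    using rc by (simp add: mult.assoc[symmetric] ennreal_mult[symmetric])
  also have "\<dots> \<le> ennreal (1 / riesz_const s) * (ennreal (?K * (1 + 1 / s) * r powr s) * ?T)"
    by (intro mult_left_mono le) auto
  also have "\<dots> = ennreal (?K * (1 + 1 / s) / riesz_const s * r powr s) * ?T"
    using rc s by (simp add: mult.assoc[symmetric] ennreal_mult[symmetric])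
  finally show ?thesis by (simp only: r_def)
qed

text \<open>
  The right-hand side of Jensen's inequality for the radial tail. The parameter \<open>\<eta>\<close> splits \<open>\<theta>^(s-1)\<close> into the finite
  weight \<open>\<theta>^(-1-\<eta>)\<close> and a factor \<open>\<theta>^(s+\<eta>)\<close> that goes into the \<open>p\<close>-th power.
\<close>

definition radial_tail_power :: "real \<Rightarrow> real \<Rightarrow> real \<Rightarrow> 'a::euclidean_space \<Rightarrow> ('a \<Rightarrow> real) \<Rightarrow> 'a \<Rightarrow> ennreal" where
  "radial_tail_power p s \<eta> a W x = (\<integral>\<^sup>+\<theta>. ennreal (indicator {1..} \<theta> * \<theta> powr (- 1 - \<eta>) * (\<theta> powr (s + \<eta>) * W (a + \<theta> *\<^sub>R (x - a))) powr p) \<partial>lborel)"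

lemma radial_tail_le_power:
  fixes W :: "'a::euclidean_space \<Rightarrow> real"
  assumes [measurable]: "W \<in> borel_measurable borel" and W0: "\<And>y. W y \<ge> 0" and p: "p > 1" and \<eta>: "\<eta> > 0"
    and z: "z \<ge> 0" "ennreal z \<le> radial_tail s a W x"
  shows "ennreal (z powr p) \<le> ennreal ((1 / \<eta>) powr (p - 1)) * radial_tail_power p s \<eta> a W x"
  unfolding radial_tail_power_def
proof (rule nn_integral_Hoelder_weight)
  let ?v = "\<lambda>\<theta>. \<theta> powr (s + \<eta>) * W (a + \<theta> *\<^sub>R (x - a))"
  show "(\<integral>\<^sup>+\<theta>. ennreal (indicator {1..} \<theta> * \<theta> powr (- 1 - \<eta>)) \<partial>lborel) = ennreal (1 / \<eta>)"
    using nn_integral_powr_Ici[of "- 1 - \<eta>" 1] \<eta>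
    by (simp add: ennreal_mult' ennreal_indicator mult.commute)
  have pw: "\<theta> powr (s - 1) * W (a + \<theta> *\<^sub>R (x - a)) = \<theta> powr (- 1 - \<eta>) * ?v \<theta>" if "\<theta> \<ge> 1" for \<theta>
    using that by (simp add: mult.assoc[symmetric] powr_add[symmetric])
  have "radial_tail s a W x = (\<integral>\<^sup>+\<theta>. ennreal (indicator {1..} \<theta> * \<theta> powr (- 1 - \<eta>) * ?v \<theta>) \<partial>lborel)"
    unfolding radial_tail_def
  proof (intro nn_integral_cong)
    fix \<theta> :: real
    show "ennreal (indicator {1..} \<theta> * (\<theta> powr (s - 1) * W (a + \<theta> *\<^sub>R (x - a)))) =
      ennreal (indicator {1..} \<theta> * \<theta> powr (- 1 - \<eta>) * ?v \<theta>)"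
    proof (cases "\<theta> \<ge> 1")
      case True
      then show ?thesis by (simp only: pw mult.assoc)
    qed simp
  qed
  then show "ennreal z \<le> (\<integral>\<^sup>+\<theta>. ennreal (indicator {1..} \<theta> * \<theta> powr (- 1 - \<eta>) * ?v \<theta>) \<partial>lborel)"
    using z by simp
qed (use W0 p \<eta> z in auto)

text \<open>
  The choice of \<open>\<eta>\<close> is the one for which the power \<open>\<theta>^((s+\<eta>)p)\<close> is exactly the Jacobian \<open>\<theta>\<^sup>d\<close> of the dilation by
  \<open>\<theta>\<close> about \<open>a\<close>. A positive \<open>\<eta>\<close> of this kind exists precisely when \<open>s < d/p\<close>.
\<close>

lemma nn_integral_radial_tail_power:
  fixes W :: "'a::euclidean_space \<Rightarrow> real"
  assumes [measurable]: "W \<in> borel_measurable borel" and W0: "\<And>y. W y \<ge> 0" and p: "p > 0" and \<eta>: "\<eta> > 0"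
    and eq: "(s + \<eta>) * p = real DIM('a)"
  shows "(\<integral>\<^sup>+x. radial_tail_power p s \<eta> a W x \<partial>lborel) = ennreal (1 / \<eta>) * (\<integral>\<^sup>+x. ennreal (W x powr p) \<partial>lborel)"
proof -
  let ?I = "\<integral>\<^sup>+x. ennreal (W x powr p) \<partial>lborel"
  let ?h = "\<lambda>\<theta> x. ennreal (indicator {1..} \<theta> * \<theta> powr (- 1 - \<eta>) * (\<theta> powr (s + \<eta>) * W (a + \<theta> *\<^sub>R (x - a))) powr p)"
  have "(\<integral>\<^sup>+x. radial_tail_power p s \<eta> a W x \<partial>lborel)
     = (\<integral>\<^sup>+\<theta>. (\<integral>\<^sup>+x. ?h \<theta> x \<partial>lborel) \<partial>lborel)"
    unfolding radial_tail_power_def by (rule lborel_pair.Fubini') measurable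
  also have "\<dots> = (\<integral>\<^sup>+\<theta>. ?I * (ennreal (\<theta> powr (- 1 - \<eta>)) * indicator {1..} \<theta>) \<partial>lborel)"
  proof (intro nn_integral_cong)
    fix \<theta> :: real
    show "(\<integral>\<^sup>+x. ?h \<theta> x \<partial>lborel)
      = ?I * (ennreal (\<theta> powr (- 1 - \<eta>)) * indicator {1..} \<theta>)"
    proof (cases "\<theta> \<ge> 1")
      case True
      have pw: "(\<theta> powr (s + \<eta>) * W y) powr p = \<theta> ^ DIM('a) * W y powr p" for y
        using True W0[of y] eq by (simp add: powr_mult powr_powr powr_realpow)
      have "(\<integral>\<^sup>+x. ?h \<theta> x \<partial>lborel)
         = (\<integral>\<^sup>+x. ennreal (\<theta> powr (- 1 - \<eta>)) * (ennreal (\<theta> ^ DIM('a)) * ennreal (W ((a - \<theta> *\<^sub>R a) + \<theta> *\<^sub>R x) powr p)) \<partial>lborel)"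
      proof (intro nn_integral_cong)
        fix x
        have "a + \<theta> *\<^sub>R (x - a) = (a - \<theta> *\<^sub>R a) + \<theta> *\<^sub>R x" by (simp add: algebra_simps)
        then show "?h \<theta> x
          = ennreal (\<theta> powr (- 1 - \<eta>)) * (ennreal (\<theta> ^ DIM('a)) * ennreal (W ((a - \<theta> *\<^sub>R a) + \<theta> *\<^sub>R x) powr p))"
          using True by (simp only: pw) (simp add: ennreal_mult mult.assoc)
      qed
      also have "\<dots> = ennreal (\<theta> powr (- 1 - \<eta>)) * (ennreal (\<theta> ^ DIM('a)) * (\<integral>\<^sup>+x. ennreal (W ((a - \<theta> *\<^sub>R a) + \<theta> *\<^sub>R x) powr p) \<partial>lborel))"
        by (simp add: nn_integral_cmult)
      also have "ennreal (\<theta> ^ DIM('a)) * (\<integral>\<^sup>+x. ennreal (W ((a - \<theta> *\<^sub>R a) + \<theta> *\<^sub>R x) powr p) \<partial>lborel) = ?I"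
        using True by (intro nn_integral_lborel_affine[symmetric]) auto
      finally show ?thesis using True by (simp add: mult.commute)
    qed simp
  qed
  also have "\<dots> = ?I * (\<integral>\<^sup>+\<theta>. ennreal (\<theta> powr (- 1 - \<eta>)) * indicator {1..} \<theta> \<partial>lborel)"
    by (intro nn_integral_cmult) measurable
  also have "(\<integral>\<^sup>+\<theta>. ennreal (\<theta> powr (- 1 - \<eta>)) * indicator {1..} \<theta> \<partial>lborel) = ennreal (1 / \<eta>)"
    using nn_integral_powr_Ici[of "- 1 - \<eta>" 1] \<eta> by simp
  finally show ?thesis by (simp add: mult.commute)
qed

lemma borel_measurable_radial_tail_power:
  fixes W :: "'a::euclidean_space \<Rightarrow> real"
  assumes [measurable]: "W \<in> borel_measurable borel"
  shows "radial_tail_power p s \<eta> a W \<in> borel_measurable borel"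
  unfolding radial_tail_power_def[abs_def] by measurable

section \<open>Convex obstacles\<close>

text \<open>
  Let \<open>y\<close> be the point of \<open>K\<close> nearest to \<open>x\<close>. Moving from \<open>x\<close> towards \<open>a\<close> by the fraction \<open>\<tau>\<close> leads to
  \<open>(1 - \<tau>) y + \<tau> a\<close> up to an error \<open>(1 - \<tau>) (x - y)\<close> of length at most \<open>\<delta>\<close>, whereas by convexity
  \<open>K\<close> contains the ball of radius \<open>\<tau> r0\<close> about that point. With \<open>\<tau> = 4 j \<delta> / r0\<close> there is room for
  the error and for the perturbation \<open>j w\<close>, since \<open>\<delta> + 2 j \<delta> \<le> 4 j \<delta>\<close>.
\<close>

lemma convex_obstacle_shift:
  fixes K :: "'a::euclidean_space set"
  assumes K: "convex K" "closed K" and ball: "cball a r0 \<subseteq> K" and r0: "r0 > 0"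
    and \<delta>: "\<delta> = infdist x K" and small: "4 * real m * \<delta> \<le> r0"
    and w: "norm w \<le> 2 * \<delta>" and j: "1 \<le> j" "j \<le> m" "\<delta> > 0"
  shows "x + real j *\<^sub>R ((4 * \<delta> / r0) *\<^sub>R (a - x) + w) \<in> K"
proof -
  have "a \<in> K" using ball r0 by auto
  then obtain y where y: "y \<in> K" "\<delta> = dist x y"
    using infdist_attains_inf[OF K(2), of x] \<delta> by auto
  define \<tau> where "\<tau> = real j * (4 * \<delta> / r0)"
  have \<tau>0: "\<tau> > 0" using j r0 by (simp add: \<tau>_def)
  have \<tau>1: "\<tau> \<le> 1"
  proof -
    have "real j * (4 * \<delta>) \<le> real m * (4 * \<delta>)" using j by (intro mult_right_mono) auto
    then have "real j * (4 * \<delta>) \<le> r0" using small by simp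
    then show ?thesis using r0 by (simp add: \<tau>_def divide_le_eq)
  qed
  \<comment> \<open>The point of the ball about \<open>a\<close> whose convex combination with \<open>y\<close> is the given point.\<close>
  define b where "b = a + (1 / \<tau>) *\<^sub>R ((1 - \<tau>) *\<^sub>R (x - y) + real j *\<^sub>R w)"
  have "norm ((1 - \<tau>) *\<^sub>R (x - y) + real j *\<^sub>R w) \<le> \<delta> + real j * (2 * \<delta>)"
  proof (intro norm_triangle_le add_mono)
    show "norm ((1 - \<tau>) *\<^sub>R (x - y)) \<le> \<delta>"
      using \<tau>0 \<tau>1 y j by (simp add: dist_norm mult_left_le_one_le)
    show "norm (real j *\<^sub>R w) \<le> real j * (2 * \<delta>)" using w by (simp add: mult_left_mono)
  qed
  also have "\<dots> \<le> real j * (4 * \<delta>)"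
  proof -
    have "1 * \<delta> \<le> real j * \<delta>" using j by (intro mult_right_mono) auto
    then show ?thesis using j by (simp add: algebra_simps)
  qed
  also have "\<dots> = \<tau> * r0" using r0 by (simp add: \<tau>_def)
  finally have "norm (b - a) \<le> r0"
    using \<tau>0 by (simp add: b_def divide_le_eq mult.commute)
  then have "b \<in> K" using ball by (auto simp: dist_norm norm_minus_commute)
  then have "(1 - \<tau>) *\<^sub>R y + \<tau> *\<^sub>R b \<in> K"
    using K(1) y \<tau>0 \<tau>1 by (intro convexD) auto
  also have "(1 - \<tau>) *\<^sub>R y + \<tau> *\<^sub>R b = x + real j *\<^sub>R ((4 * \<delta> / r0) *\<^sub>R (a - x) + w)"
  proof -
    have "\<tau> *\<^sub>R b = \<tau> *\<^sub>R a + ((1 - \<tau>) *\<^sub>R (x - y) + real j *\<^sub>R w)"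
      using \<tau>0 by (simp add: b_def scaleR_add_right)
    then have "(1 - \<tau>) *\<^sub>R y + \<tau> *\<^sub>R b = x + \<tau> *\<^sub>R (a - x) + real j *\<^sub>R w"
      by (simp add: algebra_simps)
    then show ?thesis by (simp add: \<tau>_def scaleR_add_right)
  qed
  finally show ?thesis .
qed

lemma test_function_vanishes: "f \<in> test_functions \<Omega> \<Longrightarrow> x \<notin> \<Omega> \<Longrightarrow> f x = 0"
  using closure_subset[of "{x. f x \<noteq> 0}"] by (auto simp: test_functions_def)

abbreviation hardy_ratio :: "'a::euclidean_space set \<Rightarrow> real \<Rightarrow> ('a \<Rightarrow> complex) \<Rightarrow> 'a \<Rightarrow> real" where
  "hardy_ratio \<Omega> s f x \<equiv> norm (f x) / infdist x (- \<Omega>) powr s"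

abbreviation hardy_majorant ::
  "real \<Rightarrow> real \<Rightarrow> real \<Rightarrow> 'a::euclidean_space \<Rightarrow> ('a \<Rightarrow> real) \<Rightarrow> 'a \<Rightarrow> ennreal" where
  "hardy_majorant p s \<eta> a W x \<equiv>
     ennreal (W x powr p) + ennreal (hl_maxr W x powr p) + radial_tail_power p s \<eta> a W x"

text \<open>
  The near and the far estimate are joined at distance \<open>R0\<close>, which is small enough for all \<open>m\<close> shifted points to
  fall into the obstacle, and beyond which \<open>|x - a|\<close> is at most a constant times the distance. The bound is stated
  with \<open>p\<close>-th powers, as the radial tail is only controlled after Jensen's inequality.
\<close>

lemma hardy_pointwise:
  fixes \<Omega> :: "'a::euclidean_space set" and s p \<eta> :: real
  assumes s: "s > 0" and p: "p > 1" and \<eta>: "\<eta> > 0"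
    and K: "compact (- \<Omega>)" "convex (- \<Omega>)" and ball: "cball a r0 \<subseteq> - \<Omega>" and r0: "r0 > 0"
  shows "\<exists>C>0. \<forall>f\<in>test_functions \<Omega>. \<forall>x\<in>\<Omega>. \<forall>W. W = nabla_max s f \<longrightarrow>
    ennreal (hardy_ratio \<Omega> s f x powr p)
      \<le> ennreal C * hardy_majorant p s \<eta> a W x"
proof -
  have closed: "closed (- \<Omega>)" using K by (simp add: compact_imp_closed)
  have "a \<in> cball a r0" using r0 by simp
  then have aK: "a \<in> - \<Omega>" using ball by blast
  obtain D where D: "D > 0" "\<And>y. y \<in> - \<Omega> \<Longrightarrow> norm (y - a) \<le> D"
  proof -
    have "bounded (- \<Omega>)" using K by (simp add: compact_imp_bounded)
    then obtain e where e: "\<forall>y\<in>- \<Omega>. dist a y \<le> e" using bounded_any_center by blast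
    show ?thesis
      by (rule that[of "max e 1"]) (use e in \<open>auto simp: dist_norm norm_minus_commute intro: max.coboundedI1\<close>)
  qed
  have pos: "infdist x (- \<Omega>) > 0" if "x \<in> \<Omega>" for x
    using that closed aK by (metis Compl_iff empty_iff in_closed_iff_infdist_zero infdist_nonneg order_le_less)
  have da: "norm (x - a) \<le> infdist x (- \<Omega>) + D" for x
  proof -
    obtain y where y: "y \<in> - \<Omega>" "infdist x (- \<Omega>) = dist x y"
      using infdist_attains_inf[OF closed, of x] aK by auto
    have "norm (x - a) \<le> norm (x - y) + norm (y - a)"
      using norm_triangle_ineq[of "x - y" "y - a"] by simp
    then show ?thesis using y D(2)[of y] by (simp add: dist_norm)
  qed
  define m where "m = Suc (nat \<lceil>s\<rceil>)"
  have m: "s < real m" "m \<ge> 1" using s by (auto simp: m_def) linarith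
  define R0 where "R0 = r0 / (4 * real m)"
  have R0: "R0 > 0" using r0 m by (simp add: R0_def)
  define \<Lambda> where "\<Lambda> = 4 * (R0 + D) / r0"
  have \<Lambda>: "\<Lambda> \<ge> 0" using R0 D r0 by (simp add: \<Lambda>_def)
  obtain C1 where C1: "C1 > 0" and near: "\<And>(f :: 'a \<Rightarrow> complex) x h0 \<delta> W.
     f \<in> test_functions UNIV \<Longrightarrow> \<delta> > 0 \<Longrightarrow> norm h0 \<le> \<Lambda> * \<delta> \<Longrightarrow>
     (\<forall>w\<in>ball 0 (2 * \<delta>). \<forall>j\<in>{1..m}. f (x + real j *\<^sub>R (h0 + w)) = 0) \<Longrightarrow>
     W = nabla_max s f \<Longrightarrow>
     norm (f x) \<le> C1 * \<delta> powr s * (W x + hl_maxr W x)"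
    using near_pointwise_bound[OF \<Lambda> _ s m(1), of 2, where 'a='a] by auto
  define C2 where "C2 = exp 1 * 2 ^ DIM('a) * (1 + 1 / s) / riesz_const s * (1 + D / R0) powr s"
  have "1 + D / R0 > 0" using D R0 by (intro add_pos_pos divide_pos_pos) auto
  then have C2: "C2 > 0" using s riesz_const_pos[OF s] D R0
    by (auto simp: C2_def intro!: mult_pos_pos divide_pos_pos add_pos_pos)
  define C where "C = (2 * C1) powr p + (2 * C2) powr p * (1 + (1 / \<eta>) powr (p - 1))"
  have C: "C > 0" using C1 by (auto simp: C_def intro!: add_pos_nonneg)
  have "ennreal (hardy_ratio \<Omega> s f x powr p)
      \<le> ennreal C * hardy_majorant p s \<eta> a W x"
    if f: "f \<in> test_functions \<Omega>" and x: "x \<in> \<Omega>" and W: "W = nabla_max s f" for f x W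
  proof -
    have fU: "f \<in> test_functions UNIV" using f test_functions_mono[of \<Omega> UNIV] by auto
    have [measurable]: "W \<in> borel_measurable borel" unfolding W by measurable
    have W0: "W y \<ge> 0" for y by (simp add: W)
    define \<delta> where "\<delta> = infdist x (- \<Omega>)"
    have \<delta>: "\<delta> > 0" using pos[OF x] by (simp add: \<delta>_def)
    define z where "z = norm (f x) / \<delta> powr s"
    have z0: "z \<ge> 0" by (simp add: z_def)
    let ?T = "radial_tail_power p s \<eta> a W x"
    let ?t = "radial_tail s a W x"
    let ?S = "ennreal (W x powr p) + ennreal (hl_maxr W x powr p) + ?T"
    have "ennreal (z powr p) \<le> ennreal C * ?S"
    proof (cases "\<delta> \<le> R0")
      case True
      define h0 where "h0 = (4 * \<delta> / r0) *\<^sub>R (a - x)"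
      have small: "4 * real m * \<delta> \<le> r0" using True m by (simp add: R0_def field_simps)
      have "norm h0 = 4 * \<delta> / r0 * norm (x - a)"
        using \<delta> r0 by (simp add: h0_def norm_minus_commute)
      also have "\<dots> \<le> 4 * \<delta> / r0 * (R0 + D)"
        using da[of x] True \<delta> r0 by (intro mult_left_mono) (auto simp: \<delta>_def)
      also have "\<dots> = \<Lambda> * \<delta>" by (simp add: \<Lambda>_def)
      finally have h0: "norm h0 \<le> \<Lambda> * \<delta>" .
      have "f (x + real j *\<^sub>R (h0 + w)) = 0" if "w \<in> ball 0 (2 * \<delta>)" "j \<in> {1..m}" for w j
      proof (rule test_function_vanishes[OF f])
        have "x + real j *\<^sub>R ((4 * \<delta> / r0) *\<^sub>R (a - x) + w) \<in> - \<Omega>"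
          using that \<delta> by (intro convex_obstacle_shift[OF K(2) closed ball r0 \<delta>_def small]) auto
        then show "x + real j *\<^sub>R (h0 + w) \<notin> \<Omega>" by (simp add: h0_def)
      qed
      then have "norm (f x) \<le> C1 * \<delta> powr s * (W x + hl_maxr W x)"
        by (intro near[OF fU \<delta> h0 _ W]) auto
      then have "z \<le> C1 * (W x + hl_maxr W x)"
        using \<delta> by (simp add: z_def divide_le_eq mult_ac)
      also have "\<dots> \<le> (2 * C1) * max (W x) (hl_maxr W x)" using C1 by simp
      finally have "z powr p \<le> ((2 * C1) * max (W x) (hl_maxr W x)) powr p"
        using z0 p by (intro powr_mono2) auto
      also have "\<dots> = (2 * C1) powr p * max (W x) (hl_maxr W x) powr p"
        using C1 W0[of x] by (intro powr_mult)
      also have "\<dots> \<le> C * (W x powr p + hl_maxr W x powr p)"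
        by (intro mult_mono) (auto simp: C_def max_def)
      finally have "ennreal (z powr p) \<le> ennreal (C * (W x powr p + hl_maxr W x powr p))" by (rule ennreal_leI)
      also have "\<dots> = ennreal C * (ennreal (W x powr p) + ennreal (hl_maxr W x powr p))"
        using C by (simp add: ennreal_mult)
      also have "\<dots> \<le> ennreal C * ?S" by (intro mult_left_mono) auto
      finally show ?thesis .
    next
      case False
      have xa: "x \<noteq> a" using x aK by auto
      have "norm (x - a) \<le> \<delta> * (1 + D / R0)"
      proof -
        have "D = R0 * (D / R0)" using R0 by simp
        also have "\<dots> \<le> \<delta> * (D / R0)" using False D R0 by (intro mult_right_mono) auto
        finally show ?thesis using da[of x] by (simp add: \<delta>_def[symmetric] distrib_left)
      qed
      then have "norm (x - a) powr s \<le> (\<delta> * (1 + D / R0)) powr s"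
        using s by (intro powr_mono2) auto
      also have "\<dots> = \<delta> powr s * (1 + D / R0) powr s" using \<delta> D R0 by (intro powr_mult)
      finally have "exp 1 * 2 ^ DIM('a) * (1 + 1 / s) / riesz_const s * norm (x - a) powr s
          \<le> exp 1 * 2 ^ DIM('a) * (1 + 1 / s) / riesz_const s * (\<delta> powr s * (1 + D / R0) powr s)"
        using s riesz_const_pos[OF s] by (intro mult_left_mono) auto
      also have "\<dots> = C2 * \<delta> powr s" by (simp add: C2_def)
      finally have "ennreal (norm (f x)) \<le> ennreal (C2 * \<delta> powr s) * (ennreal (W x) + ?t)"
        using far_pointwise_bound[OF s fU xa W] by (meson ennreal_leI mult_right_mono order_trans zero_le)
      then have "ennreal (1 / (C2 * \<delta> powr s)) * ennreal (norm (f x)) \<le> ennreal (1 / (C2 * \<delta> powr s)) * (ennreal (C2 * \<delta> powr s) * (ennreal (W x) + ?t))"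
        by (intro mult_left_mono) auto
      also have "ennreal (1 / (C2 * \<delta> powr s)) * (ennreal (C2 * \<delta> powr s) * (ennreal (W x) + ?t)) = ennreal (W x) + ?t"
        using C2 \<delta> by (simp add: mult.assoc[symmetric] ennreal_mult[symmetric])
      also have "ennreal (1 / (C2 * \<delta> powr s)) * ennreal (norm (f x)) = ennreal (z / C2)"
        using C2 \<delta> by (simp add: ennreal_mult[symmetric] z_def mult.commute)
      finally have le: "ennreal (z / C2) \<le> ennreal (W x) + ?t" .
      have zC: "z powr p = (2 * C2) powr p * (z / (2 * C2)) powr p"
        using C2 z0 by (subst powr_mult[symmetric]) auto
      show ?thesis
      \<comment> \<open>One of the two summands is at least half of their sum; either alone gives the claim.\<close>
      proof (cases "z / (2 * C2) \<le> W x")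
        case True
        have "z powr p \<le> (2 * C2) powr p * W x powr p"
          unfolding zC using True C2 z0 p by (intro mult_left_mono powr_mono2) auto
        also have "\<dots> \<le> C * W x powr p" by (intro mult_right_mono) (auto simp: C_def distrib_left)
        finally have "ennreal (z powr p) \<le> ennreal C * ennreal (W x powr p)"
          using C by (simp add: ennreal_mult[symmetric] ennreal_leI)
        also have "\<dots> \<le> ennreal C * ?S" by (intro mult_left_mono) (auto simp: add.assoc)
        finally show ?thesis .
      next
        case False
        have "ennreal (z / (2 * C2)) \<le> ?t"
        proof (rule ccontr)
          assume "\<not> ?thesis"
          then have "?t < ennreal (z / (2 * C2))" by simp
          then have "ennreal (W x) + ?t < ennreal (z / (2 * C2)) + ennreal (z / (2 * C2))"
            using False W0[of x] by (intro add_strict_mono) (auto simp: ennreal_less_iff)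
          also have "\<dots> = ennreal (z / C2)" using z0 C2 by (simp flip: ennreal_plus)
          finally show False using le by simp
        qed
        then have "ennreal ((z / (2 * C2)) powr p) \<le> ennreal ((1 / \<eta>) powr (p - 1)) * ?T"
          using z0 C2 p \<eta> W0 by (intro radial_tail_le_power[where s=s]) auto
        then have "ennreal (z powr p) \<le> ennreal ((2 * C2) powr p) * (ennreal ((1 / \<eta>) powr (p - 1)) * ?T)"
          unfolding zC by (simp add: ennreal_mult mult_left_mono)
        also have "\<dots> = ennreal ((2 * C2) powr p * (1 / \<eta>) powr (p - 1)) * ?T"
          by (simp add: ennreal_mult mult.assoc)
        also have "\<dots> \<le> ennreal C * ?T" by (intro mult_right_mono ennreal_leI) (auto simp: C_def distrib_left)
        also have "\<dots> \<le> ennreal C * ?S" by (intro mult_left_mono) auto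
        finally show ?thesis .
      qed
    qed
    then show ?thesis by (simp add: z_def \<delta>_def)
  qed
  with C show ?thesis by blast
qed

lemma hardy_integral:
  fixes \<Omega> :: "'a::euclidean_space set" and s p :: real
  assumes s: "0 < s" "s < real DIM('a) / p" and p: "p > 1"
    and K: "compact (- \<Omega>)" "convex (- \<Omega>)" "interior (- \<Omega>) \<noteq> {}"
  shows "\<exists>C>0. \<forall>f\<in>test_functions \<Omega>.
    (\<integral>\<^sup>+x\<in>\<Omega>. ennreal (hardy_ratio \<Omega> s f x powr p) \<partial>lborel)
      \<le> ennreal C * (\<integral>\<^sup>+x. ennreal (norm (abs_nabla_powr s f x) powr p) \<partial>lborel)"
proof -
  obtain a r0 where r0: "r0 > 0" "cball a r0 \<subseteq> - \<Omega>"
    using K(3) by (meson ex_in_conv mem_interior_cball)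
  define \<eta> where "\<eta> = real DIM('a) / p - s"
  have \<eta>: "\<eta> > 0" "(s + \<eta>) * p = real DIM('a)" using s p by (auto simp: \<eta>_def)
  obtain C1 where C1: "C1 > 0" and pt: "\<And>f x W. f \<in> test_functions \<Omega> \<Longrightarrow> x \<in> \<Omega> \<Longrightarrow> W = nabla_max s f \<Longrightarrow>
    ennreal (hardy_ratio \<Omega> s f x powr p)
      \<le> ennreal C1 * hardy_majorant p s \<eta> a W x"
    using hardy_pointwise[OF s(1) p \<eta>(1) K(1,2) r0(2,1)] by blast
  define M where "M = 5 ^ DIM('a) * 2 powr p * p / (p - 1)"
  have M: "M > 0" using p by (simp add: M_def)
  have "(\<integral>\<^sup>+x\<in>\<Omega>. ennreal (hardy_ratio \<Omega> s f x powr p) \<partial>lborel)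
      \<le> ennreal (C1 * (M + M * M + 1 / \<eta> * M)) * (\<integral>\<^sup>+x. ennreal (norm (abs_nabla_powr s f x) powr p) \<partial>lborel)"
    if f: "f \<in> test_functions \<Omega>" for f
  proof -
    have fU: "f \<in> test_functions UNIV" using f test_functions_mono[of \<Omega> UNIV] by auto
    define u where "u = (\<lambda>y. norm (abs_nabla_powr s f y))"
    define W where "W = hl_maxr u"
    have [measurable]: "u \<in> borel_measurable borel"
      unfolding u_def using abs_nabla_powr_borel[OF fU, of s] by measurable
    have [measurable]: "W \<in> borel_measurable borel" unfolding W_def by measurable
    have u0: "u y \<ge> 0" for y by (simp add: u_def)
    obtain B where B: "B \<ge> 0" "\<And>y. u y \<le> B" using abs_nabla_powr_bounded[of s f] by (auto simp: u_def)
    have W: "0 \<le> W y" "W y \<le> B" for y using B by (auto simp: W_def intro: hl_maxr_le)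
    let ?I = "\<integral>\<^sup>+x. ennreal (u x powr p) \<partial>lborel"
    let ?J3 = "\<integral>\<^sup>+x. radial_tail_power p s \<eta> a W x \<partial>lborel"
    let ?J2 = "\<integral>\<^sup>+x. ennreal (hl_maxr W x powr p) \<partial>lborel"
    let ?J = "\<integral>\<^sup>+x. ennreal (W x powr p) \<partial>lborel"
    have 1: "?J \<le> ennreal M * ?I"
      unfolding W_def M_def using B u0 p by (intro hl_maxr_strong_type) auto
    have "?J2 \<le> ennreal M * ?J"
      unfolding M_def using W p by (intro hl_maxr_strong_type) auto
    also have "\<dots> \<le> ennreal M * (ennreal M * ?I)" by (intro mult_left_mono 1) auto
    finally have 2: "?J2 \<le> ennreal M * (ennreal M * ?I)" .
    have "?J3 = ennreal (1 / \<eta>) * ?J"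
      using W p \<eta> by (intro nn_integral_radial_tail_power) auto
    also have "\<dots> \<le> ennreal (1 / \<eta>) * (ennreal M * ?I)" by (intro mult_left_mono 1) auto
    finally have 3: "?J3 \<le> ennreal (1 / \<eta>) * (ennreal M * ?I)" .
    have [measurable]: "radial_tail_power p s \<eta> a W \<in> borel_measurable borel"
      by (rule borel_measurable_radial_tail_power) measurable
    have "(\<integral>\<^sup>+x\<in>\<Omega>. ennreal (hardy_ratio \<Omega> s f x powr p) \<partial>lborel)
       \<le> (\<integral>\<^sup>+x. ennreal C1 * hardy_majorant p s \<eta> a W x \<partial>lborel)"
      using pt[OF f _ W_def[unfolded u_def]] by (intro nn_integral_mono) (auto simp: indicator_def)
    also have "\<dots> = ennreal C1 * (?J + ?J2 + ?J3)"
      by (simp add: nn_integral_cmult nn_integral_add)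
    also have "\<dots> \<le> ennreal C1 * (ennreal M * ?I + ennreal M * (ennreal M * ?I) + ennreal (1 / \<eta>) * (ennreal M * ?I))"
      by (intro mult_left_mono add_mono 1 2 3) auto
    also have "\<dots> = ennreal (C1 * (M + M * M + 1 / \<eta> * M)) * ?I"
    proof -
      have "ennreal (C1 * (M + M * M + 1 / \<eta> * M)) = ennreal C1 * (ennreal M + ennreal M * ennreal M + ennreal (1 / \<eta>) * ennreal M)"
        using C1 M \<eta> by (simp only: ennreal_mult[symmetric] ennreal_plus[symmetric] less_imp_le mult_nonneg_nonneg add_nonneg_nonneg zero_le_divide_1_iff)
      then show ?thesis by (simp only: distrib_right mult.assoc)
    qed
    finally show ?thesis by (simp only: u_def)
  qed
  moreover have "C1 * (M + M * M + 1 / \<eta> * M) > 0" using C1 M \<eta> by (intro mult_pos_pos add_pos_pos) auto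
  ultimately show ?thesis by blast
qed

section \<open>The Hardy inequality in terms of norms\<close>

lemma Lp_norm_le:
  assumes le: "(\<integral>\<^sup>+x. ennreal (norm (F x) powr p) \<partial>M) \<le> ennreal C * (\<integral>\<^sup>+x. ennreal (norm (G x) powr p) \<partial>N)"
    and C: "C > 0" and p: "p > 0"
  shows "Lp_norm p M F \<le> ennreal (C powr (1 / p)) * Lp_norm p N G"
proof -
  let ?I = "\<integral>\<^sup>+x. ennreal (norm (F x) powr p) \<partial>M" and ?J = "\<integral>\<^sup>+x. ennreal (norm (G x) powr p) \<partial>N"
  show ?thesis
  proof (cases "?J = top")
    case True
    then show ?thesis using C by (simp add: Lp_norm_def Let_def ennreal_mult_top)
  next
    case False
    then obtain j where j: "?J = ennreal j" "j \<ge> 0" by (cases ?J) auto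
    have "?I \<le> ennreal (C * j)" using le j C by (simp add: ennreal_mult)
    then obtain i where i: "?I = ennreal i" "i \<ge> 0" by (cases ?I) (auto simp: top_unique)
    have "i \<le> C * j" using \<open>?I \<le> ennreal (C * j)\<close> i j C by simp
    then have "i powr (1 / p) \<le> (C * j) powr (1 / p)" using i p by (intro powr_mono2) auto
    also have "\<dots> = C powr (1 / p) * j powr (1 / p)" using C j by (intro powr_mult)
    finally show ?thesis using i j by (simp add: Lp_norm_def Let_def ennreal_mult[symmetric] ennreal_leI)
  qed
qed

theorem lemma5p3:
  fixes \<Omega> :: "'a::euclidean_space set" and p s :: real
  assumes "DIM('a) \<ge> 3"
    and "1 < p"
    and "0 < s" and "s < real DIM('a) / p"
    and "smooth_convex_body (- \<Omega>)"
  shows "\<exists>C::real. C > 0 \<and> (\<forall>f \<in> test_functions \<Omega>.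
           Lp_norm p (lebesgue_on \<Omega>) (\<lambda>x. f x / of_real (infdist x (- \<Omega>) powr s))
             \<le> ennreal C * Lp_norm p lebesgue (abs_nabla_powr s f))"
proof -
  have K: "compact (- \<Omega>)" "convex (- \<Omega>)" "interior (- \<Omega>) \<noteq> {}"
    using assms(5) by (auto simp: smooth_convex_body_def)
  have "closed (- \<Omega>)" using K(1) by (rule compact_imp_closed)
  then have \<Omega>: "\<Omega> \<in> sets borel" by (simp add: open_closed)
  obtain C where C: "C > 0" and hardy: "\<And>f. f \<in> test_functions \<Omega> \<Longrightarrow>
    (\<integral>\<^sup>+x\<in>\<Omega>. ennreal (hardy_ratio \<Omega> s f x powr p) \<partial>lborel)
      \<le> ennreal C * (\<integral>\<^sup>+x. ennreal (norm (abs_nabla_powr s f x) powr p) \<partial>lborel)"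
    using hardy_integral[OF assms(3,4,2) K] by blast
  have "Lp_norm p (lebesgue_on \<Omega>) (\<lambda>x. f x / of_real (infdist x (- \<Omega>) powr s))
          \<le> ennreal (C powr (1 / p)) * Lp_norm p lebesgue (abs_nabla_powr s f)"
    if f: "f \<in> test_functions \<Omega>" for f
  proof (rule Lp_norm_le[OF _ C])
    have "(\<integral>\<^sup>+x. ennreal (norm (f x / of_real (infdist x (- \<Omega>) powr s)) powr p) \<partial>lebesgue_on \<Omega>)
       = (\<integral>\<^sup>+x. ennreal (hardy_ratio \<Omega> s f x powr p) * indicator \<Omega> x \<partial>lebesgue)"
      using \<Omega> by (subst nn_integral_restrict_space) (auto simp: norm_divide)
    also have "\<dots> = (\<integral>\<^sup>+x\<in>\<Omega>. ennreal (hardy_ratio \<Omega> s f x powr p) \<partial>lborel)"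
      by (rule nn_integral_completion)
    also have "\<dots> \<le> ennreal C * (\<integral>\<^sup>+x. ennreal (norm (abs_nabla_powr s f x) powr p) \<partial>lborel)"
      by (rule hardy[OF f])
    finally show "(\<integral>\<^sup>+x. ennreal (norm (f x / of_real (infdist x (- \<Omega>) powr s)) powr p) \<partial>lebesgue_on \<Omega>)
       \<le> ennreal C * (\<integral>\<^sup>+x. ennreal (norm (abs_nabla_powr s f x) powr p) \<partial>lebesgue)"
      by (simp add: nn_integral_completion)
  qed (use assms in auto)
  moreover have "C powr (1 / p) > 0" using C by simp
  ultimately show ?thesis by blast
qed

end
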